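(* Let $\alpha,\beta\in(0,1)$ and $n\ge8$, let $s$ be an even number of bins dividing $n$, and let $V_n$ be an independence V-statistic whose base functions $g_Y,g_Z$ are positive-definite kernels, with finite variance components $\psi_1',\tilde\psi_1',\psi_2'$. Let $\mathbf k((y,z),(y',z'))=g_Y(y,y')g_Z(z,z')$ and suppose $K=\sup_x|\mathbf k(x,x)|<\infty$. Put $\alpha^\star=\frac{\alpha}{2e}(\beta/3)^{1/\lfloor\alpha(B+1)\rfloor}$. If $$\frac14+\frac{\log(6/\alpha^\star)}s+\sqrt{\frac{\log(6/\alpha^\star)}s}<1,$$ then the cheap independence test with $s$ bins, $B$ wild bootstrap permutations and level $\alpha$ based on $V_n$ has power at least $1-\beta$ whenever $$\mathrm{MMD}_{\mathbf k}(\Pi,\mathbb P\times\mathbb Q)\ \ge\ \frac{\sqrt K\big(30+22\sqrt{\log(12/\beta)}\big)\Big(\frac72+\frac{1+12\log(3/\alpha^\star)}{6\sqrt s}+2\sqrt{\log(3/\alpha^\star)}\Big)}{\sqrt n\,\Big(\frac34-\frac{\log(6/\alpha^\star)}s-\sqrt{\frac{\log(6/\alpha^\star)}s}\Big)}.$$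
   Context: Data: $X_i=(Y_i,Z_i)$, $i=1,\dots,n$, i.i.d. from a distribution $\Pi$ with marginals $\mathbb P$ (of $Y_i$) and $\mathbb Q$ (of $Z_i$). Hypotheses: $\mathcal H_0:\Pi=\mathbb P\times\mathbb Q$ versus $\mathcal H_1:\Pi\ne\mathbb P\times\mathbb Q$. Write $[n]=\{1,\dots,n\}$. Independence V-statistic: for symmetric real-valued $g_Y,g_Z$ and $x_i=(y_i,z_i)$, $h_{\mathrm{in}}(x_1,x_2,x_3,x_4)=\big(g_Y(y_1,y_2)+g_Y(y_3,y_4)-g_Y(y_1,y_3)-g_Y(y_2,y_4)\big)\big(g_Z(z_1,z_2)+g_Z(z_3,z_4)-g_Z(z_1,z_3)-g_Z(z_2,z_4)\big)$, $V_n=V(Y,Z)=\frac1{n^4}\sum_{(i_1,i_2,i_3,i_4)\in[n]^4}h_{\mathrm{in}}(X_{i_1},X_{i_2},X_{i_3},X_{i_4})$. Symmetrization: $\bar h_{\mathrm{in}}(x_1,\dots,x_4)=\frac1{4!}\sum h_{\mathrm{in}}(x_{i_1},\dots,x_{i_4})$ over all orderings of $\{1,2,3,4\}$. Wild bootstrap permutation of $[q]$ ($q$ even): a random permutation that, independently for each $i\le q/2$, swaps $i$ and $i+q/2$ with probability $\frac12$ (and fixes both otherwise). Variance components, with $\pi$ a wild bootstrap permutation of $[n]$ independent of the data: $\psi_1'=\mathrm{Var}(\mathbb E[\bar h_{\mathrm{in}}(X_1,X_2,X_3,X_4)\mid X_1])$; $\tilde\psi_1'=\mathrm{Var}(\mathbb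 E[\bar h_{\mathrm{in}}((Y_1,Z_{\pi_1}),\dots,(Y_4,Z_{\pi_4}))\mid Y_1,Z_{\pi_1},\pi_1])$; $\psi_2'=16\max\{\mathbb E[g_Y^2(Y_1,Y_2)g_Z^2(Z_i,Z_j)]:(i,j)\in\{(1,2),(1,3),(3,4)\}\}$. MMD: $\mathrm{MMD}_{\mathbf k}(\mu,\nu)\ge0$ with $\mathrm{MMD}_{\mathbf k}^2(\mu,\nu)=\iint\mathbf k(x,x')\,d(\mu-\nu)(x)\,d(\mu-\nu)(x')$. Cheap independence test: split $[n]$ into $s$ consecutive bins of equal size and, for a permutation $\pi$ of $[s]$, let $Z^\pi$ be the sequence obtained from $Z$ by replacing its $i$-th bin of values with its $\pi(i)$-th bin, for each $i\in[s]$. Draw $\pi_1,\dots,\pi_B$ i.i.d. wild bootstrap permutations of $[s]$, independent of the data; set $T_0=V(Y,Z)$, $T_b=V(Y,Z^{\pi_b})$. Let $R=1+$ the number of $b\in[B]$ with $T_b$ smaller than $T_0$, ties being broken uniformly at random. The test rejects with probability $\Delta=\min(1,\max(0,R-(1-\alpha)(B+1)))$; its power is $\mathbb E[\Delta]$. The count $B$ satisfies $B\ge\frac1\alpha-1$.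
   Formalization: The formal statement additionally assumes K > 0: if K = 0 the kernel vanishes identically, the MMD condition reads 0 ≥ 0, all statistics tie, and the power is exactly α, so the claim fails when α < 1 − β. *)

theory Defs
  imports "HOL-Probability.Probability"
begin

text \<open>Indices of data points and of bins start at 0, so that the index set \<open>[n]\<close> is \<open>{..<n}\<close>.
  Bootstrap replicates are numbered \<open>1, \<dots>, B\<close>, and number 0 is the original sample.\<close>

section \<open>Kernels and maximum mean discrepancy\<close>

definition pos_def_kernel :: "'a set \<Rightarrow> ('a \<Rightarrow> 'a \<Rightarrow> real) \<Rightarrow> bool" where
  "pos_def_kernel A g \<longleftrightarrow>
     (\<forall>x\<in>A. \<forall>x'\<in>A. g x x' = g x' x) \<and>
     (\<forall>(m::nat) x c. (\<forall>i<m. x i \<in> A) \<longrightarrow>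
        0 \<le> (\<Sum>i<m. \<Sum>j<m. c i * c j * g (x i) (x j)))"

definition product_kernel ::
  "('y \<Rightarrow> 'y \<Rightarrow> real) \<Rightarrow> ('z \<Rightarrow> 'z \<Rightarrow> real) \<Rightarrow> 'y \<times> 'z \<Rightarrow> 'y \<times> 'z \<Rightarrow> real" where
  "product_kernel gY gZ = (\<lambda>(y, z) (y', z'). gY y y' * gZ z z')"

text \<open>The double integral against the signed measure \<open>\<mu> - \<nu>\<close> is expanded bilinearly.\<close>

definition MMD :: "('a \<Rightarrow> 'a \<Rightarrow> real) \<Rightarrow> 'a measure \<Rightarrow> 'a measure \<Rightarrow> real" where
  "MMD k \<mu> \<nu> = sqrt
     ((\<integral>x. (\<integral>x'. k x x' \<partial>\<mu>) \<partial>\<mu>) - (\<integral>x. (\<integral>x'. k x x' \<partial>\<nu>) \<partial>\<mu>)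
       - (\<integral>x. (\<integral>x'. k x x' \<partial>\<mu>) \<partial>\<nu>) + (\<integral>x. (\<integral>x'. k x x' \<partial>\<nu>) \<partial>\<nu>))"


section \<open>Independence V-statistics\<close>

definition h_in :: "('y \<Rightarrow> 'y \<Rightarrow> real) \<Rightarrow> ('z \<Rightarrow> 'z \<Rightarrow> real) \<Rightarrow>
    'y \<times> 'z \<Rightarrow> 'y \<times> 'z \<Rightarrow> 'y \<times> 'z \<Rightarrow> 'y \<times> 'z \<Rightarrow> real" where
  "h_in gY gZ = (\<lambda>(y1, z1) (y2, z2) (y3, z3) (y4, z4).
     (gY y1 y2 + gY y3 y4 - gY y1 y3 - gY y2 y4) *
     (gZ z1 z2 + gZ z3 z4 - gZ z1 z3 - gZ z2 z4))"

definition h_in_sym :: "('y \<Rightarrow> 'y \<Rightarrow> real) \<Rightarrow> ('z \<Rightarrow> 'z \<Rightarrow> real) \<Rightarrow> (nat \<Rightarrow> 'y \<times> 'z) \<Rightarrow> real" where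
  "h_in_sym gY gZ x =
     (\<Sum>p | p permutes {..<4}. h_in gY gZ (x (p 0)) (x (p 1)) (x (p 2)) (x (p 3))) / fact 4"

definition V_stat :: "('y \<Rightarrow> 'y \<Rightarrow> real) \<Rightarrow> ('z \<Rightarrow> 'z \<Rightarrow> real) \<Rightarrow> nat \<Rightarrow>
    (nat \<Rightarrow> 'y) \<Rightarrow> (nat \<Rightarrow> 'z) \<Rightarrow> real" where
  "V_stat gY gZ n y z =
     (\<Sum>i1<n. \<Sum>i2<n. \<Sum>i3<n. \<Sum>i4<n.
        h_in gY gZ (y i1, z i1) (y i2, z i2) (y i3, z i3) (y i4, z i4)) / real n ^ 4"


section \<open>Wild bootstrap permutations\<close>

definition swap_coins :: "nat \<Rightarrow> (nat \<Rightarrow> bool) pmf" where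
  "swap_coins q = Pi_pmf {..<q div 2} False (\<lambda>_. bernoulli_pmf (1 / 2))"

definition wild_perm :: "nat \<Rightarrow> (nat \<Rightarrow> bool) \<Rightarrow> nat \<Rightarrow> nat" where
  "wild_perm q c i =
     (if i < q div 2 \<and> c i then i + q div 2
      else if q div 2 \<le> i \<and> i < 2 * (q div 2) \<and> c (i - q div 2) then i - q div 2
      else i)"

definition wild_bootstrap :: "nat \<Rightarrow> (nat \<Rightarrow> nat) pmf" where
  "wild_bootstrap q = map_pmf (wild_perm q) (swap_coins q)"


section \<open>Variance components\<close>

text \<open>Variances are extended real numbers, so that their finiteness is meaningful; the
  variance is infinite by convention if \<open>f\<close> is not integrable, where \<open>real_cond_exp\<close> says nothing.\<close>

definition var_cond_exp :: "'a measure \<Rightarrow> 'a measure \<Rightarrow> ('a \<Rightarrow> real) \<Rightarrow> ennreal" where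
  "var_cond_exp M F f =
     (if integrable M f
      then \<integral>\<^sup>+\<omega>. ennreal ((real_cond_exp M F f \<omega> - (\<integral>\<omega>'. real_cond_exp M F f \<omega>' \<partial>M))\<^sup>2) \<partial>M
      else \<infinity>)"

definition sample :: "('y \<times> 'z) measure \<Rightarrow> nat \<Rightarrow> (nat \<Rightarrow> 'y \<times> 'z) measure" where
  "sample J n = (\<Pi>\<^sub>M i\<in>{..<n}. J)"

definition psi1 :: "('y \<times> 'z) measure \<Rightarrow> nat \<Rightarrow>
    ('y \<Rightarrow> 'y \<Rightarrow> real) \<Rightarrow> ('z \<Rightarrow> 'z \<Rightarrow> real) \<Rightarrow> ennreal" where
  "psi1 J n gY gZ =
     var_cond_exp (sample J n) (vimage_algebra (space (sample J n)) (\<lambda>x. x 0) J)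
       (\<lambda>x. h_in_sym gY gZ x)"

text \<open>The sample space carries the coins instead of the permutation, because \<open>wild_perm n c\<close>
  maps \<open>{..<n}\<close> to itself for every \<open>c\<close>. With the permutation itself as a coordinate, the
  integrand would look up data outside the sample on a null set and need not be measurable.\<close>

definition psi1_tilde :: "('y \<times> 'z) measure \<Rightarrow> nat \<Rightarrow>
    ('y \<Rightarrow> 'y \<Rightarrow> real) \<Rightarrow> ('z \<Rightarrow> 'z \<Rightarrow> real) \<Rightarrow> ennreal" where
  "psi1_tilde J n gY gZ =
     (let M = sample J n \<Otimes>\<^sub>M measure_pmf (swap_coins n);
          perm = (\<lambda>\<omega>. wild_perm n (snd \<omega>));
          X = (\<lambda>\<omega> i. (fst (fst \<omega> i), snd (fst \<omega> (perm \<omega> i))))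
      in var_cond_exp M
           (vimage_algebra (space M) (\<lambda>\<omega>. (X \<omega> 0, perm \<omega> 0)) (J \<Otimes>\<^sub>M count_space UNIV))
           (\<lambda>\<omega>. h_in_sym gY gZ (X \<omega>)))"

definition psi2 :: "('y \<times> 'z) measure \<Rightarrow> nat \<Rightarrow>
    ('y \<Rightarrow> 'y \<Rightarrow> real) \<Rightarrow> ('z \<Rightarrow> 'z \<Rightarrow> real) \<Rightarrow> ennreal" where
  "psi2 J n gY gZ =
     16 * Max ((\<lambda>(i, j). \<integral>\<^sup>+x. ennreal ((gY (fst (x 0)) (fst (x 1)))\<^sup>2 *
                                       (gZ (snd (x i)) (snd (x j)))\<^sup>2) \<partial>sample J n)
               ` {(0, 1), (0, 2), (2, 3)})"


section \<open>The cheap independence test\<close>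

definition permute_bins :: "nat \<Rightarrow> nat \<Rightarrow> (nat \<Rightarrow> nat) \<Rightarrow> (nat \<Rightarrow> 'z) \<Rightarrow> nat \<Rightarrow> 'z" where
  "permute_bins n s p z j = (let m = n div s in z (p (j div m) * m + j mod m))"

definition test_stat :: "('y \<Rightarrow> 'y \<Rightarrow> real) \<Rightarrow> ('z \<Rightarrow> 'z \<Rightarrow> real) \<Rightarrow> nat \<Rightarrow> nat \<Rightarrow>
    (nat \<Rightarrow> 'y \<times> 'z) \<Rightarrow> (nat \<Rightarrow> nat \<Rightarrow> nat) \<Rightarrow> nat \<Rightarrow> real" where
  "test_stat gY gZ n s x p b =
     (let y = (\<lambda>i. fst (x i)); z = (\<lambda>i. snd (x i))
      in V_stat gY gZ n y (if b = 0 then z else permute_bins n s (p b) z))"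

text \<open>Ties are broken by a permutation \<open>t\<close> of \<open>{0..B}\<close>, drawn uniformly in \<open>cheap_test_power\<close>.\<close>

definition rank :: "nat \<Rightarrow> (nat \<Rightarrow> real) \<Rightarrow> (nat \<Rightarrow> nat) \<Rightarrow> nat" where
  "rank B T t = 1 + card {b \<in> {1..B}. T b < T 0 \<or> (T b = T 0 \<and> t b < t 0)}"

definition reject_prob :: "real \<Rightarrow> nat \<Rightarrow> nat \<Rightarrow> real" where
  "reject_prob \<alpha> B R = min 1 (max 0 (real R - (1 - \<alpha>) * (real B + 1)))"

text \<open>The expectation over the permutations and the tie-breaking, which are independent of
  the data, is taken for fixed data first.\<close>

definition cheap_test_power :: "('y \<times> 'z) measure \<Rightarrow> ('y \<Rightarrow> 'y \<Rightarrow> real) \<Rightarrow> ('z \<Rightarrow> 'z \<Rightarrow> real) \<Rightarrow>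
    nat \<Rightarrow> nat \<Rightarrow> nat \<Rightarrow> real \<Rightarrow> real" where
  "cheap_test_power J gY gZ n s B \<alpha> =
     (\<integral>x. measure_pmf.expectation
            (pair_pmf (Pi_pmf {1..B} id (\<lambda>_. wild_bootstrap s)) (pmf_of_set {t. t permutes {0..B}}))
            (\<lambda>(p, t). reject_prob \<alpha> B (rank B (test_stat gY gZ n s x p) t))
        \<partial>sample J n)"

definition alpha_star :: "real \<Rightarrow> real \<Rightarrow> nat \<Rightarrow> real" where
  "alpha_star \<alpha> \<beta> B =
     \<alpha> / (2 * exp 1) * (\<beta> / 3) powr (1 / real_of_int \<lfloor>\<alpha> * (real B + 1)\<rfloor>)"

end

theory Submission
  imports Defs
begin

text \<open>
  With feature maps \<open>\<phi>\<close> and \<open>\<psi>\<close> of the two kernels, the V-statistic is four times the squared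
  Hilbert--Schmidt norm of the empirical cross-covariance operator \<open>C\<close> (\<open>V_stat_eq_kernel_norm\<close>),
  whose population counterpart has norm \<open>\<theta> = MMD\<close>. A wild bootstrap permutation \<open>\<sigma>\<close> replaces \<open>C\<close>
  by \<open>C\<^sub>\<sigma>\<close>. Points in swapped bins are matched with independent partners and contribute only
  noise, and on average half of the points stay in place, so that the norm of \<open>C\<^sub>\<sigma>\<close> is close to
  \<open>\<theta>/2\<close>, while that of \<open>C\<close> is close to \<open>\<theta>\<close>. The test rejects when this gap dominates the noise.

  To make this quantitative, let \<open>W\<^sub>b\<close> be the change of \<open>C\<^sub>\<sigma>\<close> when the \<open>b\<close>-th pair of bins is swapped,
  and consider for \<open>\<kappa> = sqrt (ln (1/\<alpha>\<^sup>\<star>) / 2)\<close> the gap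
  \<open>G = |C| - E\<^sub>\<sigma> |C\<^sub>\<sigma>| - \<kappa> sqrt (\<Sum>\<^sub>b |W\<^sub>b|\<^sup>2)\<close>, a function of the data. Second moments show that its
  expectation is at least \<open>\<theta> (1/2 - sqrt (ln (1/\<alpha>\<^sup>\<star>) / s))\<close> up to an error of order
  \<open>(1 + \<kappa>) sqrt (K/n)\<close> (\<open>gap_mean_ge\<close>). One data point moves \<open>G\<close> by at most a multiple of
  \<open>sqrt K (2 + \<kappa>) / n\<close>, so McDiarmid's inequality gives \<open>G > 0\<close> outside an event of small
  probability (\<open>gap_nonpos_prob_le\<close>). On \<open>G > 0\<close>, McDiarmid's inequality for the coins, whose
  bounded differences are the \<open>|W\<^sub>b|\<close>, shows that a single bootstrap replicate reaches the original
  statistic with probability at most \<open>exp (-2 \<kappa>\<^sup>2) = \<alpha>\<^sup>\<star>\<close> (\<open>swapped_exceeds_prob_le\<close>). By a union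
  bound, \<open>\<lfloor>\<alpha> (B + 1)\<rfloor>\<close> of the \<open>B\<close> replicates do so with probability at most \<open>\<beta>/3\<close>
  (\<open>alpha_star_binomial\<close>); with fewer such replicates the test rejects surely.

  No Hilbert space is constructed. Empirical operators are finite combinations of features, so their
  norms are square roots of quadratic forms in kernel values, and on finitely many points every
  positive definite kernel has features in some \<open>\<real>\<^sup>d\<close> (\<open>pos_def_kernel_finite_features\<close>), where the
  triangle inequality is available. Population quantities enter through kernels that are centered
  with respect to the marginals: centering leaves the V-statistic unchanged, the squared MMD becomes
  the double integral of the product of the centered kernels (\<open>MMD_product_eq\<close>), and mixed moments
  vanish unless the index pairs of the two factors coincide (\<open>mixed_moment\<close>).
\<close>

section \<open>McDiarmid's inequality\<close>

lemma bounded_range_of_oscillation: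
  fixes f :: "'a \<Rightarrow> real"
  assumes "\<And>u v. u \<in> S \<Longrightarrow> v \<in> S \<Longrightarrow> \<bar>f u - f v\<bar> \<le> c" and "S \<noteq> {}"
  obtains p where "\<And>u. u \<in> S \<Longrightarrow> f u \<in> {p..p + c}"
proof
  obtain v where v: "v \<in> S"
    using assms(2) by auto
  have bdd: "bdd_below (f ` S)"
    by (rule bdd_belowI[where m = "f v - c"]) (use assms(1) v in force)
  fix u assume u: "u \<in> S"
  have "f u - c \<le> Inf (f ` S)"
    using assms u by (intro cInf_greatest) force+
  then show "f u \<in> {Inf (f ` S)..Inf (f ` S) + c}"
    using cInf_lower[OF _ bdd, of "f u"] u by auto
qed

text \<open>Values that differ by at most \<open>c\<close> fill an interval of length \<open>c\<close>, so this is
  Hoeffding's lemma. The subtracted number \<open>e\<close> is arbitrary because the lemma is applied to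
  sections of a function of several variables, from which the overall mean is subtracted.\<close>

lemma (in prob_space) hoeffding_lemma_oscillation:
  fixes f :: "'a \<Rightarrow> real"
  assumes [measurable]: "f \<in> borel_measurable M"
    and osc: "\<And>u v. u \<in> space M \<Longrightarrow> v \<in> space M \<Longrightarrow> \<bar>f u - f v\<bar> \<le> c"
    and "0 < l"
  shows "(\<integral>\<^sup>+u. ennreal (exp (l * (f u - e))) \<partial>M)
    \<le> ennreal (exp (l * (expectation f - e)) * exp (l\<^sup>2 * c\<^sup>2 / 8))"
proof -
  obtain p where p: "\<And>u. u \<in> space M \<Longrightarrow> f u \<in> {p..p + c}"
    using bounded_range_of_oscillation[of "space M" f c] osc not_empty by blast
  interpret interval_bounded_random_variable M f p "p + c"
    by unfold_locales (use p in \<open>auto intro!: AE_I2\<close>)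
  have "(\<integral>\<^sup>+u. ennreal (exp (l * (f u - e))) \<partial>M)
    = (\<integral>\<^sup>+u. ennreal (exp (l * (expectation f - e))) * ennreal (exp (l * (f u - expectation f))) \<partial>M)"
    by (intro nn_integral_cong) (simp add: ennreal_mult[symmetric] exp_add[symmetric] algebra_simps)
  also have "\<dots> = ennreal (exp (l * (expectation f - e))) *
      (\<integral>\<^sup>+u. ennreal (exp (l * (f u - expectation f))) \<partial>M)"
    by (intro nn_integral_cmult) measurable
  also have "\<dots> \<le> ennreal (exp (l * (expectation f - e))) * ennreal (exp (l\<^sup>2 * c\<^sup>2 / 8))"
    using Hoeffdings_lemma_nn_integral[OF \<open>0 < l\<close>] by (intro mult_left_mono) auto
  finally show ?thesis
    by (simp add: ennreal_mult)
qed

text \<open>Markov's inequality for \<open>exp (l * (f - e))\<close> at the optimal \<open>l = 4 t / v\<close>.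
  Allowing any \<open>v \<ge> w\<close> covers a vanishing variance proxy \<open>w\<close>.\<close>

lemma (in prob_space) chernoff_bound_subgaussian:
  fixes f :: "'a \<Rightarrow> real"
  assumes [measurable]: "f \<in> borel_measurable M"
    and mgf: "\<And>l. 0 < l \<Longrightarrow> (\<integral>\<^sup>+u. ennreal (exp (l * (f u - e))) \<partial>M) \<le> ennreal (exp (l\<^sup>2 * w / 8))"
    and "w \<le> v" "0 < v" "0 < t"
  shows "prob {u \<in> space M. e + t \<le> f u} \<le> exp (- 2 * t\<^sup>2 / v)"
proof -
  define l where "l = 4 * t / v"
  have l: "0 < l"
    using assms by (simp add: l_def)
  have "emeasure M {u \<in> space M. e + t \<le> f u} = (\<integral>\<^sup>+u. indicator {u \<in> space M. e + t \<le> f u} u \<partial>M)"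
    by (subst nn_integral_indicator) auto
  also have "\<dots> \<le> (\<integral>\<^sup>+u. ennreal (exp (- l * t)) * ennreal (exp (l * (f u - e))) \<partial>M)"
  proof (intro nn_integral_mono)
    fix u
    have "1 \<le> exp (- l * t + l * (f u - e))" if "e + t \<le> f u"
    proof -
      have "l * t \<le> l * (f u - e)"
        using l that by (intro mult_left_mono) auto
      then show ?thesis
        by simp
    qed
    then show "indicator {u \<in> space M. e + t \<le> f u} u
        \<le> ennreal (exp (- l * t)) * ennreal (exp (l * (f u - e)))"
      by (auto simp: indicator_def ennreal_mult[symmetric] exp_add[symmetric] ennreal_1[symmetric]
          simp del: ennreal_1 intro!: ennreal_leI)
  qed
  also have "\<dots> = ennreal (exp (- l * t)) * (\<integral>\<^sup>+u. ennreal (exp (l * (f u - e))) \<partial>M)"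
    by (intro nn_integral_cmult) measurable
  also have "\<dots> \<le> ennreal (exp (- l * t)) * ennreal (exp (l\<^sup>2 * v / 8))"
  proof (intro mult_left_mono order_trans[OF mgf[OF l]] ennreal_leI)
    show "exp (l\<^sup>2 * w / 8) \<le> exp (l\<^sup>2 * v / 8)"
      using \<open>w \<le> v\<close> by (simp add: mult_left_mono)
  qed auto
  also have "\<dots> = ennreal (exp (- l * t + l\<^sup>2 * v / 8))"
    by (simp only: ennreal_mult[symmetric] exp_add exp_ge_zero)
  also have "- l * t + l\<^sup>2 * v / 8 = - 2 * t\<^sup>2 / v"
    using \<open>0 < v\<close> by (simp add: l_def field_simps power2_eq_square)
  finally show ?thesis
    by (simp add: emeasure_eq_measure)
qed

text \<open>Any point turns into any other one by changing its coordinates one at a time.\<close>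

lemma bounded_of_bounded_differences:
  fixes f :: "('i \<Rightarrow> 'a) \<Rightarrow> real"
  assumes "finite I" and "x \<in> Pi\<^sub>E I S" "y \<in> Pi\<^sub>E I S"
    and "\<And>x i u. x \<in> Pi\<^sub>E I S \<Longrightarrow> i \<in> I \<Longrightarrow> u \<in> S i \<Longrightarrow> \<bar>f (x(i := u)) - f x\<bar> \<le> c i"
  shows "\<bar>f y - f x\<bar> \<le> sum c I"
proof -
  have "\<bar>f (\<lambda>i. if i \<in> A then y i else x i) - f x\<bar> \<le> sum c A" if "A \<subseteq> I" for A
    using finite_subset[OF that assms(1)] that
  proof (induction A)
    case (insert j A)
    let ?z = "\<lambda>i. if i \<in> A then y i else x i"
    have z: "?z \<in> Pi\<^sub>E I S"
      using assms(2,3) insert.prems by (auto simp: PiE_def extensional_def)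
    have "\<bar>f (?z(j := y j)) - f ?z\<bar> \<le> c j"
      using insert.prems assms(3) by (intro assms(4)[OF z]) auto
    moreover have "?z(j := y j) = (\<lambda>i. if i \<in> insert j A then y i else x i)"
      by auto
    ultimately show ?case
      using insert by (auto simp: fun_eq_iff)
  qed auto
  moreover have "(\<lambda>i. if i \<in> I then y i else x i) = y"
    using assms(2,3) by (auto simp: PiE_def extensional_def)
  ultimately show ?thesis
    by (metis order_refl)
qed

lemma (in prob_space) integrable_bounded_differences:
  fixes f :: "('i \<Rightarrow> 'a) \<Rightarrow> real"
  assumes "finite I" and f: "f \<in> borel_measurable (\<Pi>\<^sub>M i\<in>I. M)"
    and "\<And>x i u. x \<in> space (\<Pi>\<^sub>M i\<in>I. M) \<Longrightarrow> i \<in> I \<Longrightarrow> u \<in> space M \<Longrightarrow>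
      \<bar>f (x(i := u)) - f x\<bar> \<le> c i"
  shows "integrable (\<Pi>\<^sub>M i\<in>I. M) f"
proof -
  interpret P: prob_space "\<Pi>\<^sub>M i\<in>I. M"
    by (intro prob_space_PiM prob_space_axioms)
  obtain x where x: "x \<in> space (\<Pi>\<^sub>M i\<in>I. M)"
    using P.not_empty by blast
  have "\<bar>f y\<bar> \<le> \<bar>f x\<bar> + sum c I" if "y \<in> space (\<Pi>\<^sub>M i\<in>I. M)" for y
    using bounded_of_bounded_differences[OF assms(1), of x "\<lambda>_. space M" y f c] x that assms(3)
    by (simp add: space_PiM)
  then show ?thesis
    by (intro P.integrable_const_bound[where B = "\<bar>f x\<bar> + sum c I"] f AE_I2) auto
qed

text \<open>Induction on the coordinates. Integrating out one coordinate leaves a function with the same bounded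
  differences in the others, and Hoeffding's lemma for that coordinate contributes the factor \<open>exp
  (l\<^sup>2 * (c i)\<^sup>2 / 8)\<close>. This is the usual martingale argument with Fubini's theorem in
  the place of conditional expectations.\<close>

lemma (in prob_space) mgf_bounded_differences:
  fixes f :: "('i \<Rightarrow> 'a) \<Rightarrow> real"
  assumes "finite I" and "f \<in> borel_measurable (\<Pi>\<^sub>M i\<in>I. M)"
    and "\<And>x i u. x \<in> space (\<Pi>\<^sub>M i\<in>I. M) \<Longrightarrow> i \<in> I \<Longrightarrow> u \<in> space M \<Longrightarrow>
      \<bar>f (x(i := u)) - f x\<bar> \<le> c i"
    and "0 < l"
  shows "(\<integral>\<^sup>+x. ennreal (exp (l * (f x - (\<integral>x. f x \<partial>(\<Pi>\<^sub>M i\<in>I. M))))) \<partial>(\<Pi>\<^sub>M i\<in>I. M))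
    \<le> ennreal (exp (l\<^sup>2 * (\<Sum>i\<in>I. (c i)\<^sup>2) / 8))"
  using assms
proof (induction I arbitrary: f)
  case empty
  interpret product_sigma_finite "\<lambda>_. M"
    by unfold_locales
  show ?case
    by (simp add: PiM_empty nn_integral_count_space_finite lebesgue_integral_count_space_finite)
next
  case (insert i I)
  interpret product_sigma_finite "\<lambda>_. M"
    by unfold_locales
  note f [measurable] = insert.prems(1)
  define g where "g x = (\<integral>u. f (x(i := u)) \<partial>M)" for x
  interpret P: prob_space "\<Pi>\<^sub>M i\<in>I. M"
    by (intro prob_space_PiM prob_space_axioms)
  have int: "integrable (\<Pi>\<^sub>M i\<in>insert i I. M) f"
    using insert.hyps f by (intro integrable_bounded_differences[of _ _ c] insert.prems(2)) auto
  have [measurable]: "(\<lambda>(x, u). f (x(i := u))) \<in> borel_measurable ((\<Pi>\<^sub>M i\<in>I. M) \<Otimes>\<^sub>M M)"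
    using measurable_compose[OF measurable_add_dim f] by (simp add: split_beta')
  have upd: "x(i := u) \<in> space (\<Pi>\<^sub>M i\<in>insert i I. M)"
    if "x \<in> space (\<Pi>\<^sub>M i\<in>I. M)" "u \<in> space M" for x u
    using that by (auto simp: space_PiM PiE_def extensional_def)
  have fx [measurable]: "(\<lambda>u. f (x(i := u))) \<in> borel_measurable M" if "x \<in> space (\<Pi>\<^sub>M i\<in>I. M)" for x
    by (rule measurable_compose[OF measurable_component_update f]) (use that insert.hyps in auto)
  have osc: "\<bar>f (x(i := u)) - f (x(i := v))\<bar> \<le> c i"
    if "x \<in> space (\<Pi>\<^sub>M i\<in>I. M)" "u \<in> space M" "v \<in> space M" for x u v
    using insert.prems(2)[OF upd[OF that(1,3)], of i u] that by (simp del: fun_upd_apply)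
  have fx_int: "integrable M (\<lambda>u. f (x(i := u)))" if x: "x \<in> space (\<Pi>\<^sub>M i\<in>I. M)" for x
  proof -
    obtain p where p: "\<And>u. u \<in> space M \<Longrightarrow> f (x(i := u)) \<in> {p..p + c i}"
      using bounded_range_of_oscillation[of "space M" "\<lambda>u. f (x(i := u))" "c i"] osc[OF x] not_empty
      by blast
    have "AE u in M. f (x(i := u)) \<in> {p..p + c i}"
      by (intro AE_I2 p)
    then show ?thesis
      by (intro integrable_const_bound[where B = "\<bar>p\<bar> + \<bar>c i\<bar>"] fx[OF x]) (auto elim: AE_mp)
  qed
  have g [measurable]: "g \<in> borel_measurable (\<Pi>\<^sub>M i\<in>I. M)"
    unfolding g_def by (intro borel_measurable_lebesgue_integral) measurable
  have Ef: "(\<integral>x. f x \<partial>(\<Pi>\<^sub>M i\<in>insert i I. M)) = (\<integral>x. g x \<partial>(\<Pi>\<^sub>M i\<in>I. M))"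
    unfolding g_def using insert.hyps int by (rule product_integral_insert)
  let ?E = "\<integral>x. g x \<partial>(\<Pi>\<^sub>M i\<in>I. M)"
  have IH: "(\<integral>\<^sup>+x. ennreal (exp (l * (g x - ?E))) \<partial>(\<Pi>\<^sub>M i\<in>I. M))
      \<le> ennreal (exp (l\<^sup>2 * (\<Sum>i\<in>I. (c i)\<^sup>2) / 8))"
  proof (intro insert.IH g \<open>0 < l\<close>)
    fix x j v assume *: "x \<in> space (\<Pi>\<^sub>M i\<in>I. M)" "j \<in> I" "v \<in> space M"
    have xv: "x(j := v) \<in> space (\<Pi>\<^sub>M i\<in>I. M)"
      using * by (auto simp: space_PiM PiE_def extensional_def)
    have ij: "i \<noteq> j"
      using * insert.hyps by auto
    have "\<bar>f (x(j := v, i := u)) - f (x(i := u))\<bar> \<le> c j" if "u \<in> space M" for u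
      using insert.prems(2)[OF upd[OF *(1) that], of j v] * ij
      by (simp add: fun_upd_twist[of i j] del: fun_upd_apply)
    then have "\<bar>\<integral>u. f (x(j := v, i := u)) - f (x(i := u)) \<partial>M\<bar> \<le> (\<integral>u. c j \<partial>M)"
      by (intro order_trans[OF integral_abs_bound] integral_mono Bochner_Integration.integrable_abs
          Bochner_Integration.integrable_diff fx_int * xv) auto
    then show "\<bar>g (x(j := v)) - g x\<bar> \<le> c j"
      by (simp add: g_def Bochner_Integration.integral_diff fx_int * xv prob_space)
  qed
  have "(\<integral>\<^sup>+x. ennreal (exp (l * (f x - ?E))) \<partial>(\<Pi>\<^sub>M i\<in>insert i I. M))
      = (\<integral>\<^sup>+x. \<integral>\<^sup>+u. ennreal (exp (l * (f (x(i := u)) - ?E))) \<partial>M \<partial>(\<Pi>\<^sub>M i\<in>I. M))"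
    using insert.hyps by (intro product_nn_integral_insert) measurable
  also have "\<dots> \<le> (\<integral>\<^sup>+x. ennreal (exp (l * (g x - ?E)) * exp (l\<^sup>2 * (c i)\<^sup>2 / 8)) \<partial>(\<Pi>\<^sub>M i\<in>I. M))"
    unfolding g_def by (intro nn_integral_mono hoeffding_lemma_oscillation fx osc \<open>0 < l\<close>)
  also have "\<dots> = (\<integral>\<^sup>+x. ennreal (exp (l * (g x - ?E))) \<partial>(\<Pi>\<^sub>M i\<in>I. M)) * ennreal (exp (l\<^sup>2 * (c i)\<^sup>2 / 8))"
    by (subst nn_integral_multc[symmetric]) (auto simp: ennreal_mult)
  also have "\<dots> \<le> ennreal (exp (l\<^sup>2 * (\<Sum>i\<in>I. (c i)\<^sup>2) / 8)) * ennreal (exp (l\<^sup>2 * (c i)\<^sup>2 / 8))"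
    by (intro mult_right_mono IH) auto
  also have "\<dots> = ennreal (exp (l\<^sup>2 * (\<Sum>i\<in>insert i I. (c i)\<^sup>2) / 8))"
    using insert.hyps by (simp add: ennreal_mult[symmetric] exp_add[symmetric] algebra_simps add_divide_distrib)
  finally show ?case
    by (simp add: Ef)
qed

lemma (in prob_space) mcdiarmid_inequality:
  fixes f :: "('i \<Rightarrow> 'a) \<Rightarrow> real"
  assumes "finite I" and f: "f \<in> borel_measurable (\<Pi>\<^sub>M i\<in>I. M)"
    and diff: "\<And>x i u. x \<in> space (\<Pi>\<^sub>M i\<in>I. M) \<Longrightarrow> i \<in> I \<Longrightarrow> u \<in> space M \<Longrightarrow>
      \<bar>f (x(i := u)) - f x\<bar> \<le> c i"
    and v: "(\<Sum>i\<in>I. (c i)\<^sup>2) \<le> v" "0 < v" and "0 < t"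
  shows "measure (\<Pi>\<^sub>M i\<in>I. M) {x \<in> space (\<Pi>\<^sub>M i\<in>I. M). (\<integral>x. f x \<partial>(\<Pi>\<^sub>M i\<in>I. M)) + t \<le> f x}
    \<le> exp (- 2 * t\<^sup>2 / v)"
proof -
  interpret P: prob_space "\<Pi>\<^sub>M i\<in>I. M"
    by (intro prob_space_PiM prob_space_axioms)
  show ?thesis
    by (intro P.chernoff_bound_subgaussian[OF f _ v \<open>0 < t\<close>] mgf_bounded_differences[OF assms(1) f diff])
qed

lemma expectation_Pi_pmf_insert:
  fixes f :: "('i \<Rightarrow> bool) \<Rightarrow> real" and p :: "'i \<Rightarrow> bool pmf"
  assumes "finite A" "i \<notin> A"
  shows "measure_pmf.expectation (Pi_pmf (insert i A) d p) f
    = measure_pmf.expectation (Pi_pmf A d p) (\<lambda>c. measure_pmf.expectation (p i) (\<lambda>b. f (c(i := b))))"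
proof -
  have fin: "finite (set_pmf (Pi_pmf A d p))"
    by (rule finite_subset[OF set_Pi_pmf_subset'[OF assms(1)]]) (intro finite_PiE_dflt, auto simp: assms(1))
  have eq: "Pi_pmf (insert i A) d p = Pi_pmf A d p \<bind> (\<lambda>c. map_pmf (\<lambda>b. c(i := b)) (p i))"
    unfolding Pi_pmf_insert'[OF assms] by (subst bind_commute_pmf) (simp add: map_pmf_def)
  show ?thesis
    unfolding eq using fin by (subst pmf_expectation_bind[of "set_pmf (Pi_pmf A d p)"])
      (auto simp: integral_measure_pmf[of "set_pmf (Pi_pmf A d p)"])
qed

text \<open>The same induction for products of PMFs, which live on total functions with a default value outside the
  index set.\<close>

lemma mgf_bounded_differences_coins:
  fixes f :: "('i \<Rightarrow> bool) \<Rightarrow> real" and p :: "'i \<Rightarrow> bool pmf"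
  assumes "finite A" and "\<And>c i b. i \<in> A \<Longrightarrow> \<bar>f (c(i := b)) - f c\<bar> \<le> w i" and "0 < l"
  shows "(\<integral>\<^sup>+c. ennreal (exp (l * (f c - measure_pmf.expectation (Pi_pmf A d p) f))) \<partial>measure_pmf (Pi_pmf A d p))
    \<le> ennreal (exp (l\<^sup>2 * (\<Sum>i\<in>A. (w i)\<^sup>2) / 8))"
  using assms
proof (induction A arbitrary: f)
  case empty
  then show ?case
    by simp
next
  case (insert i A)
  define g where "g c = measure_pmf.expectation (p i) (\<lambda>b. f (c(i := b)))" for c
  let ?P = "Pi_pmf A d p"
  let ?E = "measure_pmf.expectation ?P g"
  have Ef: "measure_pmf.expectation (Pi_pmf (insert i A) d p) f = ?E"
    unfolding g_def using insert.hyps by (rule expectation_Pi_pmf_insert)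
  have fin: "integrable (measure_pmf (p i)) h" for h :: "bool \<Rightarrow> real"
    by (intro integrable_measure_pmf_finite) auto
  have osc: "\<bar>f (c(i := b)) - f (c(i := b'))\<bar> \<le> w i" for c b b'
    using insert.prems(1)[of i "c(i := b')" b] by (simp del: fun_upd_apply)
  have IH: "(\<integral>\<^sup>+c. ennreal (exp (l * (g c - ?E))) \<partial>measure_pmf ?P)
      \<le> ennreal (exp (l\<^sup>2 * (\<Sum>i\<in>A. (w i)\<^sup>2) / 8))"
  proof (intro insert.IH \<open>0 < l\<close>)
    fix c j v assume j: "j \<in> A"
    have ij: "i \<noteq> j"
      using j insert.hyps by auto
    have "\<bar>f (c(j := v, i := b)) - f (c(i := b))\<bar> \<le> w j" for b
      using insert.prems(1)[of j "c(i := b)" v] j ij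
      by (simp add: fun_upd_twist[of i j] del: fun_upd_apply)
    then have "\<bar>\<integral>b. f (c(j := v, i := b)) - f (c(i := b)) \<partial>measure_pmf (p i)\<bar> \<le> (\<integral>b. w j \<partial>measure_pmf (p i))"
      by (intro order_trans[OF integral_abs_bound] integral_mono fin) auto
    then show "\<bar>g (c(j := v)) - g c\<bar> \<le> w j"
      by (simp add: g_def Bochner_Integration.integral_diff fin)
  qed
  have "(\<integral>\<^sup>+c. ennreal (exp (l * (f c - ?E))) \<partial>measure_pmf (Pi_pmf (insert i A) d p))
      = (\<integral>\<^sup>+c. \<integral>\<^sup>+b. ennreal (exp (l * (f (c(i := b)) - ?E))) \<partial>measure_pmf (p i) \<partial>measure_pmf ?P)"
    unfolding Pi_pmf_insert'[OF insert.hyps] by (subst bind_commute_pmf) simp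
  also have "\<dots> \<le> (\<integral>\<^sup>+c. ennreal (exp (l * (g c - ?E)) * exp (l\<^sup>2 * (w i)\<^sup>2 / 8)) \<partial>measure_pmf ?P)"
    unfolding g_def
    by (intro nn_integral_mono measure_pmf.hoeffding_lemma_oscillation osc \<open>0 < l\<close>) auto
  also have "\<dots> = (\<integral>\<^sup>+c. ennreal (exp (l * (g c - ?E))) \<partial>measure_pmf ?P) * ennreal (exp (l\<^sup>2 * (w i)\<^sup>2 / 8))"
    by (subst nn_integral_multc[symmetric]) (auto simp: ennreal_mult)
  also have "\<dots> \<le> ennreal (exp (l\<^sup>2 * (\<Sum>i\<in>A. (w i)\<^sup>2) / 8)) * ennreal (exp (l\<^sup>2 * (w i)\<^sup>2 / 8))"
    by (intro mult_right_mono IH) auto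
  also have "\<dots> = ennreal (exp (l\<^sup>2 * (\<Sum>i\<in>insert i A. (w i)\<^sup>2) / 8))"
    using insert.hyps by (simp add: ennreal_mult[symmetric] exp_add[symmetric] algebra_simps add_divide_distrib)
  finally show ?case
    by (simp add: Ef)
qed

lemma mcdiarmid_inequality_coins:
  fixes f :: "('i \<Rightarrow> bool) \<Rightarrow> real" and p :: "'i \<Rightarrow> bool pmf"
  assumes "finite A" and "\<And>c i b. i \<in> A \<Longrightarrow> \<bar>f (c(i := b)) - f c\<bar> \<le> w i"
    and v: "(\<Sum>i\<in>A. (w i)\<^sup>2) \<le> v" "0 < v" and "0 < t"
  shows "measure_pmf.prob (Pi_pmf A d p) {c. measure_pmf.expectation (Pi_pmf A d p) f + t \<le> f c}
    \<le> exp (- 2 * t\<^sup>2 / v)"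
proof -
  have "measure_pmf.prob (Pi_pmf A d p)
      {c \<in> space (measure_pmf (Pi_pmf A d p)). measure_pmf.expectation (Pi_pmf A d p) f + t \<le> f c}
    \<le> exp (- 2 * t\<^sup>2 / v)"
    by (intro measure_pmf.chernoff_bound_subgaussian[OF _ _ v \<open>0 < t\<close>]
        mgf_bounded_differences_coins[OF assms(1,2)]) auto
  then show ?thesis
    by simp
qed

section \<open>Positive definite kernels and their norms\<close>

lemma pos_def_kernel_subset: "pos_def_kernel A g \<Longrightarrow> B \<subseteq> A \<Longrightarrow> pos_def_kernel B g"
  unfolding pos_def_kernel_def by (meson subsetD)

lemma pos_def_kernel_sym: "pos_def_kernel A g \<Longrightarrow> x \<in> A \<Longrightarrow> y \<in> A \<Longrightarrow> g x y = g y x"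
  unfolding pos_def_kernel_def by blast

lemma pos_def_kernelD:
  "pos_def_kernel A g \<Longrightarrow> (\<And>i. i < m \<Longrightarrow> x i \<in> A) \<Longrightarrow>
    0 \<le> (\<Sum>i<m. \<Sum>j<m. c i * c j * g (x i) (x j))" for m :: nat
  unfolding pos_def_kernel_def by blast

lemma pos_def_kernel_two:
  assumes "pos_def_kernel A g" "x \<in> A" "y \<in> A"
  shows "0 \<le> a\<^sup>2 * g x x + 2 * a * b * g x y + b\<^sup>2 * g y y"
proof -
  have "0 \<le> (\<Sum>i<(2::nat). \<Sum>j<(2::nat). (if i = 0 then a else b) * (if j = 0 then a else b)
      * g (if i = 0 then x else y) (if j = 0 then x else y))"
    using assms by (intro pos_def_kernelD[OF assms(1)]) auto
  then show ?thesis
    using pos_def_kernel_sym[OF assms]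
    by (simp add: numeral_2_eq_2 power2_eq_square algebra_simps)
qed

lemma pos_def_kernel_diag: "pos_def_kernel A g \<Longrightarrow> x \<in> A \<Longrightarrow> 0 \<le> g x x"
  using pos_def_kernel_two[of A g x x 1 0] by simp

lemma pos_def_kernel_abs_le:
  assumes "pos_def_kernel A g" "x \<in> A" "y \<in> A"
  shows "2 * \<bar>g x y\<bar> \<le> g x x + g y y"
  using pos_def_kernel_two[OF assms, of 1 1] pos_def_kernel_two[OF assms, of 1 "-1"] by simp

text \<open>On finitely many points a kernel is a Gram matrix. If \<open>g a a > 0\<close> for the new point
  \<open>a\<close>, the Schur complement \<open>g x y - g x a * g y a / g a a\<close> is positive
  definite on the old points, and its features together with the coordinate \<open>g x a / sqrt (g a
  a)\<close> are features of \<open>g\<close>. If \<open>g a a = 0\<close>, then \<open>a\<close> is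
  orthogonal to everything.\<close>

lemma pos_def_kernel_finite_features:
  assumes "finite F" "pos_def_kernel F g"
  shows "\<exists>\<phi> (d::nat). \<forall>x\<in>F. \<forall>y\<in>F. g x y = (\<Sum>k<d. \<phi> x k * \<phi> y k)"
  using assms
proof (induction F arbitrary: g)
  case (insert a F)
  have mono: "pos_def_kernel F g"
    using insert.prems by (rule pos_def_kernel_subset) auto
  have sym: "g x a = g a x" if "x \<in> insert a F" for x
    using pos_def_kernel_sym[OF insert.prems that] by simp
  show ?case
  proof (cases "g a a = 0")
    case True
    have zero: "g x a = 0" if x: "x \<in> insert a F" for x
    proof (rule ccontr)
      assume nz: "g x a \<noteq> 0"
      have "0 \<le> g x x + 2 * b * g x a" for b
        using pos_def_kernel_two[OF insert.prems x, of a 1 b] True by simp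
      \<comment> \<open>A value of \<open>b\<close> that would make the linear function of \<open>b\<close> negative.\<close>
      from this[of "- (g x x + 1) / (2 * g x a)"] show False
        using nz by (simp add: field_simps)
    qed
    obtain \<phi> and d :: nat where \<phi>: "\<forall>x\<in>F. \<forall>y\<in>F. g x y = (\<Sum>k<d. \<phi> x k * \<phi> y k)"
      using insert.IH[OF mono] by blast
    have "\<forall>x\<in>insert a F. \<forall>y\<in>insert a F. g x y =
        (\<Sum>k<d. (if x = a then 0 else \<phi> x k) * (if y = a then 0 else \<phi> y k))"
      using \<phi> zero sym insert.hyps True by (auto intro!: sum.cong)
    then show ?thesis
      by (intro exI[of _ "\<lambda>x k. if x = a then 0 else \<phi> x k"] exI[of _ d])
  next
    case False
    then have pos: "0 < g a a"
      using pos_def_kernel_diag[OF insert.prems, of a] by auto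
    define g' where "g' x y = g x y - g x a * g y a / g a a" for x y
    have "pos_def_kernel F g'"
      unfolding pos_def_kernel_def
    proof (intro conjI ballI allI impI)
      fix x y assume "x \<in> F" "y \<in> F"
      then show "g' x y = g' y x"
        using pos_def_kernel_sym[OF mono] by (simp add: g'_def)
    next
      fix m :: nat and x c assume x: "\<forall>i<m. x i \<in> F"
      define s where "s = (\<Sum>i<m. c i * g (x i) a)"
      define x' where "x' i = (if i < m then x i else a)" for i
      \<comment> \<open>This coefficient of \<open>a\<close> minimizes the quadratic form.\<close>
      define c' where "c' i = (if i < m then c i else - s / g a a)" for i
      have sx: "g a (x i) = g (x i) a" if "i < m" for i
        using sym x that by simp
      have "0 \<le> (\<Sum>i<Suc m. \<Sum>j<Suc m. c' i * c' j * g (x' i) (x' j))"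
        using x by (intro pos_def_kernelD[OF insert.prems]) (auto simp: x'_def)
      also have "\<dots> = (\<Sum>i<m. (\<Sum>j<m. c i * c j * g (x i) (x j)) + c i * (- s / g a a) * g (x i) a)
          + ((\<Sum>j<m. (- s / g a a) * c j * g (x j) a) + (- s / g a a) * (- s / g a a) * g a a)"
        using sx by (simp add: x'_def c'_def)
      also have "(\<Sum>i<m. (\<Sum>j<m. c i * c j * g (x i) (x j)) + c i * (- s / g a a) * g (x i) a)
          = (\<Sum>i<m. \<Sum>j<m. c i * c j * g (x i) (x j)) + (- s / g a a) * s"
        unfolding s_def sum_distrib_left sum.distrib[symmetric] by (intro sum.cong refl) (simp add: mult_ac)
      also have "(\<Sum>j<m. (- s / g a a) * c j * g (x j) a) = (- s / g a a) * s"
        unfolding s_def sum_distrib_left by (simp add: mult_ac)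
      also have "(\<Sum>i<m. \<Sum>j<m. c i * c j * g (x i) (x j)) + (- s / g a a) * s
          + ((- s / g a a) * s + (- s / g a a) * (- s / g a a) * g a a)
        = (\<Sum>i<m. \<Sum>j<m. c i * c j * g (x i) (x j)) - s * s / g a a"
        using pos by (simp add: field_simps)
      also have "s * s / g a a = (\<Sum>i<m. \<Sum>j<m. c i * c j * (g (x i) a * g (x j) a / g a a))"
        unfolding s_def sum_product sum_divide_distrib by (intro sum.cong refl) simp
      finally show "0 \<le> (\<Sum>i<m. \<Sum>j<m. c i * c j * g' (x i) (x j))"
        by (simp add: g'_def right_diff_distrib sum_subtractf)
    qed
    then obtain \<phi> and d :: nat where \<phi>: "\<forall>x\<in>F. \<forall>y\<in>F. g' x y = (\<Sum>k<d. \<phi> x k * \<phi> y k)"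
      using insert.IH by blast
    define \<phi>' where "\<phi>' x k = (if k = d then g x a / sqrt (g a a) else if x = a then 0 else \<phi> x k)" for x k
    have last: "\<phi>' x d * \<phi>' y d = g x a * g y a / g a a" for x y
      using pos by (simp add: \<phi>'_def)
    have "g x y = (\<Sum>k<Suc d. \<phi>' x k * \<phi>' y k)" if xy: "x \<in> insert a F" "y \<in> insert a F" for x y
    proof (cases "x = a \<or> y = a")
      case True
      then have "(\<Sum>k<d. \<phi>' x k * \<phi>' y k) = 0"
        by (intro sum.neutral) (auto simp: \<phi>'_def)
      moreover have "g x a * g y a / g a a = g x y"
        using True pos sym[OF xy(1)] sym[OF xy(2)] by auto
      ultimately show ?thesis
        by (simp add: last)
    next
      case False
      then have "g' x y = (\<Sum>k<d. \<phi> x k * \<phi> y k)"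
        using \<phi> that by auto
      also have "\<dots> = (\<Sum>k<d. \<phi>' x k * \<phi>' y k)"
        using False by (intro sum.cong) (auto simp: \<phi>'_def)
      finally show ?thesis
        by (simp add: last g'_def)
    qed
    then show ?thesis
      by blast
  qed
qed auto

lemma sum_swap3:
  "(\<Sum>i\<in>A. \<Sum>j\<in>B. \<Sum>k\<in>C. F i j k) = (\<Sum>k\<in>C. \<Sum>i\<in>A. \<Sum>j\<in>B. F i j k)"
  for F :: "_ \<Rightarrow> _ \<Rightarrow> _ \<Rightarrow> real"
  by (subst sum.swap[of _ A C], intro sum.cong refl sum.swap)

text \<open>The Schur product theorem: expanding the first factor into features writes the form as a sum of quadratic
  forms of the second factor.\<close>

lemma pos_def_kernel_product:
  assumes "pos_def_kernel A g" "pos_def_kernel B h"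
  shows "pos_def_kernel (A \<times> B) (product_kernel g h)"
  unfolding pos_def_kernel_def
proof (intro conjI ballI allI impI)
  fix x x' assume "x \<in> A \<times> B" "x' \<in> A \<times> B"
  then show "product_kernel g h x x' = product_kernel g h x' x"
    using pos_def_kernel_sym[OF assms(1)] pos_def_kernel_sym[OF assms(2)]
    by (auto simp: product_kernel_def)
next
  fix m :: nat and x c assume x: "\<forall>i<m. x i \<in> A \<times> B"
  have "pos_def_kernel ((fst \<circ> x) ` {..<m}) g"
    using x by (intro pos_def_kernel_subset[OF assms(1)]) auto
  from pos_def_kernel_finite_features[OF _ this] obtain \<phi> and d :: nat
    where \<phi>: "\<And>i j. i < m \<Longrightarrow> j < m \<Longrightarrow> g (fst (x i)) (fst (x j)) = (\<Sum>k<d. \<phi> (fst (x i)) k * \<phi> (fst (x j)) k)"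
    by auto
  have "(\<Sum>i<m. \<Sum>j<m. c i * c j * product_kernel g h (x i) (x j))
    = (\<Sum>i<m. \<Sum>j<m. \<Sum>k<d. (c i * \<phi> (fst (x i)) k) * (c j * \<phi> (fst (x j)) k) * h (snd (x i)) (snd (x j)))"
    using \<phi> by (intro sum.cong refl)
      (auto simp: product_kernel_def split_beta' sum_distrib_left sum_distrib_right mult_ac)
  also have "\<dots> = (\<Sum>k<d. \<Sum>i<m. \<Sum>j<m. (c i * \<phi> (fst (x i)) k) * (c j * \<phi> (fst (x j)) k) * h (snd (x i)) (snd (x j)))"
    by (rule sum_swap3)
  also have "\<dots> \<ge> 0"
    using x by (intro sum_nonneg pos_def_kernelD[OF assms(2)]) auto
  finally show "0 \<le> (\<Sum>i<m. \<Sum>j<m. c i * c j * product_kernel g h (x i) (x j))" .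
qed

text \<open>The norm of \<open>\<Sum>p\<in>I. c p * k (x p) \<cdot>\<close> in the reproducing kernel Hilbert space
  of \<open>k\<close>.\<close>

definition kernel_norm :: "('a \<Rightarrow> 'a \<Rightarrow> real) \<Rightarrow> 'i set \<Rightarrow> ('i \<Rightarrow> real) \<Rightarrow> ('i \<Rightarrow> 'a) \<Rightarrow> real" where
  "kernel_norm k I c x = sqrt (\<Sum>p\<in>I. \<Sum>q\<in>I. c p * c q * k (x p) (x q))"

lemma kernel_form_features:
  fixes k :: "'a \<Rightarrow> 'a \<Rightarrow> real"
  assumes "finite I" and "\<And>p q. p \<in> I \<Longrightarrow> q \<in> I \<Longrightarrow> k (x p) (x' q) = (\<Sum>a\<in>E. \<phi> (x p) a * \<phi> (x' q) a)"
  shows "(\<Sum>p\<in>I. \<Sum>q\<in>I. c p * c' q * k (x p) (x' q))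
    = (\<Sum>a\<in>E. (\<Sum>p\<in>I. c p * \<phi> (x p) a) * (\<Sum>p\<in>I. c' p * \<phi> (x' p) a))"
proof -
  have "(\<Sum>p\<in>I. \<Sum>q\<in>I. c p * c' q * k (x p) (x' q))
      = (\<Sum>p\<in>I. \<Sum>q\<in>I. \<Sum>a\<in>E. (c p * \<phi> (x p) a) * (c' q * \<phi> (x' q) a))"
  proof (intro sum.cong refl)
    fix p q assume "p \<in> I" "q \<in> I"
    then show "c p * c' q * k (x p) (x' q) = (\<Sum>a\<in>E. (c p * \<phi> (x p) a) * (c' q * \<phi> (x' q) a))"
      unfolding assms(2)[OF \<open>p \<in> I\<close> \<open>q \<in> I\<close>] sum_distrib_left by (intro sum.cong) auto
  qed
  also have "\<dots> = (\<Sum>a\<in>E. \<Sum>p\<in>I. \<Sum>q\<in>I. (c p * \<phi> (x p) a) * (c' q * \<phi> (x' q) a))"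
    by (rule sum_swap3)
  finally show ?thesis
    by (simp add: sum_product)
qed

lemma kernel_form_nonneg:
  assumes "pos_def_kernel A k" "finite I" "\<And>p. p \<in> I \<Longrightarrow> x p \<in> A"
  shows "0 \<le> (\<Sum>p\<in>I. \<Sum>q\<in>I. c p * c q * k (x p) (x q))"
proof -
  have "pos_def_kernel (x ` I) k"
    using assms by (intro pos_def_kernel_subset[OF assms(1)]) auto
  from pos_def_kernel_finite_features[OF _ this] obtain \<phi> and d :: nat
    where \<phi>: "\<And>p q. p \<in> I \<Longrightarrow> q \<in> I \<Longrightarrow> k (x p) (x q) = (\<Sum>a<d. \<phi> (x p) a * \<phi> (x q) a)"
    using assms(2) by auto
  have "(\<Sum>p\<in>I. \<Sum>q\<in>I. c p * c q * k (x p) (x q))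
      = (\<Sum>a<d. (\<Sum>p\<in>I. c p * \<phi> (x p) a) * (\<Sum>p\<in>I. c p * \<phi> (x p) a))"
    by (rule kernel_form_features[OF assms(2)]) (rule \<phi>)
  then show ?thesis
    by (simp add: sum_nonneg)
qed

lemma kernel_norm_nonneg:
  assumes "pos_def_kernel A k" "finite I" "\<And>p. p \<in> I \<Longrightarrow> x p \<in> A"
  shows "0 \<le> kernel_norm k I c x"
  using kernel_form_nonneg[OF assms] by (simp add: kernel_norm_def)

lemma kernel_norm_sq:
  assumes "pos_def_kernel A k" "finite I" "\<And>p. p \<in> I \<Longrightarrow> x p \<in> A"
  shows "(kernel_norm k I c x)\<^sup>2 = (\<Sum>p\<in>I. \<Sum>q\<in>I. c p * c q * k (x p) (x q))"
  using kernel_form_nonneg[OF assms] by (simp add: kernel_norm_def)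

text \<open>The hypothesis bounds the squared distance of two elements of the Hilbert space, with different
  coefficients and different points. Features on the points that occur reduce the claim to the triangle
  inequality in \<open>\<real>\<^sup>d\<close>.\<close>

lemma kernel_norm_diff_le:
  assumes "pos_def_kernel A k" "finite I" "\<And>p. p \<in> I \<Longrightarrow> x p \<in> A" "\<And>p. p \<in> I \<Longrightarrow> x' p \<in> A"
    and "(\<Sum>p\<in>I. \<Sum>q\<in>I. c p * c q * k (x p) (x q) - c p * c' q * k (x p) (x' q)
        - c' p * c q * k (x' p) (x q) + c' p * c' q * k (x' p) (x' q)) \<le> r\<^sup>2"
    and "0 \<le> r"
  shows "\<bar>kernel_norm k I c x - kernel_norm k I c' x'\<bar> \<le> r"
proof -
  have "pos_def_kernel (x ` I \<union> x' ` I) k"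
    using assms by (intro pos_def_kernel_subset[OF assms(1)]) auto
  from pos_def_kernel_finite_features[OF _ this] obtain \<phi> and d :: nat
    where \<phi>: "\<And>u v. u \<in> x ` I \<union> x' ` I \<Longrightarrow> v \<in> x ` I \<union> x' ` I \<Longrightarrow> k u v = (\<Sum>a<d. \<phi> u a * \<phi> v a)"
    using assms(2) by auto
  define S where "S a = (\<Sum>p\<in>I. c p * \<phi> (x p) a)" for a
  define S' where "S' a = (\<Sum>p\<in>I. c' p * \<phi> (x' p) a)" for a
  have form: "(\<Sum>p\<in>I. \<Sum>q\<in>I. b p * b' q * k (w p) (w' q))
      = (\<Sum>a<d. (\<Sum>p\<in>I. b p * \<phi> (w p) a) * (\<Sum>p\<in>I. b' p * \<phi> (w' p) a))"
    if "w \<in> {x, x'}" "w' \<in> {x, x'}" for b b' w w'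
    by (rule kernel_form_features[OF assms(2)], rule \<phi>) (use that in auto)
  have S: "kernel_norm k I c x = L2_set S {..<d}"
    unfolding kernel_norm_def L2_set_def S_def by (subst form) (auto simp: power2_eq_square)
  have S': "kernel_norm k I c' x' = L2_set S' {..<d}"
    unfolding kernel_norm_def L2_set_def S'_def by (subst form) (auto simp: power2_eq_square)
  have "(\<Sum>p\<in>I. \<Sum>q\<in>I. c p * c q * k (x p) (x q) - c p * c' q * k (x p) (x' q)
        - c' p * c q * k (x' p) (x q) + c' p * c' q * k (x' p) (x' q))
    = (\<Sum>a<d. S a * S a) - (\<Sum>a<d. S a * S' a) - (\<Sum>a<d. S' a * S a) + (\<Sum>a<d. S' a * S' a)"
    unfolding S_def S'_def sum.distrib sum_subtractf by (subst (1 2 3 4) form) auto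
  also have "\<dots> = (\<Sum>a<d. (S a - S' a)\<^sup>2)"
    by (simp add: sum.distrib[symmetric] sum_subtractf[symmetric] power2_eq_square algebra_simps)
  finally have "L2_set (\<lambda>a. S a - S' a) {..<d} \<le> r"
    unfolding L2_set_def using assms(5,6) by (simp add: real_le_lsqrt sum_nonneg)
  moreover have "L2_set S {..<d} \<le> L2_set (\<lambda>a. S a - S' a) {..<d} + L2_set S' {..<d}"
    using L2_set_triangle_ineq[of "\<lambda>a. S a - S' a" S' "{..<d}"] by simp
  moreover have "L2_set S' {..<d} \<le> L2_set (\<lambda>a. S' a - S a) {..<d} + L2_set S {..<d}"
    using L2_set_triangle_ineq[of "\<lambda>a. S' a - S a" S "{..<d}"] by simp
  moreover have "L2_set (\<lambda>a. S' a - S a) {..<d} = L2_set (\<lambda>a. S a - S' a) {..<d}"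
    by (simp add: L2_set_def power2_commute)
  ultimately show ?thesis
    using S S' by linarith
qed

lemma kernel_norm_coef_diff_le:
  assumes "pos_def_kernel A k" "finite I" "\<And>p. p \<in> I \<Longrightarrow> x p \<in> A"
  shows "\<bar>kernel_norm k I c x - kernel_norm k I c' x\<bar> \<le> kernel_norm k I (\<lambda>p. c p - c' p) x"
proof (intro kernel_norm_diff_le[OF assms(1,2)] kernel_norm_nonneg[OF assms] assms(3))
  show "(\<Sum>p\<in>I. \<Sum>q\<in>I. c p * c q * k (x p) (x q) - c p * c' q * k (x p) (x q)
        - c' p * c q * k (x p) (x q) + c' p * c' q * k (x p) (x q))
      \<le> (kernel_norm k I (\<lambda>p. c p - c' p) x)\<^sup>2"
    by (subst kernel_norm_sq[OF assms]) (auto intro!: sum_mono simp: algebra_simps)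
qed

text \<open>On a grid, the norm for a product kernel is the Hilbert--Schmidt norm of \<open>\<Sum>p. c p * \<phi> (y
  (fst p)) \<otimes> \<psi> (z (snd p))\<close>.\<close>

definition grid :: "(nat \<Rightarrow> 'y) \<Rightarrow> (nat \<Rightarrow> 'z) \<Rightarrow> nat \<times> nat \<Rightarrow> 'y \<times> 'z" where
  "grid y z p = (y (fst p), z (snd p))"

lemma kernel_norm_transpose:
  "kernel_norm (product_kernel g h) (I \<times> J) c (grid y z)
    = kernel_norm (product_kernel h g) (J \<times> I) (\<lambda>p. c (prod.swap p)) (grid z y)"
proof -
  have "(\<Sum>p\<in>I \<times> J. F p) = (\<Sum>p\<in>J \<times> I. F (prod.swap p))" for F :: "_ \<Rightarrow> real"
    by (rule sum.reindex_bij_witness[of _ prod.swap prod.swap]) auto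
  then show ?thesis
    unfolding kernel_norm_def by (simp add: grid_def product_kernel_def mult_ac)
qed

text \<open>Replacing \<open>y r\<close> by \<open>u\<close> changes the tensor by \<open>(\<phi> u - \<phi> (y r))
  \<otimes> (\<Sum>j. c (r, j) * \<psi> (z j))\<close>, and the norm of an elementary tensor is the
  product of the norms of its factors.\<close>

lemma kernel_norm_change_left:
  assumes pd: "pos_def_kernel A g" "pos_def_kernel B h"
    and y: "\<And>i. i < n \<Longrightarrow> y i \<in> A" and z: "\<And>i. i < n \<Longrightarrow> z i \<in> B" and "r < n" "u \<in> A"
    and D: "g (y r) (y r) + g u u - 2 * g (y r) u \<le> D\<^sup>2" "0 \<le> D"
    and row: "(\<Sum>j<n. \<Sum>l<n. c (r, j) * c (r, l) * h (z j) (z l)) \<le> e\<^sup>2" "0 \<le> e"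
  shows "\<bar>kernel_norm (product_kernel g h) ({..<n} \<times> {..<n}) c (grid (y(r := u)) z)
      - kernel_norm (product_kernel g h) ({..<n} \<times> {..<n}) c (grid y z)\<bar> \<le> D * e"
proof (rule kernel_norm_diff_le[OF pos_def_kernel_product[OF pd]])
  show "grid (y(r := u)) z p \<in> A \<times> B" "grid y z p \<in> A \<times> B" if "p \<in> {..<n} \<times> {..<n}" for p
    using that y z \<open>u \<in> A\<close> by (auto simp: grid_def)
  let ?k = "product_kernel g h" and ?x = "grid (y(r := u)) z" and ?x' = "grid y z"
  define F where "F p q = c p * c q * ?k (?x p) (?x q) - c p * c q * ?k (?x p) (?x' q)
      - c p * c q * ?k (?x' p) (?x q) + c p * c q * ?k (?x' p) (?x' q)" for p q
  define d where "d = g (y r) (y r) + g u u - 2 * g (y r) u"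
  have sym: "g u (y r) = g (y r) u"
    using pos_def_kernel_sym[OF pd(1) \<open>u \<in> A\<close> y[OF \<open>r < n\<close>]] .
  have F0: "F p q = 0" if "fst p \<noteq> r \<or> fst q \<noteq> r" for p q
    using that by (auto simp: F_def grid_def)
  have F1: "F (r, j) (r, l) = d * (c (r, j) * c (r, l) * h (z j) (z l))" for j l
    by (simp add: F_def grid_def product_kernel_def d_def sym algebra_simps)
  have restr: "(\<Sum>p\<in>{..<n} \<times> {..<n}. G p) = (\<Sum>j<n. G (r, j))"
    if "\<And>p. fst p \<noteq> r \<Longrightarrow> G p = 0" for G :: "nat \<times> nat \<Rightarrow> real"
  proof -
    have "(\<Sum>p\<in>{..<n} \<times> {..<n}. G p) = (\<Sum>p\<in>(\<lambda>j. (r, j)) ` {..<n}. G p)"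
    proof (intro sum.mono_neutral_right ballI that)
      show "fst p \<noteq> r" if "p \<in> {..<n} \<times> {..<n} - (\<lambda>j. (r, j)) ` {..<n}" for p
        using that by (cases p) auto
    qed (use \<open>r < n\<close> in auto)
    then show ?thesis
      by (simp add: sum.reindex inj_on_def)
  qed
  have "(\<Sum>p\<in>{..<n} \<times> {..<n}. \<Sum>q\<in>{..<n} \<times> {..<n}. F p q) = (\<Sum>j<n. \<Sum>l<n. F (r, j) (r, l))"
    using F0 by (subst restr, simp, intro sum.cong refl, subst restr) auto
  also have "\<dots> = d * (\<Sum>j<n. \<Sum>l<n. c (r, j) * c (r, l) * h (z j) (z l))"
    by (simp add: F1 sum_distrib_left)
  also have "\<dots> \<le> D\<^sup>2 * e\<^sup>2"
  proof (rule mult_mono)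
    show "0 \<le> (\<Sum>j<n. \<Sum>l<n. c (r, j) * c (r, l) * h (z j) (z l))"
      using z by (intro pos_def_kernelD[OF pd(2)]) auto
  qed (use D row in \<open>auto simp: d_def\<close>)
  finally show "(\<Sum>p\<in>{..<n} \<times> {..<n}. \<Sum>q\<in>{..<n} \<times> {..<n}. c p * c q * ?k (?x p) (?x q)
      - c p * c q * ?k (?x p) (?x' q) - c p * c q * ?k (?x' p) (?x q)
      + c p * c q * ?k (?x' p) (?x' q)) \<le> (D * e)\<^sup>2"
    by (simp add: F_def power_mult_distrib)
qed (use D row in auto)

lemma kernel_norm_change_right:
  assumes pd: "pos_def_kernel A g" "pos_def_kernel B h"
    and y: "\<And>i. i < n \<Longrightarrow> y i \<in> A" and z: "\<And>i. i < n \<Longrightarrow> z i \<in> B" and "r < n" "u \<in> B"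
    and D: "h (z r) (z r) + h u u - 2 * h (z r) u \<le> D\<^sup>2" "0 \<le> D"
    and col: "(\<Sum>j<n. \<Sum>l<n. c (j, r) * c (l, r) * g (y j) (y l)) \<le> e\<^sup>2" "0 \<le> e"
  shows "\<bar>kernel_norm (product_kernel g h) ({..<n} \<times> {..<n}) c (grid y (z(r := u)))
      - kernel_norm (product_kernel g h) ({..<n} \<times> {..<n}) c (grid y z)\<bar> \<le> D * e"
proof -
  let ?c = "\<lambda>p. c (prod.swap p)"
  have "\<bar>kernel_norm (product_kernel h g) ({..<n} \<times> {..<n}) ?c (grid (z(r := u)) y)
      - kernel_norm (product_kernel h g) ({..<n} \<times> {..<n}) ?c (grid z y)\<bar> \<le> D * e"
    using kernel_norm_change_left[of B h A g n z y r u D ?c e] assms by simp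
  then show ?thesis
    by (simp only: kernel_norm_transpose[of g h])
qed

section \<open>The V-statistic as a squared norm\<close>

text \<open>Coefficients of the empirical cross-covariance of \<open>y\<close> and \<open>z \<circ> \<sigma>\<close>:
  the mean of \<open>\<phi> (y i) \<otimes> \<psi> (z (\<sigma> i))\<close> minus the tensor product of
  the two means.\<close>

definition cov_coef :: "nat \<Rightarrow> (nat \<Rightarrow> nat) \<Rightarrow> nat \<times> nat \<Rightarrow> real" where
  "cov_coef n \<sigma> p = (if snd p = \<sigma> (fst p) then 1 / real n else 0) - 1 / (real n)\<^sup>2"

definition graph_coef :: "nat \<Rightarrow> (nat \<Rightarrow> nat) \<Rightarrow> nat \<times> nat \<Rightarrow> real" where
  "graph_coef n \<sigma> p = (if snd p = \<sigma> (fst p) then 1 / real n else 0)"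

lemma sum_graph_coef:
  assumes "\<And>i. i < n \<Longrightarrow> \<sigma> i < n"
  shows "(\<Sum>p\<in>{..<n} \<times> {..<n}. graph_coef n \<sigma> p * F p) = (\<Sum>i<n. F (i, \<sigma> i)) / real n"
proof -
  have "(\<Sum>p\<in>{..<n} \<times> {..<n}. graph_coef n \<sigma> p * F p) = (\<Sum>i<n. \<Sum>j<n. graph_coef n \<sigma> (i, j) * F (i, j))"
    by (simp add: sum.cartesian_product)
  also have "\<dots> = (\<Sum>i<n. \<Sum>j<n. if j = \<sigma> i then F (i, \<sigma> i) / real n else 0)"
    by (intro sum.cong refl) (auto simp: graph_coef_def)
  also have "\<dots> = (\<Sum>i<n. F (i, \<sigma> i) / real n)"
    using assms by (intro sum.cong refl) (simp add: sum.delta')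
  finally show ?thesis
    by (simp add: sum_divide_distrib)
qed

lemma cov_coef_eq: "cov_coef n \<sigma> p = graph_coef n \<sigma> p - 1 / (real n)\<^sup>2"
  by (simp add: cov_coef_def graph_coef_def)

lemma sum_grid_product:
  "(\<Sum>p\<in>I \<times> J. f (fst p) * g (snd p)) = sum f I * sum g J" for f :: "_ \<Rightarrow> real"
  by (simp add: sum_product sum.cartesian_product split_beta')

text \<open>The kernel \<open>h_in\<close> is the inner product of \<open>(\<phi>\<^sub>1 - \<phi>\<^sub>4) \<otimes>
  (\<psi>\<^sub>1 - \<psi>\<^sub>4)\<close> and \<open>(\<phi>\<^sub>2 - \<phi>\<^sub>3) \<otimes>
  (\<psi>\<^sub>2 - \<psi>\<^sub>3)\<close>. Hence the V-statistic is the squared norm of the mean of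
  \<open>(\<phi>\<^sub>i - \<phi>\<^sub>j) \<otimes> (\<psi>\<^sub>i - \<psi>\<^sub>j)\<close> over all
  pairs, which is twice the cross-covariance.\<close>

lemma V_stat_eq_kernel_norm:
  assumes pd: "pos_def_kernel A gY" "pos_def_kernel B gZ"
    and y: "\<And>i. i < n \<Longrightarrow> y i \<in> A" and z: "\<And>i. i < n \<Longrightarrow> z i \<in> B"
    and \<sigma>: "bij_betw \<sigma> {..<n} {..<n}" and "0 < n"
  shows "V_stat gY gZ n y (\<lambda>i. z (\<sigma> i))
    = (2 * kernel_norm (product_kernel gY gZ) ({..<n} \<times> {..<n}) (cov_coef n \<sigma>) (grid y z))\<^sup>2"
proof -
  let ?I = "{..<n} \<times> {..<n}"
  have \<sigma>n: "\<sigma> i < n" if "i < n" for i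
    using bij_betwE[OF \<sigma>] that by auto
  have "pos_def_kernel (y ` {..<n}) gY"
    using y by (intro pos_def_kernel_subset[OF pd(1)]) auto
  from pos_def_kernel_finite_features[OF _ this] obtain \<phi> and d :: nat
    where \<phi>: "\<And>i j. i < n \<Longrightarrow> j < n \<Longrightarrow> gY (y i) (y j) = (\<Sum>a<d. \<phi> (y i) a * \<phi> (y j) a)"
    by auto
  have "pos_def_kernel (z ` {..<n}) gZ"
    using z by (intro pos_def_kernel_subset[OF pd(2)]) auto
  from pos_def_kernel_finite_features[OF _ this] obtain \<psi> and e :: nat
    where \<psi>: "\<And>i j. i < n \<Longrightarrow> j < n \<Longrightarrow> gZ (z i) (z j) = (\<Sum>b<e. \<psi> (z i) b * \<psi> (z j) b)"
    by auto
  let ?E = "{..<d} \<times> {..<e}"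
  define f where "f i a = \<phi> (y i) a" for i a
  define g where "g i b = \<psi> (z (\<sigma> i)) b" for i b
  define S where "S a b = (\<Sum>i<n. f i a * g i b) / n - (\<Sum>i<n. f i a) * (\<Sum>i<n. g i b) / (real n)\<^sup>2" for a b
  have gsum: "(\<Sum>i<n. g i b) = (\<Sum>i<n. \<psi> (z i) b)" for b
    unfolding g_def by (rule sum.reindex_bij_betw[OF \<sigma>])
  have "(kernel_norm (product_kernel gY gZ) ?I (cov_coef n \<sigma>) (grid y z))\<^sup>2
      = (\<Sum>p\<in>?I. \<Sum>q\<in>?I. cov_coef n \<sigma> p * cov_coef n \<sigma> q * product_kernel gY gZ (grid y z p) (grid y z q))"
    using y z by (intro kernel_norm_sq[OF pos_def_kernel_product[OF pd]]) (auto simp: grid_def)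
  also have "\<dots> = (\<Sum>t\<in>?E. (\<Sum>p\<in>?I. cov_coef n \<sigma> p * (\<phi> (fst (grid y z p)) (fst t) * \<psi> (snd (grid y z p)) (snd t)))
      * (\<Sum>p\<in>?I. cov_coef n \<sigma> p * (\<phi> (fst (grid y z p)) (fst t) * \<psi> (snd (grid y z p)) (snd t))))"
    by (rule kernel_form_features[where \<phi> = "\<lambda>w t. \<phi> (fst w) (fst t) * \<psi> (snd w) (snd t)"])
      (auto simp: grid_def product_kernel_def \<phi> \<psi> sum_product sum.cartesian_product mult_ac intro!: sum.cong)
  also have "\<dots> = (\<Sum>t\<in>?E. S (fst t) (snd t) * S (fst t) (snd t))"
  proof -
    have "(\<Sum>p\<in>?I. cov_coef n \<sigma> p * (\<phi> (fst (grid y z p)) a * \<psi> (snd (grid y z p)) b)) = S a b" for a b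
    proof -
      have "(\<Sum>p\<in>?I. cov_coef n \<sigma> p * (\<phi> (fst (grid y z p)) a * \<psi> (snd (grid y z p)) b))
          = (\<Sum>p\<in>?I. graph_coef n \<sigma> p * (f (fst p) a * \<psi> (z (snd p)) b))
            - (\<Sum>p\<in>?I. f (fst p) a * \<psi> (z (snd p)) b) / (real n)\<^sup>2"
        by (simp add: cov_coef_eq left_diff_distrib sum_subtractf sum_divide_distrib f_def grid_def)
      also have "\<dots> = S a b"
        by (subst sum_graph_coef[OF \<sigma>n], assumption, subst sum_grid_product)
          (unfold S_def gsum, simp add: g_def)
      finally show ?thesis .
    qed
    then show ?thesis
      by simp
  qed
  finally have kn: "(kernel_norm (product_kernel gY gZ) ?I (cov_coef n \<sigma>) (grid y z))\<^sup>2
      = (\<Sum>t\<in>?E. (S (fst t) (snd t))\<^sup>2)"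
    by (simp add: power2_eq_square)
  \<comment> \<open>The arguments of \<open>h_in\<close> are regrouped into the pairs (1, 4) and (2, 3).\<close>
  define \<Phi> where "\<Phi> p t = (f (fst p) (fst t) - f (snd p) (fst t)) * (g (fst p) (snd t) - g (snd p) (snd t))" for p t
  define H where "H p q = h_in gY gZ (y (fst p), z (\<sigma> (fst p))) (y (fst q), z (\<sigma> (fst q)))
      (y (snd q), z (\<sigma> (snd q))) (y (snd p), z (\<sigma> (snd p)))" for p q
  have H: "H p q = (\<Sum>t\<in>?E. \<Phi> p t * \<Phi> q t)" if "p \<in> ?I" "q \<in> ?I" for p q
  proof -
    obtain i j k l where pq: "p = (i, j)" "q = (k, l)"
      by (cases p, cases q)
    have lt: "i < n" "j < n" "k < n" "l < n"
      using that pq by auto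
    have u: "gY (y i) (y k) + gY (y l) (y j) - gY (y i) (y l) - gY (y k) (y j)
        = (\<Sum>a<d. (f i a - f j a) * (f k a - f l a))"
      using lt by (simp add: \<phi> f_def sum.distrib[symmetric] sum_subtractf[symmetric] algebra_simps)
    have v: "gZ (z (\<sigma> i)) (z (\<sigma> k)) + gZ (z (\<sigma> l)) (z (\<sigma> j)) - gZ (z (\<sigma> i)) (z (\<sigma> l)) - gZ (z (\<sigma> k)) (z (\<sigma> j))
        = (\<Sum>b<e. (g i b - g j b) * (g k b - g l b))"
      using lt \<sigma>n by (simp add: \<psi> g_def sum.distrib[symmetric] sum_subtractf[symmetric] algebra_simps)
    show ?thesis
      unfolding H_def pq h_in_def by (simp add: u v \<Phi>_def sum_product sum.cartesian_product mult_ac split_beta')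
  qed
  have \<Phi>sum: "(\<Sum>p\<in>?I. \<Phi> p t) = 2 * (real n)\<^sup>2 * S (fst t) (snd t)" for t
  proof -
    obtain a b where t: "t = (a, b)"
      by (cases t)
    have "(\<Sum>p\<in>?I. \<Phi> p t) = (\<Sum>i<n. \<Sum>j<n. f i a * g i b + f j a * g j b - f i a * g j b - f j a * g i b)"
      by (simp add: \<Phi>_def t sum.cartesian_product split_beta' algebra_simps)
    also have "\<dots> = 2 * real n * (\<Sum>i<n. f i a * g i b) - 2 * (\<Sum>i<n. f i a) * (\<Sum>i<n. g i b)"
    proof -
      have "(\<Sum>i<n. \<Sum>j<n. f j a * g i b) = (\<Sum>i<n. f i a) * (\<Sum>i<n. g i b)"
        by (subst sum.swap) (simp add: sum_product)
      then show ?thesis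
        by (simp add: sum.distrib sum_subtractf sum_product sum_distrib_left[symmetric])
    qed
    also have "\<dots> = 2 * (real n)\<^sup>2 * S a b"
      using \<open>0 < n\<close> by (simp add: S_def field_simps power2_eq_square)
    finally show ?thesis
      by (simp add: t)
  qed
  have "(\<Sum>i1<n. \<Sum>i2<n. \<Sum>i3<n. \<Sum>i4<n. h_in gY gZ (y i1, z (\<sigma> i1)) (y i2, z (\<sigma> i2)) (y i3, z (\<sigma> i3)) (y i4, z (\<sigma> i4)))
      = (\<Sum>i1<n. \<Sum>i4<n. \<Sum>i2<n. \<Sum>i3<n. H (i1, i4) (i2, i3))"
    unfolding H_def fst_conv snd_conv by (rule sum.cong[OF refl], rule sum_swap3)
  also have "\<dots> = (\<Sum>p\<in>?I. \<Sum>q\<in>?I. H p q)"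
  proof -
    have "(\<Sum>p\<in>?I. F p) = (\<Sum>i<n. \<Sum>j<n. F (i, j))" for F :: "nat \<times> nat \<Rightarrow> real"
      by (simp add: sum.cartesian_product)
    then show ?thesis
      by simp
  qed
  also have "\<dots> = (\<Sum>p\<in>?I. \<Sum>q\<in>?I. 1 * 1 * H p q)"
    by simp
  also have "\<dots> = (\<Sum>t\<in>?E. (\<Sum>p\<in>?I. 1 * \<Phi> p t) * (\<Sum>p\<in>?I. 1 * \<Phi> p t))"
    by (rule kernel_form_features[where x = "\<lambda>p. p" and x' = "\<lambda>p. p"]) (use H in auto)
  also have "\<dots> = real n ^ 4 * (4 * (\<Sum>t\<in>?E. (S (fst t) (snd t))\<^sup>2))"
    by (simp add: \<Phi>sum sum_distrib_left power2_eq_square power4_eq_xxxx mult_ac)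
  finally show ?thesis
    unfolding V_stat_def power_mult_distrib kn using \<open>0 < n\<close> by simp
qed

lemma kernel_norm_graph_coef_sq:
  assumes pd: "pos_def_kernel A gY" "pos_def_kernel B gZ"
    and y: "\<And>i. i < n \<Longrightarrow> y i \<in> A" and z: "\<And>i. i < n \<Longrightarrow> z i \<in> B"
    and \<sigma>: "\<And>i. i < n \<Longrightarrow> \<sigma> i < n"
  shows "(kernel_norm (product_kernel gY gZ) ({..<n} \<times> {..<n}) (graph_coef n \<sigma>) (grid y z))\<^sup>2
    = (\<Sum>i<n. \<Sum>k<n. gY (y i) (y k) * gZ (z (\<sigma> i)) (z (\<sigma> k))) / (real n)\<^sup>2"
proof -
  let ?I = "{..<n} \<times> {..<n}" and ?K = "\<lambda>p q. product_kernel gY gZ (grid y z p) (grid y z q)"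
  have "(kernel_norm (product_kernel gY gZ) ?I (graph_coef n \<sigma>) (grid y z))\<^sup>2
      = (\<Sum>p\<in>?I. \<Sum>q\<in>?I. graph_coef n \<sigma> p * graph_coef n \<sigma> q * ?K p q)"
    using y z by (intro kernel_norm_sq[OF pos_def_kernel_product[OF pd]]) (auto simp: grid_def)
  also have "\<dots> = (\<Sum>p\<in>?I. graph_coef n \<sigma> p * (\<Sum>q\<in>?I. graph_coef n \<sigma> q * ?K p q))"
    by (simp add: sum_distrib_left mult_ac)
  also have "\<dots> = (\<Sum>i<n. (\<Sum>k<n. ?K (i, \<sigma> i) (k, \<sigma> k)) / n) / n"
    by (simp only: sum_graph_coef[OF \<sigma>])
  finally show ?thesis
    by (simp add: sum_divide_distrib power2_eq_square grid_def product_kernel_def)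
qed

lemma kernel_norm_const_coef_sq:
  assumes pd: "pos_def_kernel A gY" "pos_def_kernel B gZ"
    and y: "\<And>i. i < n \<Longrightarrow> y i \<in> A" and z: "\<And>i. i < n \<Longrightarrow> z i \<in> B"
  shows "(kernel_norm (product_kernel gY gZ) ({..<n} \<times> {..<n}) (\<lambda>_. 1 / (real n)\<^sup>2) (grid y z))\<^sup>2
    = (\<Sum>i<n. \<Sum>k<n. gY (y i) (y k)) / (real n)\<^sup>2 * ((\<Sum>j<n. \<Sum>l<n. gZ (z j) (z l)) / (real n)\<^sup>2)"
proof -
  let ?I = "{..<n} \<times> {..<n}" and ?K = "\<lambda>p q. product_kernel gY gZ (grid y z p) (grid y z q)"
  have "(kernel_norm (product_kernel gY gZ) ?I (\<lambda>_. 1 / (real n)\<^sup>2) (grid y z))\<^sup>2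
      = (\<Sum>p\<in>?I. \<Sum>q\<in>?I. 1 / (real n)\<^sup>2 * (1 / (real n)\<^sup>2) * ?K p q)"
    using y z by (intro kernel_norm_sq[OF pos_def_kernel_product[OF pd]]) (auto simp: grid_def)
  also have "\<dots> = (\<Sum>p\<in>?I. \<Sum>q\<in>?I. gY (y (fst p)) (y (fst q)) * gZ (z (snd p)) (z (snd q))) / ((real n)\<^sup>2 * (real n)\<^sup>2)"
    by (simp add: sum_divide_distrib grid_def product_kernel_def)
  also have "(\<Sum>p\<in>?I. \<Sum>q\<in>?I. gY (y (fst p)) (y (fst q)) * gZ (z (snd p)) (z (snd q)))
      = (\<Sum>p\<in>?I. (\<Sum>k<n. gY (y (fst p)) (y k)) * (\<Sum>l<n. gZ (z (snd p)) (z l)))"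
    by (intro sum.cong refl sum_grid_product)
  also have "\<dots> = (\<Sum>i<n. \<Sum>k<n. gY (y i) (y k)) * (\<Sum>j<n. \<Sum>l<n. gZ (z j) (z l))"
    by (rule sum_grid_product)
  finally show ?thesis
    by simp
qed

text \<open>The form is the squared norm of \<open>(\<psi> (z r) - mean) / n\<close>, and the mean lies in the convex
  hull of the features, whose diameter is at most \<open>D\<close>.\<close>

lemma centered_column_bound:
  assumes pd: "pos_def_kernel B h" and z: "\<And>i. i < n \<Longrightarrow> z i \<in> B" and "r < n"
    and diam: "\<And>u v. u \<in> B \<Longrightarrow> v \<in> B \<Longrightarrow> h u u + h v v - 2 * h u v \<le> D\<^sup>2"
  shows "(\<Sum>j<n. \<Sum>l<n. ((if j = r then 1 / real n else 0) - 1 / (real n)\<^sup>2)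
      * ((if l = r then 1 / real n else 0) - 1 / (real n)\<^sup>2) * h (z j) (z l)) \<le> (D / n)\<^sup>2"
proof -
  have n: "0 < real n"
    using \<open>r < n\<close> by simp
  define T where "T = (\<Sum>j<n. \<Sum>l<n. h (z j) (z l))"
  define R where "R = (\<Sum>l<n. h (z r) (z l))"
  have sym: "h (z j) (z r) = h (z r) (z j)" if "j < n" for j
    using pos_def_kernel_sym[OF pd z[OF that] z[OF \<open>r < n\<close>]] .
  have T: "T \<le> n * (\<Sum>l<n. h (z l) (z l))"
  proof -
    have "2 * T \<le> (\<Sum>j<n. \<Sum>l<n. h (z j) (z j) + h (z l) (z l))"
      unfolding T_def sum_distrib_left using pos_def_kernel_abs_le[OF pd] z
      by (intro sum_mono) (smt (verit) lessThan_iff)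
    also have "\<dots> = 2 * (n * (\<Sum>l<n. h (z l) (z l)))"
      by (simp add: sum.distrib sum_distrib_left[symmetric])
    finally show ?thesis
      by simp
  qed
  have inner: "(\<Sum>l<n. ((if l = r then 1 / real n else 0) - 1 / (real n)\<^sup>2) * w l)
      = w r / n - (\<Sum>l<n. w l) / (real n)\<^sup>2" for w
  proof -
    have "(\<Sum>l<n. ((if l = r then 1 / real n else 0) - 1 / (real n)\<^sup>2) * w l)
        = (\<Sum>l<n. (if l = r then w r / real n else 0) - w l / (real n)\<^sup>2)"
      by (intro sum.cong) (auto simp: field_simps)
    then show ?thesis
      using \<open>r < n\<close> by (simp add: sum_subtractf sum_divide_distrib)
  qed
  have "(\<Sum>j<n. \<Sum>l<n. ((if j = r then 1 / real n else 0) - 1 / (real n)\<^sup>2)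
      * ((if l = r then 1 / real n else 0) - 1 / (real n)\<^sup>2) * h (z j) (z l))
    = (\<Sum>j<n. ((if j = r then 1 / real n else 0) - 1 / (real n)\<^sup>2)
      * (h (z j) (z r) / n - (\<Sum>l<n. h (z j) (z l)) / (real n)\<^sup>2))"
    by (simp only: mult.assoc sum_distrib_left[symmetric] inner)
  also have "\<dots> = (h (z r) (z r) / n - R / (real n)\<^sup>2) / n - ((\<Sum>j<n. h (z r) (z j)) / n - T / (real n)\<^sup>2) / (real n)\<^sup>2"
    using sym by (simp add: inner R_def T_def sum_subtractf sum_divide_distrib)
  also have "\<dots> = (n * h (z r) (z r) - 2 * R + T / n) / (real n ^ 3)"
    using n by (simp add: R_def[symmetric] field_simps power2_eq_square power3_eq_cube)
  also have "\<dots> \<le> (n * h (z r) (z r) - 2 * R + (\<Sum>l<n. h (z l) (z l))) / (real n ^ 3)"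
    using T n by (intro divide_right_mono) (auto simp: field_simps)
  also have "n * h (z r) (z r) - 2 * R + (\<Sum>l<n. h (z l) (z l))
      = (\<Sum>l<n. h (z r) (z r) + h (z l) (z l) - 2 * h (z r) (z l))"
    by (simp add: R_def sum.distrib sum_subtractf sum_distrib_left)
  also have "\<dots> / (real n ^ 3) \<le> (n * D\<^sup>2) / (real n ^ 3)"
    using diam z \<open>r < n\<close> by (intro divide_right_mono sum_bounded_above[THEN order_trans]) auto
  also have "\<dots> = (D / n)\<^sup>2"
    using n by (simp add: field_simps power2_eq_square power3_eq_cube)
  finally show ?thesis .
qed

section \<open>Swapping paired bins\<close>

definition partner :: "nat \<Rightarrow> nat \<Rightarrow> nat" where
  "partner n i = (if i < n div 2 then i + n div 2 else i - n div 2)"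

definition bin_pair :: "nat \<Rightarrow> nat \<Rightarrow> nat \<Rightarrow> nat" where
  "bin_pair n m i = (i mod (n div 2)) div m"

text \<open>The permutation of data points that a permutation of bins induces. There are \<open>2 h\<close> bins of
  \<open>m\<close> points, and the \<open>b\<close>-th coin exchanges bins \<open>b\<close> and \<open>b
  + h\<close>, that is, every point of these bins with the one \<open>n / 2 = h m\<close> positions away.\<close>

definition swap_bins :: "nat \<Rightarrow> nat \<Rightarrow> (nat \<Rightarrow> bool) \<Rightarrow> nat \<Rightarrow> nat" where
  "swap_bins n m c i = (if c (bin_pair n m i) then partner n i else i)"

locale paired_bins =
  fixes n m h :: nat
  assumes n_eq: "n = 2 * h * m" and h_pos: "0 < h" and m_pos: "0 < m"
begin

lemma half: "n div 2 = h * m"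
  by (simp add: n_eq)

lemma hm_pos: "0 < h * m"
  using h_pos m_pos by simp

lemma n_pos: "0 < n"
  using h_pos m_pos by (simp add: n_eq)

lemma partner_less: "i < n \<Longrightarrow> partner n i < n"
  by (auto simp: partner_def half n_eq)

lemma partner_neq: "i < n \<Longrightarrow> partner n i \<noteq> i"
  using hm_pos by (simp only: partner_def half split: if_split) linarith

lemma partner_partner: "i < n \<Longrightarrow> partner n (partner n i) = i"
  by (auto simp: partner_def half n_eq)

lemma bin_pair_low: "i < h * m \<Longrightarrow> bin_pair n m i = i div m"
  by (simp add: bin_pair_def half)

lemma bin_pair_high: "h * m \<le> i \<Longrightarrow> i < n \<Longrightarrow> bin_pair n m i = (i - h * m) div m"
  by (simp add: bin_pair_def half n_eq le_mod_geq)

lemma bin_pair_partner: "i < n \<Longrightarrow> bin_pair n m (partner n i) = bin_pair n m i"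
  using bin_pair_low[of i] bin_pair_high[of i] bin_pair_low[of "i - h * m"] bin_pair_high[of "i + h * m"]
  by (auto simp: partner_def half n_eq)

lemma bin_pair_less: "bin_pair n m i < h"
  unfolding bin_pair_def half using hm_pos m_pos
  by (metis div_less_iff_less_mult mod_less_divisor mult.commute)

lemma card_bin_pair:
  assumes "b < h"
  shows "card {i\<in>{..<n}. bin_pair n m i = b} = 2 * m"
proof -
  have bm: "b * m + m \<le> h * m"
    using assms by (metis Suc_leI add.commute mult_Suc mult_le_mono1)
  have lt: "i < n \<longleftrightarrow> i < h * m + h * m" for i
    unfolding n_eq by linarith
  have div: "i div m = b \<longleftrightarrow> b * m \<le> i \<and> i < b * m + m" for i
  proof -
    have "i div m = b \<longleftrightarrow> b \<le> i div m \<and> i div m < Suc b"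
      by auto
    then show ?thesis
      using m_pos by (simp add: less_eq_div_iff_mult_less_eq div_less_iff_less_mult add.commute)
  qed
  have "{i\<in>{..<n}. bin_pair n m i = b} = {b * m..<b * m + m} \<union> {h * m + b * m..<h * m + b * m + m}"
  proof (intro set_eqI)
    fix i
    show "i \<in> {i\<in>{..<n}. bin_pair n m i = b} \<longleftrightarrow>
        i \<in> {b * m..<b * m + m} \<union> {h * m + b * m..<h * m + b * m + m}"
    proof (cases "i < h * m")
      case True
      then show ?thesis
        using bm by (auto simp: bin_pair_low[OF True] div lt)
    next
      case False
      then obtain j where i: "i = h * m + j"
        by (metis le_Suc_ex not_less)
      have "i < n \<Longrightarrow> bin_pair n m i = j div m"
        using bin_pair_high[of i] by (simp add: i)
      then show ?thesis
        using bm div[of j] by (auto simp: lt i)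
    qed
  qed
  moreover have "{b * m..<b * m + m} \<inter> {h * m + b * m..<h * m + b * m + m} = {}"
    using bm by auto
  ultimately show ?thesis
    by (simp add: card_Un_disjoint)
qed

lemma swap_bins_less: "i < n \<Longrightarrow> swap_bins n m c i < n"
  by (simp add: swap_bins_def partner_less)

lemma swap_bins_involution: "i < n \<Longrightarrow> swap_bins n m c (swap_bins n m c i) = i"
  by (simp add: swap_bins_def partner_partner bin_pair_partner)

lemma permute_bins_wild_perm:
  assumes "j < n"
  shows "permute_bins n (2 * h) (wild_perm (2 * h) c) z j = z (swap_bins n m c j)"
proof -
  have m: "n div (2 * h) = m"
    using h_pos by (simp add: n_eq)
  have "wild_perm (2 * h) c (j div m) * m + j mod m = swap_bins n m c j"
  proof (cases "j < h * m")
    case True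
    then have "j div m < h"
      using m_pos by (simp add: less_mult_imp_div_less)
    then show ?thesis
      using True by (auto simp: wild_perm_def swap_bins_def bin_pair_low partner_def half algebra_simps)
  next
    case False
    have jm: "j div m < 2 * h"
      using assms by (simp add: n_eq less_mult_imp_div_less)
    have hj: "h \<le> j div m"
      using False m_pos by (simp add: less_eq_div_iff_mult_less_eq)
    obtain k where k: "j = k + h * m"
      using False by (metis le_add_diff_inverse2 not_less)
    have "(j - h * m) div m = j div m - h"
      using m_pos by (simp add: k)
    then have bp: "bin_pair n m j = j div m - h"
      using bin_pair_high[of j] False assms by simp
    have "(j div m - h) * m + j mod m = j - h * m"
      using hj by (simp add: diff_mult_distrib)
    then show ?thesis
      using False jm hj by (auto simp: wild_perm_def swap_bins_def bp partner_def half)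
  qed
  then show ?thesis
    by (simp add: permute_bins_def m)
qed

lemma V_stat_permute_bins:
  "V_stat gY gZ n y (permute_bins n (2 * h) (wild_perm (2 * h) c) z)
    = V_stat gY gZ n y (\<lambda>j. z (swap_bins n m c j))"
  unfolding V_stat_def by (simp add: permute_bins_wild_perm)

end

text \<open>A root of a sum of squares moves no more than its only changing entry.\<close>

lemma L2_set_single_change:
  assumes "finite I" and "\<And>i. i \<in> I \<Longrightarrow> i \<noteq> b \<Longrightarrow> f i = g i" and "\<bar>f b - g b\<bar> \<le> e"
  shows "\<bar>L2_set f I - L2_set g I\<bar> \<le> e"
proof -
  have *: "L2_set f I \<le> L2_set g I + e"
    if "\<And>i. i \<in> I \<Longrightarrow> i \<noteq> b \<Longrightarrow> f i = g i" "\<bar>f b - g b\<bar> \<le> e" for f g :: "'a \<Rightarrow> real"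
  proof -
    have "L2_set f I \<le> L2_set g I + L2_set (\<lambda>i. f i - g i) I"
      using L2_set_triangle_ineq[of g "\<lambda>i. f i - g i" I] by simp
    moreover have "L2_set (\<lambda>i. f i - g i) I \<le> (\<Sum>i\<in>I. \<bar>f i - g i\<bar>)"
      by (rule L2_set_le_sum_abs)
    moreover have "(\<Sum>i\<in>I. \<bar>f i - g i\<bar>) \<le> (\<Sum>i\<in>I. if i = b then e else 0)"
      using that by (intro sum_mono) auto
    moreover have "\<dots> \<le> e"
      using order_trans[OF abs_ge_zero that(2)] assms(1) by (simp add: sum.delta)
    ultimately show ?thesis
      by linarith
  qed
  have "L2_set f I \<le> L2_set g I + e" "L2_set g I \<le> L2_set f I + e"
    using assms by (auto intro!: * simp: abs_minus_commute)
  then show ?thesis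
    by linarith
qed

locale paired_kernels = paired_bins n m h
  for n m h :: nat +
  fixes A :: "'y set" and B :: "'z set" and gY :: "'y \<Rightarrow> 'y \<Rightarrow> real" and gZ :: "'z \<Rightarrow> 'z \<Rightarrow> real"
    and DY DZ :: real
  assumes pdY: "pos_def_kernel A gY" and pdZ: "pos_def_kernel B gZ"
    and diamY: "\<And>u v. u \<in> A \<Longrightarrow> v \<in> A \<Longrightarrow> gY u u + gY v v - 2 * gY u v \<le> DY\<^sup>2"
    and diamZ: "\<And>u v. u \<in> B \<Longrightarrow> v \<in> B \<Longrightarrow> gZ u u + gZ v v - 2 * gZ u v \<le> DZ\<^sup>2"
    and DY_pos: "0 < DY" and DZ_pos: "0 < DZ"
begin

abbreviation "tensor_norm \<equiv> kernel_norm (product_kernel gY gZ) ({..<n} \<times> {..<n})"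

definition cov_norm :: "(nat \<Rightarrow> nat) \<Rightarrow> (nat \<Rightarrow> 'y) \<Rightarrow> (nat \<Rightarrow> 'z) \<Rightarrow> real" where
  "cov_norm \<sigma> y z = tensor_norm (cov_coef n \<sigma>) (grid y z)"

text \<open>The change of the cross-covariance when the \<open>b\<close>-th pair of bins is swapped, up to the sign.
  It does not depend on the other coins.\<close>

definition flip_coef :: "nat \<Rightarrow> nat \<times> nat \<Rightarrow> real" where
  "flip_coef b p = (if bin_pair n m (fst p) = b
     then graph_coef n (\<lambda>i. i) p - graph_coef n (partner n) p else 0)"

definition flip_norm :: "nat \<Rightarrow> (nat \<Rightarrow> 'y) \<Rightarrow> (nat \<Rightarrow> 'z) \<Rightarrow> real" where
  "flip_norm b y z = tensor_norm (flip_coef b) (grid y z)"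

text \<open>The root of the sum of the squared bounded differences with respect to the coins, which is the scale in
  McDiarmid's inequality for the coins.\<close>

definition flip_total :: "(nat \<Rightarrow> 'y) \<Rightarrow> (nat \<Rightarrow> 'z) \<Rightarrow> real" where
  "flip_total y z = L2_set (\<lambda>b. flip_norm b y z) {..<h}"

lemma grid_in: "(\<And>i. i < n \<Longrightarrow> y i \<in> A) \<Longrightarrow> (\<And>i. i < n \<Longrightarrow> z i \<in> B) \<Longrightarrow>
    p \<in> {..<n} \<times> {..<n} \<Longrightarrow> grid y z p \<in> A \<times> B"
  by (auto simp: grid_def)

lemmas pd_prod = pos_def_kernel_product[OF pdY pdZ]

lemma V_stat_eq_cov_norm:
  assumes "\<And>i. i < n \<Longrightarrow> y i \<in> A" "\<And>i. i < n \<Longrightarrow> z i \<in> B"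
    and "\<And>i. i < n \<Longrightarrow> \<sigma> i < n" "\<And>i. i < n \<Longrightarrow> \<sigma> (\<sigma> i) = i"
  shows "V_stat gY gZ n y (\<lambda>i. z (\<sigma> i)) = (2 * cov_norm \<sigma> y z)\<^sup>2"
proof -
  have "bij_betw \<sigma> {..<n} {..<n}"
    by (rule bij_betw_byWitness[of _ \<sigma>]) (use assms(3,4) in auto)
  from V_stat_eq_kernel_norm[OF pdY pdZ assms(1,2) this n_pos] show ?thesis
    by (simp add: cov_norm_def)
qed

lemma cov_norm_nonneg:
  assumes "\<And>i. i < n \<Longrightarrow> y i \<in> A" "\<And>i. i < n \<Longrightarrow> z i \<in> B"
  shows "0 \<le> cov_norm \<sigma> y z"
  unfolding cov_norm_def by (intro kernel_norm_nonneg[OF pd_prod] grid_in assms) auto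

lemma flip_norm_nonneg:
  assumes "\<And>i. i < n \<Longrightarrow> y i \<in> A" "\<And>i. i < n \<Longrightarrow> z i \<in> B"
  shows "0 \<le> flip_norm b y z"
  unfolding flip_norm_def by (intro kernel_norm_nonneg[OF pd_prod] grid_in assms) auto

lemma cov_norm_flip:
  assumes "\<And>i. i < n \<Longrightarrow> y i \<in> A" "\<And>i. i < n \<Longrightarrow> z i \<in> B"
  shows "\<bar>cov_norm (swap_bins n m (c(b := v))) y z - cov_norm (swap_bins n m c) y z\<bar> \<le> flip_norm b y z"
proof (cases "c b = v")
  case True
  then have "c(b := v) = c"
    by auto
  then show ?thesis
    using flip_norm_nonneg[OF assms] by simp
next
  case False
  define w where "w p = cov_coef n (swap_bins n m (c(b := v))) p - cov_coef n (swap_bins n m c) p" for p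
  have "w p = (if v then - flip_coef b p else flip_coef b p)" for p
    using False by (auto simp: w_def cov_coef_eq flip_coef_def swap_bins_def graph_coef_def)
  then have "w p * w q = flip_coef b p * flip_coef b q" for p q
    by simp
  then have "tensor_norm w (grid y z) = flip_norm b y z"
    by (simp add: flip_norm_def kernel_norm_def)
  then show ?thesis
    using kernel_norm_coef_diff_le[OF pd_prod, of "{..<n} \<times> {..<n}" "grid y z"
        "cov_coef n (swap_bins n m (c(b := v)))" "cov_coef n (swap_bins n m c)"] grid_in[OF assms]
    by (simp add: cov_norm_def w_def[abs_def])
qed

lemma cov_norm_change_left:
  assumes "\<And>i. i < n \<Longrightarrow> y i \<in> A" "\<And>i. i < n \<Longrightarrow> z i \<in> B" "r < n" "u \<in> A"
    and "\<And>i. i < n \<Longrightarrow> \<sigma> i < n"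
  shows "\<bar>cov_norm \<sigma> (y(r := u)) z - cov_norm \<sigma> y z\<bar> \<le> DY * DZ / n"
proof -
  have "\<bar>cov_norm \<sigma> (y(r := u)) z - cov_norm \<sigma> y z\<bar> \<le> DY * (DZ / n)"
    unfolding cov_norm_def
  proof (rule kernel_norm_change_left[OF pdY pdZ assms(1-4) diamY])
    show "(\<Sum>j<n. \<Sum>l<n. cov_coef n \<sigma> (r, j) * cov_coef n \<sigma> (r, l) * gZ (z j) (z l)) \<le> (DZ / n)\<^sup>2"
      using centered_column_bound[OF pdZ assms(2) assms(5)[OF \<open>r < n\<close>] diamZ] by (simp add: cov_coef_def)
  qed (use assms DY_pos DZ_pos in auto)
  then show ?thesis
    by simp
qed

lemma cov_norm_change_right:
  assumes "\<And>i. i < n \<Longrightarrow> y i \<in> A" "\<And>i. i < n \<Longrightarrow> z i \<in> B" "r < n" "u \<in> B"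
    and "\<And>i. i < n \<Longrightarrow> \<sigma> i < n" "\<And>i. i < n \<Longrightarrow> \<sigma> (\<sigma> i) = i"
  shows "\<bar>cov_norm \<sigma> y (z(r := u)) - cov_norm \<sigma> y z\<bar> \<le> DY * DZ / n"
proof -
  have "\<bar>cov_norm \<sigma> y (z(r := u)) - cov_norm \<sigma> y z\<bar> \<le> DZ * (DY / n)"
    unfolding cov_norm_def
  proof (rule kernel_norm_change_right[OF pdY pdZ assms(1-4) diamZ])
    have eq: "cov_coef n \<sigma> (j, r) = (if j = \<sigma> r then 1 / real n else 0) - 1 / (real n)\<^sup>2" if "j < n" for j
      using assms(5,6) that \<open>r < n\<close> by (auto simp: cov_coef_def)
    show "(\<Sum>j<n. \<Sum>l<n. cov_coef n \<sigma> (j, r) * cov_coef n \<sigma> (l, r) * gY (y j) (y l)) \<le> (DY / n)\<^sup>2"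
      using centered_column_bound[OF pdY assms(1) assms(5)[OF \<open>r < n\<close>] diamY] by (simp add: eq)
  qed (use assms DY_pos DZ_pos in auto)
  then show ?thesis
    by (simp add: mult.commute)
qed

text \<open>The form is the squared norm of \<open>(\<psi> (x r) - \<psi> (x r')) / n\<close> for the partner
  \<open>r'\<close> of \<open>r\<close>.\<close>

lemma difference_column_bound:
  assumes pd: "pos_def_kernel C g" and x: "\<And>i. i < n \<Longrightarrow> x i \<in> C" and "r < n"
    and diam: "\<And>u v. u \<in> C \<Longrightarrow> v \<in> C \<Longrightarrow> g u u + g v v - 2 * g u v \<le> D\<^sup>2"
  shows "(\<Sum>j<n. \<Sum>l<n. ((if j = r then 1 / real n else 0) - (if j = partner n r then 1 / real n else 0))
      * ((if l = r then 1 / real n else 0) - (if l = partner n r then 1 / real n else 0)) * g (x j) (x l)) \<le> (D / n)\<^sup>2"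
proof -
  have pr: "partner n r < n"
    using \<open>r < n\<close> by (rule partner_less)
  have inner: "(\<Sum>l<n. ((if l = r then 1 / real n else 0) - (if l = partner n r then 1 / real n else 0)) * w l)
      = (w r - w (partner n r)) / n" for w
  proof -
    have "(\<Sum>l<n. ((if l = r then 1 / real n else 0) - (if l = partner n r then 1 / real n else 0)) * w l)
        = (\<Sum>l<n. (if l = r then w r / real n else 0) - (if l = partner n r then w (partner n r) / real n else 0))"
      by (intro sum.cong) (auto simp: field_simps)
    then show ?thesis
      using \<open>r < n\<close> pr by (simp add: sum_subtractf diff_divide_distrib)
  qed
  have "(\<Sum>j<n. \<Sum>l<n. ((if j = r then 1 / real n else 0) - (if j = partner n r then 1 / real n else 0))
      * ((if l = r then 1 / real n else 0) - (if l = partner n r then 1 / real n else 0)) * g (x j) (x l))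
    = (g (x r) (x r) + g (x (partner n r)) (x (partner n r)) - 2 * g (x r) (x (partner n r))) / (real n)\<^sup>2"
    using pos_def_kernel_sym[OF pd x[OF pr] x[OF \<open>r < n\<close>]]
    by (simp only: mult.assoc sum_distrib_left[symmetric] inner) (use n_pos in \<open>simp add: power2_eq_square field_simps\<close>)
  also have "\<dots> \<le> D\<^sup>2 / (real n)\<^sup>2"
    using \<open>r < n\<close> pr by (intro divide_right_mono diam x) auto
  finally show ?thesis
    by (simp add: power_divide)
qed

lemma flip_norm_change_left:
  assumes "\<And>i. i < n \<Longrightarrow> y i \<in> A" "\<And>i. i < n \<Longrightarrow> z i \<in> B" "r < n" "u \<in> A"
  shows "\<bar>flip_norm b (y(r := u)) z - flip_norm b y z\<bar> \<le> (if bin_pair n m r = b then DY * DZ / n else 0)"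
proof -
  define e where "e = (if bin_pair n m r = b then DZ / n else 0)"
  have "\<bar>flip_norm b (y(r := u)) z - flip_norm b y z\<bar> \<le> DY * e"
    unfolding flip_norm_def
  proof (rule kernel_norm_change_left[OF pdY pdZ assms(1-4) diamY])
    show "(\<Sum>j<n. \<Sum>l<n. flip_coef b (r, j) * flip_coef b (r, l) * gZ (z j) (z l)) \<le> e\<^sup>2"
      using difference_column_bound[OF pdZ assms(2) \<open>r < n\<close> diamZ]
      by (simp add: flip_coef_def graph_coef_def e_def)
  qed (use assms DY_pos DZ_pos in \<open>auto simp: e_def\<close>)
  then show ?thesis
    by (simp add: e_def split: if_splits)
qed

lemma flip_norm_change_right:
  assumes "\<And>i. i < n \<Longrightarrow> y i \<in> A" "\<And>i. i < n \<Longrightarrow> z i \<in> B" "r < n" "u \<in> B"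
  shows "\<bar>flip_norm b y (z(r := u)) - flip_norm b y z\<bar> \<le> (if bin_pair n m r = b then DY * DZ / n else 0)"
proof -
  define e where "e = (if bin_pair n m r = b then DY / n else 0)"
  have "\<bar>flip_norm b y (z(r := u)) - flip_norm b y z\<bar> \<le> DZ * e"
    unfolding flip_norm_def
  proof (rule kernel_norm_change_right[OF pdY pdZ assms(1-4) diamZ])
    have eq: "flip_coef b (j, r) = (if bin_pair n m r = b then
        (if j = r then 1 / real n else 0) - (if j = partner n r then 1 / real n else 0) else 0)" if "j < n" for j
      using partner_partner[OF that] partner_partner[OF \<open>r < n\<close>] bin_pair_partner[OF that]
        bin_pair_partner[OF \<open>r < n\<close>]
      by (auto simp: flip_coef_def graph_coef_def)
    show "(\<Sum>j<n. \<Sum>l<n. flip_coef b (j, r) * flip_coef b (l, r) * gY (y j) (y l)) \<le> e\<^sup>2"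
      using difference_column_bound[OF pdY assms(1) \<open>r < n\<close> diamY] by (simp add: eq e_def)
  qed (use assms DY_pos DZ_pos in \<open>auto simp: e_def\<close>)
  then show ?thesis
    by (simp add: e_def mult.commute split: if_splits)
qed

text \<open>A data point belongs to a single pair of bins, so it affects a single summand.\<close>

lemma flip_total_change_left:
  assumes "\<And>i. i < n \<Longrightarrow> y i \<in> A" "\<And>i. i < n \<Longrightarrow> z i \<in> B" "r < n" "u \<in> A"
  shows "\<bar>flip_total (y(r := u)) z - flip_total y z\<bar> \<le> DY * DZ / n"
  unfolding flip_total_def
proof (rule L2_set_single_change[where b = "bin_pair n m r"])
  show "flip_norm b (y(r := u)) z = flip_norm b y z" if "b \<noteq> bin_pair n m r" for b
    using flip_norm_change_left[OF assms, where b = b] that by simp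
qed (use flip_norm_change_left[OF assms, where b = "bin_pair n m r"] in auto)

lemma flip_total_change_right:
  assumes "\<And>i. i < n \<Longrightarrow> y i \<in> A" "\<And>i. i < n \<Longrightarrow> z i \<in> B" "r < n" "u \<in> B"
  shows "\<bar>flip_total y (z(r := u)) - flip_total y z\<bar> \<le> DY * DZ / n"
  unfolding flip_total_def
proof (rule L2_set_single_change[where b = "bin_pair n m r"])
  show "flip_norm b y (z(r := u)) = flip_norm b y z" if "b \<noteq> bin_pair n m r" for b
    using flip_norm_change_right[OF assms, where b = b] that by simp
qed (use flip_norm_change_right[OF assms, where b = "bin_pair n m r"] in auto)

lemma flip_norm_sq:
  assumes y: "\<And>i. i < n \<Longrightarrow> y i \<in> A" and z: "\<And>i. i < n \<Longrightarrow> z i \<in> B"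
  shows "(flip_norm b y z)\<^sup>2 = (\<Sum>i\<in>{i\<in>{..<n}. bin_pair n m i = b}. \<Sum>k\<in>{i\<in>{..<n}. bin_pair n m i = b}.
    gY (y i) (y k) * (gZ (z i) (z k) - gZ (z i) (z (partner n k)) - gZ (z (partner n i)) (z k)
      + gZ (z (partner n i)) (z (partner n k)))) / (real n)\<^sup>2"
proof -
  let ?I = "{..<n} \<times> {..<n}" and ?K = "\<lambda>p q. product_kernel gY gZ (grid y z p) (grid y z q)"
  let ?S = "{i\<in>{..<n}. bin_pair n m i = b}"
  have restr: "(\<Sum>p\<in>?I. flip_coef b p * F p) = (\<Sum>i\<in>?S. F (i, i) - F (i, partner n i)) / n" for F
  proof -
    define G where "G p = (if bin_pair n m (fst p) = b then F p else 0)" for p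
    have "(\<Sum>p\<in>?I. flip_coef b p * F p)
        = (\<Sum>p\<in>?I. graph_coef n (\<lambda>i. i) p * G p) - (\<Sum>p\<in>?I. graph_coef n (partner n) p * G p)"
      by (subst sum_subtractf[symmetric], intro sum.cong) (auto simp: flip_coef_def G_def algebra_simps)
    also have "\<dots> = (\<Sum>i<n. G (i, i) - G (i, partner n i)) / n"
      by (simp add: sum_graph_coef partner_less sum_subtractf diff_divide_distrib)
    also have "(\<Sum>i<n. G (i, i) - G (i, partner n i)) = (\<Sum>i\<in>?S. F (i, i) - F (i, partner n i))"
      unfolding G_def by (subst sum.inter_filter) (auto intro!: sum.cong)
    finally show ?thesis .
  qed
  have "(flip_norm b y z)\<^sup>2 = (\<Sum>p\<in>?I. \<Sum>q\<in>?I. flip_coef b p * flip_coef b q * ?K p q)"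
    unfolding flip_norm_def using grid_in[OF y z] by (intro kernel_norm_sq[OF pd_prod]) auto
  also have "\<dots> = (\<Sum>p\<in>?I. flip_coef b p * (\<Sum>q\<in>?I. flip_coef b q * ?K p q))"
    by (simp add: sum_distrib_left mult_ac)
  also have "\<dots> = (\<Sum>i\<in>?S. (\<Sum>k\<in>?S. ?K (i, i) (k, k) - ?K (i, i) (k, partner n k)) / n
      - (\<Sum>k\<in>?S. ?K (i, partner n i) (k, k) - ?K (i, partner n i) (k, partner n k)) / n) / n"
    by (simp only: restr)
  also have "\<dots> = (\<Sum>i\<in>?S. \<Sum>k\<in>?S. ?K (i, i) (k, k) - ?K (i, i) (k, partner n k)
      - ?K (i, partner n i) (k, k) + ?K (i, partner n i) (k, partner n k)) / (real n)\<^sup>2"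
    by (simp add: sum_divide_distrib[symmetric] diff_divide_distrib[symmetric] sum_subtractf[symmetric]
        power2_eq_square algebra_simps)
  finally show ?thesis
    by (simp add: grid_def product_kernel_def algebra_simps)
qed

definition mean_norm :: "(nat \<Rightarrow> 'y) \<Rightarrow> (nat \<Rightarrow> 'z) \<Rightarrow> real" where
  "mean_norm y z = tensor_norm (\<lambda>_. 1 / (real n)\<^sup>2) (grid y z)"

text \<open>The two tensors differ by the tensor product of the means of the features.\<close>

lemma cov_norm_graph_norm:
  assumes "\<And>i. i < n \<Longrightarrow> y i \<in> A" "\<And>i. i < n \<Longrightarrow> z i \<in> B"
  shows "\<bar>cov_norm \<sigma> y z - tensor_norm (graph_coef n \<sigma>) (grid y z)\<bar> \<le> mean_norm y z"
proof -
  have "tensor_norm (\<lambda>p. cov_coef n \<sigma> p - graph_coef n \<sigma> p) (grid y z) = mean_norm y z"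
    by (simp add: cov_coef_eq mean_norm_def kernel_norm_def)
  then show ?thesis
    using kernel_norm_coef_diff_le[OF pd_prod, of "{..<n} \<times> {..<n}" "grid y z" "cov_coef n \<sigma>" "graph_coef n \<sigma>"]
      grid_in[OF assms] by (simp add: cov_norm_def)
qed

end

section \<open>Independent samples, mean embeddings and centering\<close>

lemma (in prob_space) integrable_bounded:
  fixes f :: "'a \<Rightarrow> real"
  assumes "f \<in> borel_measurable M" "\<And>x. x \<in> space M \<Longrightarrow> \<bar>f x\<bar> \<le> C"
  shows "integrable M f"
  using assms by (intro integrable_const_bound[where B = C] AE_I2) auto

lemma (in prob_space) abs_expectation_le:
  fixes f :: "'a \<Rightarrow> real"
  assumes "\<And>x. x \<in> space M \<Longrightarrow> \<bar>f x\<bar> \<le> C"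
  shows "\<bar>expectation f\<bar> \<le> C"
proof (cases "integrable M f")
  case True
  have "\<bar>expectation f\<bar> \<le> (\<integral>x. C \<partial>M)"
    using assms by (intro order_trans[OF integral_abs_bound] integral_mono True
        Bochner_Integration.integrable_abs) auto
  then show ?thesis
    by (simp add: prob_space)
next
  case False
  obtain x where "x \<in> space M"
    using not_empty by blast
  with assms[of x] show ?thesis
    by (simp add: not_integrable_integral_eq[OF False])
qed

lemma integral_double_sum:
  fixes f :: "'i \<Rightarrow> 'j \<Rightarrow> 'a \<Rightarrow> real"
  assumes "\<And>i k. i \<in> A \<Longrightarrow> k \<in> B \<Longrightarrow> integrable M (f i k)"
  shows "(\<integral>x. (\<Sum>i\<in>A. \<Sum>k\<in>B. f i k x) \<partial>M) = (\<Sum>i\<in>A. \<Sum>k\<in>B. \<integral>x. f i k x \<partial>M)"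
proof -
  have "(\<integral>x. (\<Sum>i\<in>A. \<Sum>k\<in>B. f i k x) \<partial>M) = (\<Sum>i\<in>A. \<integral>x. (\<Sum>k\<in>B. f i k x) \<partial>M)"
    by (intro Bochner_Integration.integral_sum Bochner_Integration.integrable_sum assms)
  also have "\<dots> = (\<Sum>i\<in>A. \<Sum>k\<in>B. \<integral>x. f i k x \<partial>M)"
    by (intro sum.cong refl Bochner_Integration.integral_sum assms)
  finally show ?thesis .
qed

text \<open>Fubini's theorem for one coordinate, stated without splitting the index set, so that it also shows that
  an integrand vanishes in mean as soon as it does so in one coordinate.\<close>

lemma (in prob_space) integral_PiM_resample:
  fixes f :: "('i \<Rightarrow> 'a) \<Rightarrow> real"
  assumes "finite I" "i \<in> I" and f [measurable]: "f \<in> borel_measurable (\<Pi>\<^sub>M i\<in>I. M)"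
    and bdd: "\<And>x. x \<in> space (\<Pi>\<^sub>M i\<in>I. M) \<Longrightarrow> \<bar>f x\<bar> \<le> C"
  shows "(\<integral>x. f x \<partial>(\<Pi>\<^sub>M i\<in>I. M)) = (\<integral>x. (\<integral>u. f (x(i := u)) \<partial>M) \<partial>(\<Pi>\<^sub>M i\<in>I. M))"
proof -
  interpret product_sigma_finite "\<lambda>_. M"
    by unfold_locales
  interpret P: prob_space "\<Pi>\<^sub>M i\<in>I. M"
    by (intro prob_space_PiM prob_space_axioms)
  define I' where "I' = I - {i}"
  have I: "I = insert i I'" "finite I'" "i \<notin> I'"
    using assms by (auto simp: I'_def)
  define F where "F x = (\<integral>u. f (x(i := u)) \<partial>M)" for x
  have "(\<lambda>(x, u). f (x(i := u))) \<in> borel_measurable ((\<Pi>\<^sub>M i\<in>I. M) \<Otimes>\<^sub>M M)"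
    using measurable_compose[OF measurable_add_dim, of f i I "\<lambda>_. M"] f insert_absorb[OF \<open>i \<in> I\<close>]
    by (simp add: split_beta')
  then have F [measurable]: "F \<in> borel_measurable (\<Pi>\<^sub>M i\<in>I. M)"
    unfolding F_def by (rule borel_measurable_lebesgue_integral)
  have upd: "x(i := u) \<in> space (\<Pi>\<^sub>M i\<in>I. M)" if "x \<in> space (\<Pi>\<^sub>M i\<in>I. M)" "u \<in> space M" for x u
    using that \<open>i \<in> I\<close> by (auto simp: space_PiM PiE_def extensional_def)
  have Fb: "\<bar>F x\<bar> \<le> C" if "x \<in> space (\<Pi>\<^sub>M i\<in>I. M)" for x
    unfolding F_def using that by (intro abs_expectation_le bdd upd)
  have "(\<integral>x. F x \<partial>(\<Pi>\<^sub>M i\<in>I. M)) = (\<integral>x. (\<integral>v. F (x(i := v)) \<partial>M) \<partial>(\<Pi>\<^sub>M i\<in>I'. M))"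
    using product_integral_insert[OF I(2,3), of F] P.integrable_bounded[OF F Fb]
    by (simp add: I(1)[symmetric])
  also have "\<dots> = (\<integral>x. F x \<partial>(\<Pi>\<^sub>M i\<in>I'. M))"
    by (simp add: F_def prob_space)
  also have "\<dots> = (\<integral>x. f x \<partial>(\<Pi>\<^sub>M i\<in>I. M))"
    using product_integral_insert[OF I(2,3), of f] P.integrable_bounded[OF f bdd]
    by (simp add: I(1)[symmetric] F_def)
  finally show ?thesis
    by (simp add: F_def)
qed

lemma (in prob_space) integral_PiM_component:
  fixes f :: "'a \<Rightarrow> real"
  assumes "finite I" "i \<in> I" and [measurable]: "f \<in> borel_measurable M"
    and bdd: "\<And>x. x \<in> space M \<Longrightarrow> \<bar>f x\<bar> \<le> C"
  shows "(\<integral>x. f (x i) \<partial>(\<Pi>\<^sub>M i\<in>I. M)) = expectation f"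
proof -
  interpret P: prob_space "\<Pi>\<^sub>M i\<in>I. M"
    by (intro prob_space_PiM prob_space_axioms)
  have "(\<integral>x. f (x i) \<partial>(\<Pi>\<^sub>M i\<in>I. M)) = (\<integral>x. (\<integral>u. f ((x(i := u)) i) \<partial>M) \<partial>(\<Pi>\<^sub>M i\<in>I. M))"
    using assms by (intro integral_PiM_resample) (auto simp: space_PiM)
  then show ?thesis
    by (simp add: P.prob_space)
qed

lemma measurable_kernel_compose:
  assumes "(\<lambda>(u, v). g u v) \<in> borel_measurable (N \<Otimes>\<^sub>M N)" and [measurable]: "f \<in> M \<rightarrow>\<^sub>M N"
  shows "(\<lambda>(u, v). g (f u) (f v)) \<in> borel_measurable (M \<Otimes>\<^sub>M M)"
proof -
  have "(\<lambda>w. (\<lambda>(u, v). g u v) (f (fst w), f (snd w))) \<in> borel_measurable (M \<Otimes>\<^sub>M M)"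
    by (intro measurable_compose[OF _ assms(1)]) measurable
  then show ?thesis
    by (simp add: split_beta')
qed

lemma measurable_kernel_PiM:
  assumes "(\<lambda>(u, v). k u v) \<in> borel_measurable (M \<Otimes>\<^sub>M M)" "i \<in> I" "j \<in> I"
  shows "(\<lambda>x. k (x i) (x j)) \<in> borel_measurable (\<Pi>\<^sub>M i\<in>I. M)"
proof -
  have "(\<lambda>x. (\<lambda>(u, v). k u v) (x i, x j)) \<in> borel_measurable (\<Pi>\<^sub>M i\<in>I. M)"
    using assms(2,3)
    by (intro measurable_compose[OF _ assms(1)] measurable_Pair measurable_component_singleton)
  then show ?thesis
    by simp
qed

lemma (in prob_space) integral_PiM_pair:
  fixes k :: "'a \<Rightarrow> 'a \<Rightarrow> real"
  assumes "finite I" "i \<in> I" "j \<in> I" "i \<noteq> j"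
    and k [measurable]: "(\<lambda>(u, v). k u v) \<in> borel_measurable (M \<Otimes>\<^sub>M M)"
    and bdd: "\<And>u v. u \<in> space M \<Longrightarrow> v \<in> space M \<Longrightarrow> \<bar>k u v\<bar> \<le> C"
  shows "(\<integral>x. k (x i) (x j) \<partial>(\<Pi>\<^sub>M i\<in>I. M)) = (\<integral>u. (\<integral>v. k u v \<partial>M) \<partial>M)"
proof -
  have "(\<integral>x. k (x i) (x j) \<partial>(\<Pi>\<^sub>M i\<in>I. M))
      = (\<integral>x. (\<integral>v. k ((x(j := v)) i) ((x(j := v)) j) \<partial>M) \<partial>(\<Pi>\<^sub>M i\<in>I. M))"
  proof (rule integral_PiM_resample[where C = C])
    show "(\<lambda>x. k (x i) (x j)) \<in> borel_measurable (\<Pi>\<^sub>M i\<in>I. M)"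
      using k assms(2,3) by (rule measurable_kernel_PiM)
  qed (use assms in \<open>auto simp: space_PiM\<close>)
  also have "\<dots> = (\<integral>x. (\<lambda>u. \<integral>v. k u v \<partial>M) (x i) \<partial>(\<Pi>\<^sub>M i\<in>I. M))"
    using assms by simp
  also have "\<dots> = (\<integral>u. (\<integral>v. k u v \<partial>M) \<partial>M)"
    using assms by (intro integral_PiM_component[where C = C] abs_expectation_le
        borel_measurable_lebesgue_integral) auto
  finally show ?thesis .
qed

text \<open>Only the \<open>n\<close> diagonal terms out of \<open>n\<^sup>2\<close> have a nonzero mean.\<close>

lemma (in prob_space) centered_form:
  fixes k :: "'a \<Rightarrow> 'a \<Rightarrow> real"
  assumes k: "(\<lambda>(u, v). k u v) \<in> borel_measurable (M \<Otimes>\<^sub>M M)"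
    and bdd: "\<And>u v. u \<in> space M \<Longrightarrow> v \<in> space M \<Longrightarrow> \<bar>k u v\<bar> \<le> C"
    and centered: "\<And>u. u \<in> space M \<Longrightarrow> (\<integral>v. k u v \<partial>M) = 0" and "0 < n"
  defines "S \<equiv> \<lambda>x. (\<Sum>i<n. \<Sum>j<n. k (x i) (x j)) / (real n)\<^sup>2"
  shows "integrable (\<Pi>\<^sub>M i\<in>{..<n}. M) S"
    and "(\<integral>x. S x \<partial>(\<Pi>\<^sub>M i\<in>{..<n}. M)) \<le> C / n"
proof -
  let ?P = "\<Pi>\<^sub>M i\<in>{..<n}. M"
  interpret P: prob_space ?P
    by (intro prob_space_PiM prob_space_axioms)
  have X: "x i \<in> space M" if "x \<in> space ?P" "i < n" for x i
    using that by (auto simp: space_PiM)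
  have int: "integrable ?P (\<lambda>x. k (x i) (x j))" if "i < n" "j < n" for i j
    using that X by (intro P.integrable_bounded[where C = C] bdd measurable_kernel_PiM k) auto
  then show "integrable ?P S"
    unfolding S_def by (intro integrable_divide_zero Bochner_Integration.integrable_sum) auto
  have entry: "(\<integral>x. k (x i) (x j) \<partial>?P) \<le> (if i = j then C else 0)" if "i < n" "j < n" for i j
  proof (cases "i = j")
    case True
    have "\<bar>\<integral>x. k (x i) (x j) \<partial>?P\<bar> \<le> C"
      using that X by (intro P.abs_expectation_le bdd) auto
    with True show ?thesis
      by simp
  next
    case False
    have "(\<integral>x. k (x i) (x j) \<partial>?P) = (\<integral>u. (\<integral>v. k u v \<partial>M) \<partial>M)"
      using that False bdd by (intro integral_PiM_pair[OF _ _ _ _ k]) auto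
    also have "\<dots> = (\<integral>u. 0 \<partial>M)"
      by (intro Bochner_Integration.integral_cong refl centered)
    finally show ?thesis
      using False by simp
  qed
  have "(\<integral>x. S x \<partial>?P) = (\<Sum>i<n. \<Sum>j<n. (\<integral>x. k (x i) (x j) \<partial>?P)) / (real n)\<^sup>2"
    unfolding S_def integral_divide_zero by (subst integral_double_sum) (auto intro: int)
  also have "\<dots> \<le> (\<Sum>i<n. \<Sum>j<n. if i = j then C else 0) / (real n)\<^sup>2"
    by (intro divide_right_mono sum_mono entry) auto
  also have "\<dots> = C / n"
    by (simp add: power2_eq_square)
  finally show "(\<integral>x. S x \<partial>?P) \<le> C / n" .
qed

text \<open>The right-hand side is the squared distance of \<open>\<Sum>i<p. c i * k (x i) \<cdot>\<close> to
  \<open>t\<close> times the mean embedding of \<open>M\<close>. Replacing the embedding by the average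
  over \<open>N\<close> independent points gives a nonnegative quadratic form, whose expectation differs
  from the claimed one by \<open>O(1 / N)\<close>, since only the diagonal terms are wrong.\<close>

lemma (in prob_space) mean_embedding_nonneg:
  fixes k :: "'a \<Rightarrow> 'a \<Rightarrow> real" and p :: nat
  assumes k [measurable]: "(\<lambda>(u, v). k u v) \<in> borel_measurable (M \<Otimes>\<^sub>M M)"
    and bdd: "\<And>u v. u \<in> space M \<Longrightarrow> v \<in> space M \<Longrightarrow> \<bar>k u v\<bar> \<le> C"
    and pd: "pos_def_kernel (space M) k" and x: "\<And>i. i < p \<Longrightarrow> x i \<in> space M"
  shows "0 \<le> (\<Sum>i<p. \<Sum>j<p. c i * c j * k (x i) (x j)) - 2 * t * (\<Sum>i<p. c i * (\<integral>u. k (x i) u \<partial>M))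
    + t\<^sup>2 * (\<integral>u. (\<integral>v. k u v \<partial>M) \<partial>M)"
proof -
  define \<theta> where "\<theta> = (\<integral>u. (\<integral>v. k u v \<partial>M) \<partial>M)"
  define a where "a = (\<Sum>i<p. \<Sum>j<p. c i * c j * k (x i) (x j)) - 2 * t * (\<Sum>i<p. c i * (\<integral>u. k (x i) u \<partial>M))"
  have C: "0 \<le> C"
    using bdd not_empty by (metis abs_ge_zero ex_in_conv order_trans)
  have "0 \<le> a + t\<^sup>2 * \<theta> + t\<^sup>2 * (C - \<theta>) / N" if N: "0 < N" for N :: nat
  proof -
    let ?P = "\<Pi>\<^sub>M i\<in>{..<N}. M"
    interpret P: prob_space ?P
      by (intro prob_space_PiM prob_space_axioms)
    have X: "X i \<in> space M" if "X \<in> space ?P" "i < N" for X i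
      using that by (auto simp: space_PiM)
    have kx [measurable]: "(\<lambda>v. k u v) \<in> borel_measurable M" if "u \<in> space M" for u
      using that by measurable
    have m1: "integrable ?P (\<lambda>X. k (x i) (X j))" if "i < p" "j < N" for i j
    proof (rule P.integrable_bounded[where C = C])
      show "(\<lambda>X. k (x i) (X j)) \<in> borel_measurable ?P"
        using that by (intro measurable_compose[OF _ kx[OF x]] measurable_component_singleton) auto
    qed (use X x that bdd in auto)
    have m2: "integrable ?P (\<lambda>X. k (X j) (X l))" if "j < N" "l < N" for j l
    proof (rule P.integrable_bounded[where C = C])
      show "(\<lambda>X. k (X j) (X l)) \<in> borel_measurable ?P"
        using that by (intro measurable_kernel_PiM k) auto
    qed (use X that bdd in auto)
    define F where "F X = (\<Sum>i<p. \<Sum>j<p. c i * c j * k (x i) (x j))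
        + (\<Sum>i<p. \<Sum>j<N. 2 * c i * (- t / N) * k (x i) (X j))
        + (\<Sum>j<N. \<Sum>l<N. (- t / N) * (- t / N) * k (X j) (X l))" for X
    have F: "0 \<le> F X" if Xs: "X \<in> space ?P" for X
    proof -
      \<comment> \<open>The given points and the Monte Carlo points together, the latter with coefficients \<open>- t / N\<close>.\<close>
      define w where "w = case_sum x X"
      define e where "e = case_sum c (\<lambda>_::nat. - t / N)"
      have "0 \<le> (\<Sum>i\<in>{..<p} <+> {..<N}. \<Sum>j\<in>{..<p} <+> {..<N}. e i * e j * k (w i) (w j))"
        using x X[OF Xs] by (intro kernel_form_nonneg[OF pd]) (auto simp: w_def)
      also have "\<dots> = (\<Sum>i<p. (\<Sum>j<p. c i * c j * k (x i) (x j)) + (\<Sum>j<N. c i * (- t / N) * k (x i) (X j)))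
          + (\<Sum>j<N. (\<Sum>i<p. (- t / N) * c i * k (X j) (x i)) + (\<Sum>l<N. (- t / N) * (- t / N) * k (X j) (X l)))"
        by (simp add: sum.Plus w_def e_def)
      also have "(\<Sum>j<N. (\<Sum>i<p. (- t / N) * c i * k (X j) (x i)) + (\<Sum>l<N. (- t / N) * (- t / N) * k (X j) (X l)))
          = (\<Sum>i<p. \<Sum>j<N. c i * (- t / N) * k (x i) (X j)) + (\<Sum>j<N. \<Sum>l<N. (- t / N) * (- t / N) * k (X j) (X l))"
      proof -
        have "(\<Sum>j<N. \<Sum>i<p. (- t / N) * c i * k (X j) (x i)) = (\<Sum>i<p. \<Sum>j<N. c i * (- t / N) * k (x i) (X j))"
          using pos_def_kernel_sym[OF pd x X[OF Xs]]
          by (subst sum.swap) (intro sum.cong refl, simp add: mult_ac)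
        then show ?thesis
          by (simp add: sum.distrib)
      qed
      also have "(\<Sum>i<p. (\<Sum>j<p. c i * c j * k (x i) (x j)) + (\<Sum>j<N. c i * (- t / N) * k (x i) (X j)))
          + ((\<Sum>i<p. \<Sum>j<N. c i * (- t / N) * k (x i) (X j)) + (\<Sum>j<N. \<Sum>l<N. (- t / N) * (- t / N) * k (X j) (X l)))
        = (\<Sum>i<p. \<Sum>j<p. c i * c j * k (x i) (x j))
          + ((\<Sum>i<p. \<Sum>j<N. c i * (- t / N) * k (x i) (X j)) + (\<Sum>i<p. \<Sum>j<N. c i * (- t / N) * k (x i) (X j)))
          + (\<Sum>j<N. \<Sum>l<N. (- t / N) * (- t / N) * k (X j) (X l))"
        by (simp only: sum.distrib add_ac)
      also have "(\<Sum>i<p. \<Sum>j<N. c i * (- t / N) * k (x i) (X j)) + (\<Sum>i<p. \<Sum>j<N. c i * (- t / N) * k (x i) (X j))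
          = (\<Sum>i<p. \<Sum>j<N. 2 * c i * (- t / N) * k (x i) (X j))"
        by (simp add: sum.distrib[symmetric] mult_ac)
      finally show ?thesis
        by (simp add: F_def)
    qed
    have "0 \<le> (\<integral>X. F X \<partial>?P)"
      using F by (intro integral_nonneg_AE AE_I2)
    also have "\<dots> = (\<Sum>i<p. \<Sum>j<p. c i * c j * k (x i) (x j))
        + (\<Sum>i<p. \<Sum>j<N. 2 * c i * (- t / N) * (\<integral>X. k (x i) (X j) \<partial>?P))
        + (\<Sum>j<N. \<Sum>l<N. (- t / N) * (- t / N) * (\<integral>X. k (X j) (X l) \<partial>?P))"
    proof -
      have i1: "integrable ?P (\<lambda>X. 2 * c i * (- t / N) * k (x i) (X j))"
        if "i \<in> {..<p}" "j \<in> {..<N}" for i j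
        using m1[of i j] that by (intro Bochner_Integration.integrable_mult_right) auto
      have i2: "integrable ?P (\<lambda>X. (- t / N) * (- t / N) * k (X j) (X l))"
        if "j \<in> {..<N}" "l \<in> {..<N}" for j l
        using m2[of j l] that by (intro Bochner_Integration.integrable_mult_right) auto
      have e1: "(\<integral>X. (\<Sum>i<p. \<Sum>j<N. 2 * c i * (- t / N) * k (x i) (X j)) \<partial>?P)
          = (\<Sum>i<p. \<Sum>j<N. 2 * c i * (- t / N) * (\<integral>X. k (x i) (X j) \<partial>?P))"
        using i1 by (simp only: Bochner_Integration.integral_sum Bochner_Integration.integrable_sum
            Bochner_Integration.integral_mult_right_zero cong: sum.cong)
      have e2: "(\<integral>X. (\<Sum>j<N. \<Sum>l<N. (- t / N) * (- t / N) * k (X j) (X l)) \<partial>?P)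
          = (\<Sum>j<N. \<Sum>l<N. (- t / N) * (- t / N) * (\<integral>X. k (X j) (X l) \<partial>?P))"
        using i2 by (simp only: Bochner_Integration.integral_sum Bochner_Integration.integrable_sum
            Bochner_Integration.integral_mult_right_zero cong: sum.cong)
      have split: "(\<integral>X. b + G X + H X \<partial>?P) = b + P.expectation G + P.expectation H"
        if "integrable ?P G" "integrable ?P H" for b :: real and G H
        using that P.prob_space by simp
      show ?thesis
        unfolding F_def e1[symmetric] e2[symmetric]
        by (rule split) (intro Bochner_Integration.integrable_sum i1 i2; assumption)+
    qed
    also have "(\<Sum>i<p. \<Sum>j<N. 2 * c i * (- t / N) * (\<integral>X. k (x i) (X j) \<partial>?P))
        = (\<Sum>i<p. \<Sum>j<N. 2 * c i * (- t / N) * (\<integral>u. k (x i) u \<partial>M))"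
    proof (intro sum.cong refl)
      fix i j assume "i \<in> {..<p}" "j \<in> {..<N}"
      then have "(\<integral>X. k (x i) (X j) \<partial>?P) = (\<integral>u. k (x i) u \<partial>M)"
        using x bdd by (intro integral_PiM_component[where C = C] kx) auto
      then show "2 * c i * (- t / N) * (\<integral>X. k (x i) (X j) \<partial>?P)
          = 2 * c i * (- t / N) * (\<integral>u. k (x i) u \<partial>M)"
        by simp
    qed
    also have "\<dots> = - 2 * t * (\<Sum>i<p. c i * (\<integral>u. k (x i) u \<partial>M))"
      using N by (simp add: sum_distrib_left sum_negf mult_ac)
    also have "(\<Sum>j<N. \<Sum>l<N. (- t / N) * (- t / N) * (\<integral>X. k (X j) (X l) \<partial>?P))
        \<le> (\<Sum>j<N. \<Sum>l<N. (- t / N) * (- t / N) * (\<theta> + (if l = j then C - \<theta> else 0)))"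
    proof (intro sum_mono mult_left_mono)
      fix j l assume "j \<in> {..<N}" "l \<in> {..<N}"
      then show "(\<integral>X. k (X j) (X l) \<partial>?P) \<le> \<theta> + (if l = j then C - \<theta> else 0)"
        using integral_PiM_pair[of "{..<N}" j l k C] bdd X
          P.abs_expectation_le[of "\<lambda>X. k (X j) (X l)" C]
        by (auto simp: \<theta>_def abs_le_iff)
    qed auto
    also have "\<dots> = (- t / N) * (- t / N) * (N * (N * \<theta> + (C - \<theta>)))"
    proof -
      have "(\<Sum>l<N. \<theta> + (if l = j then C - \<theta> else 0)) = N * \<theta> + (C - \<theta>)" if "j < N" for j
        using that by (simp add: sum.distrib)
      then show ?thesis
        unfolding sum_distrib_left[symmetric] by simp
    qed
    also have "\<dots> = t\<^sup>2 * \<theta> + t\<^sup>2 * (C - \<theta>) / N"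
      using N by (simp add: power2_eq_square field_simps)
    finally show ?thesis
      by (simp add: a_def algebra_simps)
  qed
  then have "\<forall>N\<ge>1. 0 \<le> a + t\<^sup>2 * \<theta> + t\<^sup>2 * (C - \<theta>) / real N"
    by auto
  moreover have "(\<lambda>N. a + t\<^sup>2 * \<theta> + t\<^sup>2 * (C - \<theta>) / real N) \<longlonglongrightarrow> a + t\<^sup>2 * \<theta> + 0"
    by (intro tendsto_add tendsto_const lim_const_over_n)
  ultimately have "0 \<le> a + t\<^sup>2 * \<theta> + 0"
    by (intro LIMSEQ_le_const) auto
  then show ?thesis
    by (simp add: a_def \<theta>_def)
qed

text \<open>The kernel of the features minus their mean.\<close>

definition centered_kernel :: "'a measure \<Rightarrow> ('a \<Rightarrow> 'a \<Rightarrow> real) \<Rightarrow> 'a \<Rightarrow> 'a \<Rightarrow> real" where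
  "centered_kernel M g x x' = g x x' - (\<integral>u. g x u \<partial>M) - (\<integral>u. g x' u \<partial>M) + (\<integral>u. (\<integral>v. g u v \<partial>M) \<partial>M)"

text \<open>In \<open>h_in\<close>, a summand that depends on one argument of the kernel cancels.\<close>

lemma V_stat_centered_kernel:
  "V_stat (centered_kernel M g) (centered_kernel N h) n y z = V_stat g h n y z"
  by (simp add: V_stat_def h_in_def centered_kernel_def algebra_simps)

text \<open>Positive definiteness is the nonnegativity of the distance to the mean embedding with \<open>t\<close>
  the sum of the coefficients.\<close>

lemma (in prob_space) centered_kernel:
  fixes g :: "'a \<Rightarrow> 'a \<Rightarrow> real"
  assumes g [measurable]: "(\<lambda>(u, v). g u v) \<in> borel_measurable (M \<Otimes>\<^sub>M M)"
    and bdd: "\<And>u v. u \<in> space M \<Longrightarrow> v \<in> space M \<Longrightarrow> \<bar>g u v\<bar> \<le> C"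
    and pd: "pos_def_kernel (space M) g"
  shows "(\<lambda>(u, v). centered_kernel M g u v) \<in> borel_measurable (M \<Otimes>\<^sub>M M)"
    and "pos_def_kernel (space M) (centered_kernel M g)"
    and "\<And>x. x \<in> space M \<Longrightarrow> (\<integral>u. centered_kernel M g x u \<partial>M) = 0"
proof -
  have a [measurable]: "(\<lambda>x. \<integral>u. g x u \<partial>M) \<in> borel_measurable M"
    by (rule borel_measurable_lebesgue_integral) fact
  show "(\<lambda>(u, v). centered_kernel M g u v) \<in> borel_measurable (M \<Otimes>\<^sub>M M)"
    unfolding centered_kernel_def by measurable
  show "pos_def_kernel (space M) (centered_kernel M g)"
    unfolding pos_def_kernel_def
  proof (intro conjI ballI allI impI)
    fix x x' assume "x \<in> space M" "x' \<in> space M"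
    then show "centered_kernel M g x x' = centered_kernel M g x' x"
      using pos_def_kernel_sym[OF pd] by (simp add: centered_kernel_def)
  next
    fix p :: nat and x and c :: "nat \<Rightarrow> real" assume x: "\<forall>i<p. x i \<in> space M"
    define s where "s = (\<Sum>i<p. c i)"
    let ?b = "\<lambda>i. \<integral>u. g (x i) u \<partial>M" and ?t = "\<integral>u. (\<integral>v. g u v \<partial>M) \<partial>M"
    have "0 \<le> (\<Sum>i<p. \<Sum>j<p. c i * c j * g (x i) (x j)) - 2 * s * (\<Sum>i<p. c i * ?b i) + s\<^sup>2 * ?t"
      using mean_embedding_nonneg[OF g bdd pd] x by blast
    also have "\<dots> = (\<Sum>i<p. \<Sum>j<p. c i * c j * g (x i) (x j)) - (\<Sum>i<p. \<Sum>j<p. c i * ?b i * c j)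
        - (\<Sum>i<p. \<Sum>j<p. c i * (c j * ?b j)) + (\<Sum>i<p. \<Sum>j<p. c i * c j * ?t)"
      by (simp add: s_def sum_product[symmetric] sum_distrib_right[symmetric] power2_eq_square)
    also have "\<dots> = (\<Sum>i<p. \<Sum>j<p. c i * c j * centered_kernel M g (x i) (x j))"
      by (simp add: centered_kernel_def sum.distrib[symmetric] sum_subtractf[symmetric] algebra_simps)
    finally show "0 \<le> (\<Sum>i<p. \<Sum>j<p. c i * c j * centered_kernel M g (x i) (x j))" .
  qed
  fix x assume x: "x \<in> space M"
  have [measurable]: "(\<lambda>v. g x v) \<in> borel_measurable M"
    using x by measurable
  have "integrable M (\<lambda>u. g x u)"
    using x bdd by (intro integrable_bounded[where C = C]) auto
  moreover have "integrable M (\<lambda>u. \<integral>v. g u v \<partial>M)"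
    using bdd by (intro integrable_bounded[where C = C] abs_expectation_le a) auto
  ultimately show "(\<integral>u. centered_kernel M g x u \<partial>M) = 0"
    by (simp add: centered_kernel_def prob_space)
qed

section \<open>Expected norms\<close>

lemma (in prob_space) expectation_le_sqrt_second_moment:
  fixes X :: "'a \<Rightarrow> real"
  assumes "integrable M X" "integrable M (\<lambda>x. (X x)\<^sup>2)"
  shows "expectation X \<le> sqrt (expectation (\<lambda>x. (X x)\<^sup>2))"
proof -
  have "(expectation X)\<^sup>2 \<le> expectation (\<lambda>x. (X x)\<^sup>2)"
    using variance_positive[of X] variance_eq[OF assms] by simp
  then show ?thesis
    using real_le_rsqrt by blast
qed

lemma swap_coins_flip_prob:
  assumes "b < q div 2"
  shows "measure_pmf.expectation (swap_coins q) (\<lambda>c. if c b then 0 else 1 :: real) = 1 / 2"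
proof -
  have "measure_pmf.expectation (map_pmf (\<lambda>c. c b) (swap_coins q)) (\<lambda>v. if v then 0 else 1 :: real) = 1 / 2"
    unfolding swap_coins_def by (subst Pi_pmf_component) (use assms in auto)
  then show ?thesis
    by simp
qed

lemma finite_set_swap_coins: "finite (set_pmf (swap_coins q))"
  unfolding swap_coins_def
  by (rule finite_subset[OF set_Pi_pmf_subset']) (auto intro: finite_PiE_dflt)

lemma expectation_swap_coins:
  "measure_pmf.expectation (swap_coins q) f = (\<Sum>c\<in>set_pmf (swap_coins q). pmf (swap_coins q) c * f c)"
  for f :: "_ \<Rightarrow> real"
  by (subst integral_measure_pmf[OF finite_set_swap_coins]) auto

text \<open>The data are an i.i.d. sample from \<open>J\<close>, and the kernels are centered for the marginals of
  \<open>J\<close>. The constants \<open>DY\<close> and \<open>DZ\<close> bound the norms of the features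
  and the distances between them.\<close>

locale paired_sample = paired_kernels n m h "space MY" "space MZ" gY gZ DY DZ + prob_space J
  for n m h :: nat and MY :: "'y measure" and MZ :: "'z measure"
    and gY :: "'y \<Rightarrow> 'y \<Rightarrow> real" and gZ :: "'z \<Rightarrow> 'z \<Rightarrow> real" and DY DZ :: real
    and J :: "('y \<times> 'z) measure" +
  assumes sets_J: "sets J = sets (MY \<Otimes>\<^sub>M MZ)"
    and gY_meas: "(\<lambda>(u, v). gY u v) \<in> borel_measurable (MY \<Otimes>\<^sub>M MY)"
    and gZ_meas: "(\<lambda>(u, v). gZ u v) \<in> borel_measurable (MZ \<Otimes>\<^sub>M MZ)"
    and centeredY: "\<And>y. y \<in> space MY \<Longrightarrow> (\<integral>x. gY y (fst x) \<partial>J) = 0"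
    and centeredZ: "\<And>z. z \<in> space MZ \<Longrightarrow> (\<integral>x. gZ z (snd x) \<partial>J) = 0"
    and diagY: "\<And>y. y \<in> space MY \<Longrightarrow> gY y y \<le> DY\<^sup>2"
    and diagZ: "\<And>z. z \<in> space MZ \<Longrightarrow> gZ z z \<le> DZ\<^sup>2"
begin

abbreviation P :: "(nat \<Rightarrow> 'y \<times> 'z) measure" where
  "P \<equiv> \<Pi>\<^sub>M i\<in>{..<n}. J"

abbreviation Y :: "(nat \<Rightarrow> 'y \<times> 'z) \<Rightarrow> nat \<Rightarrow> 'y" where
  "Y x \<equiv> \<lambda>i. fst (x i)"

abbreviation Z :: "(nat \<Rightarrow> 'y \<times> 'z) \<Rightarrow> nat \<Rightarrow> 'z" where
  "Z x \<equiv> \<lambda>i. snd (x i)"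

sublocale P: prob_space P
  by (intro prob_space_PiM prob_space_axioms)

definition D :: real where "D = DY * DZ"

lemma D_pos: "0 < D"
  using DY_pos DZ_pos by (simp add: D_def)

lemma space_J: "space J = space MY \<times> space MZ"
  using sets_eq_imp_space_eq[OF sets_J] by (simp add: space_pair_measure)

lemma fst_meas [measurable]: "fst \<in> J \<rightarrow>\<^sub>M MY" and snd_meas [measurable]: "snd \<in> J \<rightarrow>\<^sub>M MZ"
  by (simp_all add: measurable_cong_sets[OF sets_J refl])

lemma sample_in: "x \<in> space P \<Longrightarrow> i < n \<Longrightarrow> x i \<in> space J"
  by (auto simp: space_PiM)

lemma Y_in: "x \<in> space P \<Longrightarrow> i < n \<Longrightarrow> Y x i \<in> space MY"
  and Z_in: "x \<in> space P \<Longrightarrow> i < n \<Longrightarrow> Z x i \<in> space MZ"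
  using sample_in[of x i] by (auto simp: space_J)

lemma grid_sample: "x \<in> space P \<Longrightarrow> p \<in> {..<n} \<times> {..<n} \<Longrightarrow> grid (Y x) (Z x) p \<in> space MY \<times> space MZ"
  using Y_in[of x "fst p"] Z_in[of x "snd p"] by (auto simp: grid_def)

lemma abs_gY: "u \<in> space MY \<Longrightarrow> v \<in> space MY \<Longrightarrow> \<bar>gY u v\<bar> \<le> DY\<^sup>2"
  using pos_def_kernel_abs_le[OF pdY, of u v] diagY[of u] diagY[of v] by simp

lemma abs_gZ: "u \<in> space MZ \<Longrightarrow> v \<in> space MZ \<Longrightarrow> \<bar>gZ u v\<bar> \<le> DZ\<^sup>2"
  using pos_def_kernel_abs_le[OF pdZ, of u v] diagZ[of u] diagZ[of v] by simp

lemma abs_gY_gZ: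
  "u \<in> space MY \<Longrightarrow> v \<in> space MY \<Longrightarrow> u' \<in> space MZ \<Longrightarrow> v' \<in> space MZ \<Longrightarrow> \<bar>gY u v * gZ u' v'\<bar> \<le> D\<^sup>2"
  unfolding D_def abs_mult power_mult_distrib by (intro mult_mono abs_gY abs_gZ) auto

lemma gY_J: "(\<lambda>(u, v). gY (fst u) (fst v)) \<in> borel_measurable (J \<Otimes>\<^sub>M J)"
  and gZ_J: "(\<lambda>(u, v). gZ (snd u) (snd v)) \<in> borel_measurable (J \<Otimes>\<^sub>M J)"
  by (rule measurable_kernel_compose[OF gY_meas fst_meas] measurable_kernel_compose[OF gZ_meas snd_meas])+

lemma gY_P: "i < n \<Longrightarrow> k < n \<Longrightarrow> (\<lambda>x. gY (Y x i) (Y x k)) \<in> borel_measurable P"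
  and gZ_P: "i < n \<Longrightarrow> k < n \<Longrightarrow> (\<lambda>x. gZ (Z x i) (Z x k)) \<in> borel_measurable P"
  by (simp_all add: measurable_kernel_PiM[OF gY_J] measurable_kernel_PiM[OF gZ_J])

lemma gY_gZ_integrable:
  assumes "i < n" "k < n" "j < n" "l < n"
  shows "integrable P (\<lambda>x. gY (Y x i) (Y x k) * gZ (Z x j) (Z x l))"
  using assms Y_in Z_in by (intro P.integrable_bounded[where C = "D\<^sup>2"] abs_gY_gZ borel_measurable_times gY_P gZ_P) auto

abbreviation K :: "'y \<times> 'z \<Rightarrow> 'y \<times> 'z \<Rightarrow> real" where
  "K \<equiv> product_kernel gY gZ"

lemma K_eq: "K u v = gY (fst u) (fst v) * gZ (snd u) (snd v)"
  by (simp add: product_kernel_def split_beta')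

lemma K_meas: "(\<lambda>(u, v). K u v) \<in> borel_measurable (J \<Otimes>\<^sub>M J)"
  using borel_measurable_times[OF gY_J gZ_J] by (simp add: K_eq split_beta')

lemma K_bounded: "u \<in> space J \<Longrightarrow> v \<in> space J \<Longrightarrow> \<bar>K u v\<bar> \<le> D\<^sup>2"
  unfolding K_eq by (intro abs_gY_gZ) (auto simp: space_J)

lemma K_pd: "pos_def_kernel (space J) K"
  unfolding space_J by (rule pd_prod)

text \<open>The squared norm of the population cross-covariance operator.\<close>

definition \<theta>sq :: real where
  "\<theta>sq = (\<integral>u. (\<integral>v. K u v \<partial>J) \<partial>J)"

definition \<theta> :: real where "\<theta> = sqrt \<theta>sq"

lemma \<theta>sq_nonneg: "0 \<le> \<theta>sq"
  using mean_embedding_nonneg[OF K_meas K_bounded K_pd, of 0 undefined undefined 1] by (simp add: \<theta>sq_def)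

lemma \<theta>sq_le: "\<theta>sq \<le> D\<^sup>2"
  using abs_expectation_le[of "\<lambda>u. \<integral>v. K u v \<partial>J" "D\<^sup>2"] abs_expectation_le[of "K _" "D\<^sup>2"] K_bounded
  by (simp add: \<theta>sq_def abs_le_iff)

lemma \<theta>_nonneg: "0 \<le> \<theta>"
  using \<theta>sq_nonneg by (simp add: \<theta>_def)

lemma \<theta>_sq: "\<theta>\<^sup>2 = \<theta>sq"
  using \<theta>sq_nonneg by (simp add: \<theta>_def)

lemma \<theta>_le: "\<theta> \<le> D"
  unfolding \<theta>_def using \<theta>sq_le D_pos by (intro real_le_lsqrt) auto

text \<open>If an index of the first factor does not occur in the second one, integrating over this data point gives
  zero by centering. Otherwise the two index pairs agree up to order.\<close>

lemma mixed_moment: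
  assumes lt: "i < n" "k < n" "j < n" "l < n" and "i \<noteq> k" "j \<noteq> l"
  shows "(\<integral>x. gY (Y x i) (Y x k) * gZ (Z x j) (Z x l) \<partial>P) = (if {i, k} = {j, l} then \<theta>sq else 0)"
proof -
  let ?f = "\<lambda>x. gY (Y x i) (Y x k) * gZ (Z x j) (Z x l)"
  have sY: "gY (Y x i) (Y x k) = gY (Y x k) (Y x i)" if "x \<in> space P" for x
    using that lt Y_in by (intro pos_def_kernel_sym[OF pdY]) auto
  have sZ: "gZ (Z x j) (Z x l) = gZ (Z x l) (Z x j)" if "x \<in> space P" for x
    using that lt Z_in by (intro pos_def_kernel_sym[OF pdZ]) auto
  show ?thesis
  proof (cases "{i, k} = {j, l}")
    case True
    have "(\<integral>x. ?f x \<partial>P) = (\<integral>x. K (x i) (x k) \<partial>P)"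
      using True sZ by (intro Bochner_Integration.integral_cong refl) (auto simp: K_eq doubleton_eq_iff)
    also have "\<dots> = \<theta>sq"
      unfolding \<theta>sq_def using assms K_bounded by (intro integral_PiM_pair[OF _ _ _ _ K_meas]) auto
    finally show ?thesis
      using True by simp
  next
    case False
    have vanish: "(\<integral>x. gY (Y x i) (Y x k) * gZ (Z x j) (Z x l) \<partial>P) = 0"
      if *: "i < n" "k < n" "i \<noteq> k" "k \<notin> {j, l}" for i k
    proof -
      let ?f = "\<lambda>x. gY (Y x i) (Y x k) * gZ (Z x j) (Z x l)"
      have "(\<integral>x. ?f x \<partial>P) = (\<integral>x. (\<integral>u. ?f (x(k := u)) \<partial>J) \<partial>P)"
        using * lt Y_in Z_in
        by (intro integral_PiM_resample[where C = "D\<^sup>2"] borel_measurable_times gY_P gZ_P abs_gY_gZ) auto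
      also have "\<dots> = (\<integral>x. 0 \<partial>P)"
      proof (intro Bochner_Integration.integral_cong refl)
        fix x assume x: "x \<in> space P"
        have "(\<integral>u. ?f (x(k := u)) \<partial>J) = (\<integral>u. gY (Y x i) (fst u) * gZ (Z x j) (Z x l) \<partial>J)"
          using * by (intro Bochner_Integration.integral_cong refl) auto
        then show "(\<integral>u. ?f (x(k := u)) \<partial>J) = 0"
          using centeredY[OF Y_in[OF x \<open>i < n\<close>]] by simp
      qed
      finally show ?thesis
        by simp
    qed
    from False assms consider "k \<notin> {j, l}" | "i \<notin> {j, l}"
      by fastforce
    then have "(\<integral>x. ?f x \<partial>P) = 0"
    proof cases
      case 2
      have "(\<integral>x. ?f x \<partial>P) = (\<integral>x. gY (Y x k) (Y x i) * gZ (Z x j) (Z x l) \<partial>P)"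
        using sY by (intro Bochner_Integration.integral_cong refl) simp
      then show ?thesis
        using vanish[of k i] lt 2 \<open>i \<noteq> k\<close> by simp
    qed (use vanish[of i k] lt \<open>i \<noteq> k\<close> in simp)
    then show ?thesis
      using False by simp
  qed
qed

lemma tensor_norm_integrable: "integrable P (\<lambda>x. tensor_norm c (grid (Y x) (Z x)))"
proof (rule P.integrable_bounded)
  let ?I = "{..<n} \<times> {..<n}"
  show "(\<lambda>x. tensor_norm c (grid (Y x) (Z x))) \<in> borel_measurable P"
    unfolding kernel_norm_def grid_def K_eq fst_conv snd_conv
    by (intro measurable_compose[OF _ borel_measurable_sqrt] borel_measurable_sum borel_measurable_times borel_measurable_const gY_P gZ_P) auto
  show "\<bar>tensor_norm c (grid (Y x) (Z x))\<bar> \<le> sqrt (\<Sum>p\<in>?I. \<Sum>q\<in>?I. \<bar>c p * c q\<bar> * D\<^sup>2)" if x: "x \<in> space P" for x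
  proof -
    have abs_sqrt: "\<bar>sqrt a\<bar> = sqrt \<bar>a\<bar>" for a
      by (cases "0 \<le> a") (simp_all add: real_sqrt_minus)
    have "\<bar>\<Sum>p\<in>?I. \<Sum>q\<in>?I. c p * c q * K (grid (Y x) (Z x) p) (grid (Y x) (Z x) q)\<bar>
        \<le> (\<Sum>p\<in>?I. \<Sum>q\<in>?I. \<bar>c p * c q\<bar> * D\<^sup>2)"
    proof (intro order_trans[OF sum_abs] sum_mono)
      fix p q assume "p \<in> ?I" "q \<in> ?I"
      then show "\<bar>c p * c q * K (grid (Y x) (Z x) p) (grid (Y x) (Z x) q)\<bar> \<le> \<bar>c p * c q\<bar> * D\<^sup>2"
        unfolding abs_mult[of "c p * c q"] grid_def K_eq fst_conv snd_conv
        using Y_in[OF x] Z_in[OF x] by (intro mult_left_mono abs_gY_gZ) auto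
    qed
    then show ?thesis
      unfolding kernel_norm_def abs_sqrt by (rule real_sqrt_le_mono)
  qed
qed

lemma tensor_norm_sq_integrable: "integrable P (\<lambda>x. (tensor_norm c (grid (Y x) (Z x)))\<^sup>2)"
proof -
  let ?I = "{..<n} \<times> {..<n}"
  have "integrable P (\<lambda>x. \<Sum>p\<in>?I. \<Sum>q\<in>?I. c p * c q * (gY (Y x (fst p)) (Y x (fst q)) * gZ (Z x (snd p)) (Z x (snd q))))"
    by (intro Bochner_Integration.integrable_sum Bochner_Integration.integrable_mult_right gY_gZ_integrable) auto
  then show ?thesis
  proof (rule Bochner_Integration.integrable_cong[THEN iffD1, OF refl, rotated])
    fix x assume x: "x \<in> space P"
    show "(\<Sum>p\<in>?I. \<Sum>q\<in>?I. c p * c q * (gY (Y x (fst p)) (Y x (fst q)) * gZ (Z x (snd p)) (Z x (snd q))))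
        = (tensor_norm c (grid (Y x) (Z x)))\<^sup>2"
      using grid_sample[OF x]
      by (subst kernel_norm_sq[OF pd_prod]) (auto simp: grid_def K_eq)
  qed
qed

text \<open>By the Cauchy--Schwarz inequality, \<open>\<theta>\<close> times the empirical norm is at least the inner
  product of the empirical and the population operator, and the expectation of this inner product is
  \<open>\<theta>\<^sup>2\<close>.\<close>

lemma graph_norm_mean_ge: "\<theta> \<le> (\<integral>x. tensor_norm (graph_coef n (\<lambda>i. i)) (grid (Y x) (Z x)) \<partial>P)"
proof (cases "\<theta> = 0")
  case True
  have "0 \<le> (\<integral>x. tensor_norm (graph_coef n (\<lambda>i. i)) (grid (Y x) (Z x)) \<partial>P)"
    using grid_sample by (intro integral_nonneg_AE AE_I2 kernel_norm_nonneg[OF pd_prod]) auto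
  with True show ?thesis
    by simp
next
  case False
  then have pos: "0 < \<theta>"
    using \<theta>_nonneg by simp
  define \<mu> where "\<mu> u = (\<integral>v. K u v \<partial>J)" for u
  have \<mu>_meas: "\<mu> \<in> borel_measurable J"
    unfolding \<mu>_def by (rule borel_measurable_lebesgue_integral) (rule K_meas)
  have \<mu>_bdd: "\<bar>\<mu> u\<bar> \<le> D\<^sup>2" if "u \<in> space J" for u
    unfolding \<mu>_def using that by (intro abs_expectation_le K_bounded)
  have int: "integrable P (\<lambda>x. \<mu> (x i))" if "i < n" for i
    using that sample_in
    by (intro P.integrable_bounded[where C = "D\<^sup>2"] \<mu>_bdd measurable_compose[OF _ \<mu>_meas]
        measurable_component_singleton) auto
  have "\<theta>sq = (\<integral>x. (\<Sum>i<n. 1 / n * \<mu> (x i)) \<partial>P)"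
  proof -
    have "(\<integral>x. \<mu> (x i) \<partial>P) = \<theta>sq" if "i < n" for i
      unfolding \<theta>sq_def \<mu>_def[symmetric] using that
      by (intro integral_PiM_component[where C = "D\<^sup>2"] \<mu>_meas \<mu>_bdd) auto
    then have "(\<Sum>i<n. 1 / n * (\<integral>x. \<mu> (x i) \<partial>P)) = \<theta>sq"
      using n_pos by simp
    then show ?thesis
      using int by (subst Bochner_Integration.integral_sum) auto
  qed
  also have "\<dots> \<le> (\<integral>x. \<theta> * tensor_norm (graph_coef n (\<lambda>i. i)) (grid (Y x) (Z x)) \<partial>P)"
  proof (intro integral_mono Bochner_Integration.integrable_sum Bochner_Integration.integrable_mult_right
      tensor_norm_integrable int)
    fix x assume x: "x \<in> space P"
    define a where "a = (\<Sum>i<n. 1 / n * \<mu> (x i))"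
    define N where "N = tensor_norm (graph_coef n (\<lambda>i. i)) (grid (Y x) (Z x))"
    have N: "N\<^sup>2 = (\<Sum>i<n. \<Sum>j<n. 1 / n * (1 / n) * K (x i) (x j))"
      unfolding N_def using kernel_norm_graph_coef_sq[OF pdY pdZ, of n "Y x" "Z x" "\<lambda>i. i"] Y_in[OF x] Z_in[OF x]
      by (simp add: K_eq sum_divide_distrib power2_eq_square)
    have N0: "0 \<le> N"
      unfolding N_def using grid_sample[OF x] by (intro kernel_norm_nonneg[OF pd_prod]) auto
    have "0 \<le> N\<^sup>2 - 2 * t * a + t\<^sup>2 * \<theta>sq" for t
      using mean_embedding_nonneg[OF K_meas K_bounded K_pd, of n x "\<lambda>_. 1 / n" t] sample_in[OF x]
      by (simp add: N a_def \<mu>_def \<theta>sq_def)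
    \<comment> \<open>The value of \<open>t\<close> that minimizes the quadratic polynomial.\<close>
    from this[of "a / \<theta>sq"] have "a\<^sup>2 \<le> (\<theta> * N)\<^sup>2"
      using pos by (simp add: \<theta>_sq[symmetric] field_simps power2_eq_square)
    then show "a \<le> \<theta> * N"
      using pos N0 by (simp add: abs_le_square_iff[symmetric])
  qed auto
  also have "\<dots> = \<theta> * (\<integral>x. tensor_norm (graph_coef n (\<lambda>i. i)) (grid (Y x) (Z x)) \<partial>P)"
    by simp
  finally show ?thesis
    using pos by (simp add: \<theta>_sq[symmetric] power2_eq_square)
qed

text \<open>The square of the norm is a product of two forms with means at most \<open>DY\<^sup>2 / n\<close> and
  \<open>DZ\<^sup>2 / n\<close>. The two are dependent; the inequality of arithmetic and geometric means,
  with weights that equalize the two bounds, separates them.\<close>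

lemma mean_norm_mean_le: "(\<integral>x. mean_norm (Y x) (Z x) \<partial>P) \<le> D / n"
proof -
  define S where "S x = (\<Sum>i<n. \<Sum>k<n. gY (Y x i) (Y x k)) / (real n)\<^sup>2" for x
  define T where "T x = (\<Sum>i<n. \<Sum>k<n. gZ (Z x i) (Z x k)) / (real n)\<^sup>2" for x
  have bounds: "\<bar>gY (fst u) (fst v)\<bar> \<le> DY\<^sup>2" "\<bar>gZ (snd u) (snd v)\<bar> \<le> DZ\<^sup>2"
    if "u \<in> space J" "v \<in> space J" for u v
    using that abs_gY abs_gZ by (auto simp: space_J)
  have zero: "(\<integral>v. gY (fst u) (fst v) \<partial>J) = 0" "(\<integral>v. gZ (snd u) (snd v) \<partial>J) = 0"
    if "u \<in> space J" for u
    using that centeredY centeredZ by (auto simp: space_J)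
  note formY = centered_form[OF gY_J bounds(1) zero(1) n_pos, folded S_def[abs_def]]
  note formZ = centered_form[OF gZ_J bounds(2) zero(2) n_pos, folded T_def[abs_def]]
  have "(\<integral>x. mean_norm (Y x) (Z x) \<partial>P) \<le> (\<integral>x. (DZ / DY * S x + DY / DZ * T x) / 2 \<partial>P)"
  proof (intro integral_mono)
    show "integrable P (\<lambda>x. mean_norm (Y x) (Z x))"
      unfolding mean_norm_def by (rule tensor_norm_integrable)
    show "integrable P (\<lambda>x. (DZ / DY * S x + DY / DZ * T x) / 2)"
      using formY(1) formZ(1) by simp
    fix x assume x: "x \<in> space P"
    have S: "0 \<le> S x" and T: "0 \<le> T x"
      unfolding S_def T_def
      using kernel_form_nonneg[OF pdY, of "{..<n}" "Y x" "\<lambda>_. 1"] kernel_form_nonneg[OF pdZ, of "{..<n}" "Z x" "\<lambda>_. 1"]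
        Y_in[OF x] Z_in[OF x] by auto
    have amgm: "a * b \<le> ((a + b) / 2)\<^sup>2" for a b :: real
      using sum_squares_bound[of a b] by (simp add: power2_eq_square field_simps)
    have "(mean_norm (Y x) (Z x))\<^sup>2 = S x * T x"
      unfolding mean_norm_def S_def T_def
      by (rule kernel_norm_const_coef_sq[OF pdY pdZ Y_in[OF x] Z_in[OF x]])
    also have "\<dots> = (DZ / DY * S x) * (DY / DZ * T x)"
      using DY_pos DZ_pos by simp
    also have "\<dots> \<le> ((DZ / DY * S x + DY / DZ * T x) / 2)\<^sup>2"
      by (rule amgm)
    finally show "mean_norm (Y x) (Z x) \<le> (DZ / DY * S x + DY / DZ * T x) / 2"
      using S T DY_pos DZ_pos by (elim power2_le_imp_le) auto
  qed
  also have "\<dots> = (DZ / DY * (\<integral>x. S x \<partial>P) + DY / DZ * (\<integral>x. T x \<partial>P)) / 2"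
    using formY(1) formZ(1) by simp
  also have "\<dots> \<le> (DZ / DY * (DY\<^sup>2 / n) + DY / DZ * (DZ\<^sup>2 / n)) / 2"
    using formY(2) formZ(2) DY_pos DZ_pos by (intro divide_right_mono add_mono mult_left_mono) auto
  also have "\<dots> = D / n"
    using DY_pos DZ_pos n_pos by (simp add: D_def field_simps power2_eq_square)
  finally show ?thesis .
qed

definition coins :: "(nat \<Rightarrow> bool) pmf" where
  "coins = swap_coins (2 * h)"

lemma coins_eq: "coins = Pi_pmf {..<h} False (\<lambda>_. bernoulli_pmf (1 / 2))"
  by (simp add: coins_def swap_coins_def)

definition fixed_count :: "(nat \<Rightarrow> bool) \<Rightarrow> real" where
  "fixed_count c = (\<Sum>i<n. if c (bin_pair n m i) then 0 else 1)"

lemma fixed_count_mean: "measure_pmf.expectation coins fixed_count = n / 2"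
proof -
  have "measure_pmf.expectation coins fixed_count
      = (\<Sum>i<n. measure_pmf.expectation coins (\<lambda>c. if c (bin_pair n m i) then 0 else 1 :: real))"
    unfolding fixed_count_def[abs_def] coins_def
    by (intro Bochner_Integration.integral_sum integrable_measure_pmf_finite finite_set_swap_coins)
  also have "\<dots> = (\<Sum>i<n. 1 / 2)"
    unfolding coins_def by (intro sum.cong refl swap_coins_flip_prob) (simp add: bin_pair_less)
  finally show ?thesis
    by simp
qed

text \<open>In the second moment, an off-diagonal pair of indices contributes \<open>\<theta>\<^sup>2\<close> only if
  the permutation preserves it as a set: either both points are fixed, or they are partners of each
  other. There are at most \<open>(fixed_count c)\<^sup>2\<close> pairs of the first and \<open>n\<close>
  of the second kind, and the latter are absorbed into the noise by \<open>\<theta> \<le> D\<close>.\<close>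

lemma swapped_graph_norm_mean_le:
  "(\<integral>x. tensor_norm (graph_coef n (swap_bins n m c)) (grid (Y x) (Z x)) \<partial>P)
    \<le> \<theta> * fixed_count c / n + 2 * D / sqrt n"
proof -
  let ?s = "swap_bins n m c"
  define stay where "stay i = (if c (bin_pair n m i) then 0 else 1 :: real)" for i
  have n0: "0 < real n"
    using n_pos by simp
  have fc: "0 \<le> fixed_count c"
    by (simp add: fixed_count_def sum_nonneg)
  have entry: "(\<integral>x. gY (Y x i) (Y x k) * gZ (Z x (?s i)) (Z x (?s k)) \<partial>P)
      \<le> \<theta>sq * (stay i * stay k) + \<theta>sq * (if k = partner n i then 1 else 0) + (if k = i then D\<^sup>2 else 0)"
    if lt: "i < n" "k < n" for i k
  proof (cases "k = i")
    case True
    have "\<bar>\<integral>x. gY (Y x i) (Y x k) * gZ (Z x (?s i)) (Z x (?s k)) \<partial>P\<bar> \<le> D\<^sup>2"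
      using lt swap_bins_less Y_in Z_in by (intro P.abs_expectation_le abs_gY_gZ) auto
    moreover have "0 \<le> \<theta>sq * (stay i * stay k) + \<theta>sq * (if k = partner n i then 1 else 0)"
      using \<theta>sq_nonneg by (simp add: stay_def)
    ultimately show ?thesis
      using True by simp
  next
    case False
    have inj: "?s i \<noteq> ?s k"
      using False lt swap_bins_involution by metis
    have "(\<integral>x. gY (Y x i) (Y x k) * gZ (Z x (?s i)) (Z x (?s k)) \<partial>P) = (if {i, k} = {?s i, ?s k} then \<theta>sq else 0)"
      using False inj lt swap_bins_less by (intro mixed_moment) auto
    moreover have "stay i * stay k = 1 \<or> k = partner n i" if "{i, k} = {?s i, ?s k}"
    proof (rule disjCI)
      assume "k \<noteq> partner n i"
      then have "i \<noteq> partner n k"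
        using partner_partner[OF \<open>k < n\<close>] by auto
      then have "?s i \<noteq> partner n i" "?s k \<noteq> partner n k"
        using that \<open>k \<noteq> partner n i\<close> partner_neq[OF lt(1)] partner_neq[OF lt(2)]
        by (metis insertCI insertE singletonD)+
      then show "stay i * stay k = 1"
        by (auto simp: stay_def swap_bins_def split: if_splits)
    qed
    moreover have "0 \<le> stay i * stay k"
      by (simp add: stay_def)
    ultimately show ?thesis
      using \<theta>sq_nonneg False by (cases "{i, k} = {?s i, ?s k}") auto
  qed
  have "(\<integral>x. (tensor_norm (graph_coef n ?s) (grid (Y x) (Z x)))\<^sup>2 \<partial>P)
      = (\<integral>x. (\<Sum>i<n. \<Sum>k<n. gY (Y x i) (Y x k) * gZ (Z x (?s i)) (Z x (?s k))) / (real n)\<^sup>2 \<partial>P)"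
    by (intro Bochner_Integration.integral_cong refl kernel_norm_graph_coef_sq[OF pdY pdZ] Y_in Z_in swap_bins_less)
  also have "\<dots> = (\<Sum>i<n. \<Sum>k<n. (\<integral>x. gY (Y x i) (Y x k) * gZ (Z x (?s i)) (Z x (?s k)) \<partial>P)) / (real n)\<^sup>2"
    unfolding integral_divide_zero
    by (subst integral_double_sum) (auto intro!: gY_gZ_integrable swap_bins_less)
  also have "\<dots> \<le> (\<Sum>i<n. \<Sum>k<n. \<theta>sq * (stay i * stay k) + \<theta>sq * (if k = partner n i then 1 else 0) + (if k = i then D\<^sup>2 else 0)) / (real n)\<^sup>2"
    using entry by (intro divide_right_mono sum_mono) auto
  also have "\<dots> = (\<theta>sq * (fixed_count c)\<^sup>2 + n * \<theta>sq + n * D\<^sup>2) / (real n)\<^sup>2"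
  proof -
    have "(\<Sum>i<n. \<Sum>k<n. \<theta>sq * (stay i * stay k)) = \<theta>sq * (fixed_count c)\<^sup>2"
      unfolding fixed_count_def stay_def[symmetric] power2_eq_square sum_product
      by (simp only: sum_distrib_left)
    moreover have "(\<Sum>i<n. \<Sum>k<n. \<theta>sq * (if k = partner n i then 1 else 0)) = n * \<theta>sq"
      using partner_less by (simp add: sum_distrib_left[symmetric])
    moreover have "(\<Sum>i<n. \<Sum>k<n. if k = i then D\<^sup>2 else 0) = n * D\<^sup>2"
      by simp
    ultimately show ?thesis
      by (simp only: sum.distrib)
  qed
  also have "\<dots> = (\<theta> * fixed_count c / n)\<^sup>2 + (\<theta> / sqrt n)\<^sup>2 + (D / sqrt n)\<^sup>2"
    using n0 by (simp add: \<theta>_sq[symmetric] power_divide power_mult_distrib add_divide_distrib) (simp add: power2_eq_square)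
  also have "\<dots> \<le> (\<theta> * fixed_count c / n + \<theta> / sqrt n + D / sqrt n)\<^sup>2"
  proof -
    have "a\<^sup>2 + b\<^sup>2 + d\<^sup>2 \<le> (a + b + d)\<^sup>2" if "0 \<le> a" "0 \<le> b" "0 \<le> d" for a b d :: real
      using that by (simp add: power2_eq_square algebra_simps)
    from this[of "\<theta> * fixed_count c / n" "\<theta> / sqrt n" "D / sqrt n"] show ?thesis
      using \<theta>_nonneg D_pos fc by simp
  qed
  finally have "sqrt (\<integral>x. (tensor_norm (graph_coef n ?s) (grid (Y x) (Z x)))\<^sup>2 \<partial>P)
      \<le> \<theta> * fixed_count c / n + \<theta> / sqrt n + D / sqrt n"
    using \<theta>_nonneg D_pos fc by (intro real_le_lsqrt) auto
  moreover have "(\<integral>x. tensor_norm (graph_coef n ?s) (grid (Y x) (Z x)) \<partial>P)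
      \<le> sqrt (\<integral>x. (tensor_norm (graph_coef n ?s) (grid (Y x) (Z x)))\<^sup>2 \<partial>P)"
    by (intro P.expectation_le_sqrt_second_moment tensor_norm_integrable tensor_norm_sq_integrable)
  moreover have "\<theta> / sqrt n \<le> D / sqrt n"
    using \<theta>_le by (intro divide_right_mono) auto
  ultimately show ?thesis
    by simp
qed

text \<open>Of the four products in the integrand, only the one with the original indices has a mean, unless the two
  points coincide or are partners. In these exceptional cases the integrand is at most
  \<open>D\<^sup>2\<close>.\<close>

lemma flip_norm_second_moment_le:
  assumes "b < h"
  shows "(\<integral>x. (flip_norm b (Y x) (Z x))\<^sup>2 \<partial>P) \<le> (4 * m\<^sup>2 * \<theta>sq + 4 * m * D\<^sup>2) / (real n)\<^sup>2"
proof -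
  let ?S = "{i\<in>{..<n}. bin_pair n m i = b}" and ?t = "partner n"
  define F where "F i k x = gY (Y x i) (Y x k) * (gZ (Z x i) (Z x k) - gZ (Z x i) (Z x (?t k))
      - gZ (Z x (?t i)) (Z x k) + gZ (Z x (?t i)) (Z x (?t k)))" for i k x
  have F_expand: "F i k = (\<lambda>x. gY (Y x i) (Y x k) * gZ (Z x i) (Z x k) - gY (Y x i) (Y x k) * gZ (Z x i) (Z x (?t k))
      - gY (Y x i) (Y x k) * gZ (Z x (?t i)) (Z x k) + gY (Y x i) (Y x k) * gZ (Z x (?t i)) (Z x (?t k)))" for i k
    by (simp add: F_def fun_eq_iff algebra_simps)
  have F_int: "integrable P (F i k)" if "i < n" "k < n" for i k
    unfolding F_expand using that partner_less
    by (intro Bochner_Integration.integrable_add Bochner_Integration.integrable_diff gY_gZ_integrable) auto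
  have entry: "(\<integral>x. F i k x \<partial>P) \<le> \<theta>sq + ((if k = i then D\<^sup>2 else 0) + (if k = ?t i then D\<^sup>2 else 0))"
    if lt: "i < n" "k < n" for i k
  proof (cases "k = i \<or> k = ?t i")
    case True
    have "(\<integral>x. F i k x \<partial>P) \<le> D\<^sup>2"
    proof -
      have "\<bar>F i k x\<bar> \<le> D\<^sup>2" if x: "x \<in> space P" for x
      proof -
        have in_t: "Z x i \<in> space MZ" "Z x (?t i) \<in> space MZ"
          using Z_in[OF x] lt partner_less by auto
        define d where "d = gZ (Z x i) (Z x i) + gZ (Z x (?t i)) (Z x (?t i)) - 2 * gZ (Z x i) (Z x (?t i))"
        have d: "0 \<le> d" "d \<le> DZ\<^sup>2"
          using diamZ[OF in_t] pos_def_kernel_two[OF pdZ in_t, of 1 "-1"] by (auto simp: d_def)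
        have s: "gZ (Z x (?t i)) (Z x i) = gZ (Z x i) (Z x (?t i))"
          by (rule pos_def_kernel_sym[OF pdZ in_t(2,1)])
        have "F i k x = gY (Y x i) (Y x k) * d \<or> F i k x = gY (Y x i) (Y x k) * (- d)"
          using True s partner_partner[OF \<open>i < n\<close>] by (auto simp: F_def d_def)
        then have "\<bar>F i k x\<bar> = \<bar>gY (Y x i) (Y x k)\<bar> * d"
          using d(1) by (auto simp: abs_mult)
        also have "\<dots> \<le> DY\<^sup>2 * DZ\<^sup>2"
          using Y_in[OF x] lt d by (intro mult_mono abs_gY) auto
        finally show ?thesis
          by (simp add: D_def power_mult_distrib)
      qed
      then show ?thesis
        using P.abs_expectation_le[of "F i k" "D\<^sup>2"] by (simp add: abs_le_iff)
    qed
    then show ?thesis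
      using True \<theta>sq_nonneg partner_neq[OF \<open>i < n\<close>] by auto
  next
    case False
    have ne: "i \<noteq> k" "i \<noteq> ?t k" "?t i \<noteq> k" "?t i \<noteq> ?t k" "?t i < n" "?t k < n" "?t i \<noteq> i" "?t k \<noteq> k"
      using False lt partner_partner partner_less partner_neq by metis+
    have "(\<integral>x. F i k x \<partial>P) = (if {i, k} = {i, k} then \<theta>sq else 0) - (if {i, k} = {i, ?t k} then \<theta>sq else 0)
        - (if {i, k} = {?t i, k} then \<theta>sq else 0) + (if {i, k} = {?t i, ?t k} then \<theta>sq else 0)"
    proof -
      have int: "integrable P (\<lambda>x. gY (Y x i) (Y x k) * gZ (Z x j) (Z x l))" if "j < n" "l < n" for j l
        using lt that by (rule gY_gZ_integrable)
      have "(\<integral>x. F i k x \<partial>P) = (\<integral>x. gY (Y x i) (Y x k) * gZ (Z x i) (Z x k) \<partial>P)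
          - (\<integral>x. gY (Y x i) (Y x k) * gZ (Z x i) (Z x (?t k)) \<partial>P)
          - (\<integral>x. gY (Y x i) (Y x k) * gZ (Z x (?t i)) (Z x k) \<partial>P)
          + (\<integral>x. gY (Y x i) (Y x k) * gZ (Z x (?t i)) (Z x (?t k)) \<partial>P)"
        unfolding F_expand using lt ne int
        by (simp only: Bochner_Integration.integral_add Bochner_Integration.integral_diff
            Bochner_Integration.integrable_diff)
      also have "\<dots> = (if {i, k} = {i, k} then \<theta>sq else 0) - (if {i, k} = {i, ?t k} then \<theta>sq else 0)
        - (if {i, k} = {?t i, k} then \<theta>sq else 0) + (if {i, k} = {?t i, ?t k} then \<theta>sq else 0)"
        using lt ne by (simp only: mixed_moment if_True refl not_False_eq_True)
      finally show ?thesis .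
    qed
    also have "\<dots> = \<theta>sq"
      using ne by (auto simp: doubleton_eq_iff)
    finally show ?thesis
      using False by simp
  qed
  have "(\<integral>x. (flip_norm b (Y x) (Z x))\<^sup>2 \<partial>P) = (\<integral>x. (\<Sum>i\<in>?S. \<Sum>k\<in>?S. F i k x) / (real n)\<^sup>2 \<partial>P)"
    unfolding F_def by (intro Bochner_Integration.integral_cong refl flip_norm_sq Y_in Z_in)
  also have "\<dots> = (\<Sum>i\<in>?S. \<Sum>k\<in>?S. (\<integral>x. F i k x \<partial>P)) / (real n)\<^sup>2"
    unfolding integral_divide_zero by (subst integral_double_sum) (auto intro: F_int)
  also have "\<dots> \<le> (\<Sum>i\<in>?S. \<Sum>k\<in>?S. \<theta>sq + ((if k = i then D\<^sup>2 else 0) + (if k = ?t i then D\<^sup>2 else 0))) / (real n)\<^sup>2"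
    using entry by (intro divide_right_mono sum_mono) auto
  also have "(\<Sum>i\<in>?S. \<Sum>k\<in>?S. \<theta>sq + ((if k = i then D\<^sup>2 else 0) + (if k = ?t i then D\<^sup>2 else 0)))
      = (\<Sum>i\<in>?S. card ?S * \<theta>sq + 2 * D\<^sup>2)"
    using partner_less bin_pair_partner by (intro sum.cong refl) (simp add: sum.distrib)
  also have "\<dots> = 4 * m\<^sup>2 * \<theta>sq + 4 * m * D\<^sup>2"
    using card_bin_pair[OF assms] by (simp add: power2_eq_square algebra_simps)
  finally show ?thesis .
qed

lemma flip_total_sq: "(flip_total y z)\<^sup>2 = (\<Sum>b<h. (flip_norm b y z)\<^sup>2)"
  by (simp add: flip_total_def L2_set_def sum_nonneg)

lemma flip_norm_sq_integrable: "integrable P (\<lambda>x. (flip_norm b (Y x) (Z x))\<^sup>2)"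
  unfolding flip_norm_def by (rule tensor_norm_sq_integrable)

lemma flip_norm_integrable: "integrable P (\<lambda>x. flip_norm b (Y x) (Z x))"
  unfolding flip_norm_def by (rule tensor_norm_integrable)

lemma flip_total_sq_integrable: "integrable P (\<lambda>x. (flip_total (Y x) (Z x))\<^sup>2)"
  unfolding flip_total_sq by (intro Bochner_Integration.integrable_sum flip_norm_sq_integrable)

lemma flip_total_integrable: "integrable P (\<lambda>x. flip_total (Y x) (Z x))"
proof (rule Bochner_Integration.integrable_bound)
  show "integrable P (\<lambda>x. \<Sum>b<h. \<bar>flip_norm b (Y x) (Z x)\<bar>)"
    by (intro Bochner_Integration.integrable_sum Bochner_Integration.integrable_abs flip_norm_integrable)
  show "(\<lambda>x. flip_total (Y x) (Z x)) \<in> borel_measurable P"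
    unfolding flip_total_def L2_set_def using borel_measurable_integrable[OF flip_norm_sq_integrable]
    by (intro measurable_compose[OF _ borel_measurable_sqrt] borel_measurable_sum) auto
  show "AE x in P. norm (flip_total (Y x) (Z x)) \<le> norm (\<Sum>b<h. \<bar>flip_norm b (Y x) (Z x)\<bar>)"
    unfolding flip_total_def using L2_set_le_sum_abs by (intro AE_I2) (auto simp: sum_nonneg)
qed

lemma flip_total_mean_le: "(\<integral>x. flip_total (Y x) (Z x) \<partial>P) \<le> \<theta> / sqrt h + sqrt 2 * D / sqrt n"
proof -
  have pos: "0 < real n" "0 < real h" "0 < real m"
    using n_pos h_pos m_pos by auto
  have "(\<integral>x. (flip_total (Y x) (Z x))\<^sup>2 \<partial>P) = (\<Sum>b<h. (\<integral>x. (flip_norm b (Y x) (Z x))\<^sup>2 \<partial>P))"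
    unfolding flip_total_sq by (intro Bochner_Integration.integral_sum flip_norm_sq_integrable)
  also have "\<dots> \<le> (\<Sum>b<h. (4 * m\<^sup>2 * \<theta>sq + 4 * m * D\<^sup>2) / (real n)\<^sup>2)"
    by (intro sum_mono flip_norm_second_moment_le) auto
  also have "\<dots> = (\<theta> / sqrt h)\<^sup>2 + (sqrt 2 * D / sqrt n)\<^sup>2"
    using pos by (simp add: n_eq \<theta>_sq[symmetric] power_divide power_mult_distrib field_simps power2_eq_square)
  also have "\<dots> \<le> (\<theta> / sqrt h + sqrt 2 * D / sqrt n)\<^sup>2"
  proof -
    have "a\<^sup>2 + b\<^sup>2 \<le> (a + b)\<^sup>2" if "0 \<le> a" "0 \<le> b" for a b :: real
      using that by (simp add: power2_eq_square algebra_simps)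
    then show ?thesis
      using \<theta>_nonneg D_pos by auto
  qed
  finally have "sqrt (\<integral>x. (flip_total (Y x) (Z x))\<^sup>2 \<partial>P) \<le> \<theta> / sqrt h + sqrt 2 * D / sqrt n"
    using \<theta>_nonneg D_pos by (intro real_le_lsqrt) auto
  then show ?thesis
    using P.expectation_le_sqrt_second_moment[OF flip_total_integrable flip_total_sq_integrable] by linarith
qed

section \<open>The gap between the original and the swapped statistic\<close>

definition swapped_mean :: "(nat \<Rightarrow> 'y \<times> 'z) \<Rightarrow> real" where
  "swapped_mean x = measure_pmf.expectation coins (\<lambda>c. cov_norm (swap_bins n m c) (Y x) (Z x))"

text \<open>Positivity of the gap says that the original norm exceeds the mean of the swapped norms by more than
  \<open>\<kappa>\<close> times their fluctuation scale.\<close>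

definition gap :: "real \<Rightarrow> (nat \<Rightarrow> 'y \<times> 'z) \<Rightarrow> real" where
  "gap \<kappa> x = cov_norm (\<lambda>i. i) (Y x) (Z x) - swapped_mean x - \<kappa> * flip_total (Y x) (Z x)"

lemma cov_norm_integrable: "integrable P (\<lambda>x. cov_norm \<sigma> (Y x) (Z x))"
  unfolding cov_norm_def by (rule tensor_norm_integrable)

lemma mean_norm_integrable: "integrable P (\<lambda>x. mean_norm (Y x) (Z x))"
  unfolding mean_norm_def by (rule tensor_norm_integrable)

lemma swapped_mean_sum:
  "swapped_mean x = (\<Sum>c\<in>set_pmf coins. pmf coins c * cov_norm (swap_bins n m c) (Y x) (Z x))"
  unfolding swapped_mean_def coins_def by (rule expectation_swap_coins)

lemma swapped_mean_integrable: "integrable P swapped_mean"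
  unfolding swapped_mean_sum[abs_def]
  by (intro Bochner_Integration.integrable_sum Bochner_Integration.integrable_mult_right cov_norm_integrable)

lemma gap_integrable: "integrable P (gap \<kappa>)"
  unfolding gap_def[abs_def]
  by (intro Bochner_Integration.integrable_diff Bochner_Integration.integrable_mult_right cov_norm_integrable
      swapped_mean_integrable flip_total_integrable)

lemma cov_norm_mean_ge: "\<theta> - D / n \<le> (\<integral>x. cov_norm (\<lambda>i. i) (Y x) (Z x) \<partial>P)"
proof -
  have "\<theta> - D / n \<le> (\<integral>x. tensor_norm (graph_coef n (\<lambda>i. i)) (grid (Y x) (Z x)) \<partial>P) - (\<integral>x. mean_norm (Y x) (Z x) \<partial>P)"
    using graph_norm_mean_ge mean_norm_mean_le by linarith
  also have "\<dots> = (\<integral>x. tensor_norm (graph_coef n (\<lambda>i. i)) (grid (Y x) (Z x)) - mean_norm (Y x) (Z x) \<partial>P)"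
    using tensor_norm_integrable mean_norm_integrable by simp
  also have "\<dots> \<le> (\<integral>x. cov_norm (\<lambda>i. i) (Y x) (Z x) \<partial>P)"
  proof (intro integral_mono Bochner_Integration.integrable_diff tensor_norm_integrable mean_norm_integrable cov_norm_integrable)
    fix x assume "x \<in> space P"
    then show "tensor_norm (graph_coef n (\<lambda>i. i)) (grid (Y x) (Z x)) - mean_norm (Y x) (Z x) \<le> cov_norm (\<lambda>i. i) (Y x) (Z x)"
      using cov_norm_graph_norm[of "Y x" "Z x" "\<lambda>i. i"] Y_in Z_in by force
  qed
  finally show ?thesis .
qed

lemma swapped_cov_norm_mean_le:
  "(\<integral>x. cov_norm (swap_bins n m c) (Y x) (Z x) \<partial>P) \<le> \<theta> * fixed_count c / n + 2 * D / sqrt n + D / n"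
proof -
  let ?s = "swap_bins n m c"
  have "(\<integral>x. cov_norm ?s (Y x) (Z x) \<partial>P) \<le> (\<integral>x. tensor_norm (graph_coef n ?s) (grid (Y x) (Z x)) + mean_norm (Y x) (Z x) \<partial>P)"
  proof (intro integral_mono Bochner_Integration.integrable_add tensor_norm_integrable mean_norm_integrable cov_norm_integrable)
    fix x assume "x \<in> space P"
    then show "cov_norm ?s (Y x) (Z x) \<le> tensor_norm (graph_coef n ?s) (grid (Y x) (Z x)) + mean_norm (Y x) (Z x)"
      using cov_norm_graph_norm[of "Y x" "Z x" ?s] Y_in Z_in by force
  qed
  also have "\<dots> = (\<integral>x. tensor_norm (graph_coef n ?s) (grid (Y x) (Z x)) \<partial>P) + (\<integral>x. mean_norm (Y x) (Z x) \<partial>P)"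
    using tensor_norm_integrable mean_norm_integrable by simp
  finally show ?thesis
    using swapped_graph_norm_mean_le[of c] mean_norm_mean_le by linarith
qed

text \<open>On average over the coins, half of the data points are fixed.\<close>

lemma swapped_mean_mean_le: "(\<integral>x. swapped_mean x \<partial>P) \<le> \<theta> / 2 + 2 * D / sqrt n + D / n"
proof -
  have "(\<integral>x. swapped_mean x \<partial>P)
      = (\<Sum>c\<in>set_pmf coins. pmf coins c * (\<integral>x. cov_norm (swap_bins n m c) (Y x) (Z x) \<partial>P))"
    unfolding swapped_mean_sum by (subst Bochner_Integration.integral_sum)
      (auto intro: Bochner_Integration.integrable_mult_right cov_norm_integrable)
  also have "\<dots> \<le> (\<Sum>c\<in>set_pmf coins. pmf coins c * (\<theta> * fixed_count c / n + (2 * D / sqrt n + D / n)))"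
    using swapped_cov_norm_mean_le by (intro sum_mono mult_left_mono) (auto simp: algebra_simps)
  also have "\<dots> = measure_pmf.expectation coins (\<lambda>c. \<theta> * fixed_count c / n + (2 * D / sqrt n + D / n))"
    unfolding coins_def by (rule expectation_swap_coins[symmetric])
  also have "\<dots> = \<theta> * measure_pmf.expectation coins fixed_count / n + (2 * D / sqrt n + D / n)"
  proof -
    have "integrable (measure_pmf coins) fixed_count"
      unfolding coins_def by (intro integrable_measure_pmf_finite finite_set_swap_coins)
    then show ?thesis
      by simp
  qed
  finally show ?thesis
    using n_pos by (simp add: fixed_count_mean)
qed

lemma gap_mean_ge:
  assumes "0 \<le> \<kappa>"
  shows "\<theta> * (1 / 2 - \<kappa> / sqrt h) - (2 * D / n + (2 + sqrt 2 * \<kappa>) * D / sqrt n) \<le> (\<integral>x. gap \<kappa> x \<partial>P)"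
proof -
  have "(\<integral>x. gap \<kappa> x \<partial>P) = (\<integral>x. cov_norm (\<lambda>i. i) (Y x) (Z x) \<partial>P) - (\<integral>x. swapped_mean x \<partial>P)
      - \<kappa> * (\<integral>x. flip_total (Y x) (Z x) \<partial>P)"
    unfolding gap_def using cov_norm_integrable swapped_mean_integrable flip_total_integrable by simp
  moreover have "\<kappa> * (\<integral>x. flip_total (Y x) (Z x) \<partial>P) \<le> \<kappa> * (\<theta> / sqrt h + sqrt 2 * D / sqrt n)"
    using assms flip_total_mean_le by (rule mult_left_mono[rotated])
  moreover have "\<theta> - D / n - (\<theta> / 2 + 2 * D / sqrt n + D / n) - \<kappa> * (\<theta> / sqrt h + sqrt 2 * D / sqrt n)
      = \<theta> * (1 / 2 - \<kappa> / sqrt h) - (2 * D / n + (2 + sqrt 2 * \<kappa>) * D / sqrt n)"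
    using n_pos h_pos by (simp add: field_simps)
  ultimately show ?thesis
    using cov_norm_mean_ge swapped_mean_mean_le by linarith
qed

lemma change_both_coordinates:
  assumes x: "x \<in> space P" and "r < n" and u: "u \<in> space J"
    and left: "\<And>y z v. (\<And>i. i < n \<Longrightarrow> y i \<in> space MY) \<Longrightarrow> (\<And>i. i < n \<Longrightarrow> z i \<in> space MZ) \<Longrightarrow>
      v \<in> space MY \<Longrightarrow> \<bar>F (y(r := v)) z - F y z\<bar> \<le> DY * DZ / n"
    and right: "\<And>y z v. (\<And>i. i < n \<Longrightarrow> y i \<in> space MY) \<Longrightarrow> (\<And>i. i < n \<Longrightarrow> z i \<in> space MZ) \<Longrightarrow>
      v \<in> space MZ \<Longrightarrow> \<bar>F y (z(r := v)) - F y z\<bar> \<le> DY * DZ / n"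
  shows "\<bar>F (Y (x(r := u))) (Z (x(r := u))) - F (Y x) (Z x)\<bar> \<le> 2 * D / n"
proof -
  have eq: "Y (x(r := u)) = (Y x)(r := fst u)" "Z (x(r := u)) = (Z x)(r := snd u)"
    by auto
  have v: "fst u \<in> space MY" "snd u \<in> space MZ"
    using u by (auto simp: space_J)
  have "\<bar>F ((Y x)(r := fst u)) ((Z x)(r := snd u)) - F (Y x) ((Z x)(r := snd u))\<bar> \<le> DY * DZ / n"
    using Y_in[OF x] Z_in[OF x] v by (intro left) auto
  moreover have "\<bar>F (Y x) ((Z x)(r := snd u)) - F (Y x) (Z x)\<bar> \<le> DY * DZ / n"
    using Y_in[OF x] Z_in[OF x] v by (intro right) auto
  ultimately show ?thesis
    unfolding eq D_def by linarith
qed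

lemma cov_norm_change:
  assumes "x \<in> space P" "r < n" "u \<in> space J"
    and "\<And>i. i < n \<Longrightarrow> \<sigma> i < n" "\<And>i. i < n \<Longrightarrow> \<sigma> (\<sigma> i) = i"
  shows "\<bar>cov_norm \<sigma> (Y (x(r := u))) (Z (x(r := u))) - cov_norm \<sigma> (Y x) (Z x)\<bar> \<le> 2 * D / n"
  using assms by (intro change_both_coordinates cov_norm_change_left cov_norm_change_right)

lemma flip_total_change:
  assumes "x \<in> space P" "r < n" "u \<in> space J"
  shows "\<bar>flip_total (Y (x(r := u))) (Z (x(r := u))) - flip_total (Y x) (Z x)\<bar> \<le> 2 * D / n"
  using assms by (intro change_both_coordinates flip_total_change_left flip_total_change_right)

lemma swapped_mean_change:
  assumes "x \<in> space P" "r < n" "u \<in> space J"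
  shows "\<bar>swapped_mean (x(r := u)) - swapped_mean x\<bar> \<le> 2 * D / n"
proof -
  have "\<bar>swapped_mean (x(r := u)) - swapped_mean x\<bar>
      = \<bar>measure_pmf.expectation coins (\<lambda>c. cov_norm (swap_bins n m c) (Y (x(r := u))) (Z (x(r := u)))
          - cov_norm (swap_bins n m c) (Y x) (Z x))\<bar>"
    unfolding swapped_mean_def coins_def
    by (subst Bochner_Integration.integral_diff) (auto intro!: integrable_measure_pmf_finite finite_set_swap_coins)
  also have "\<dots> \<le> 2 * D / n"
    by (intro measure_pmf.abs_expectation_le cov_norm_change assms swap_bins_less swap_bins_involution)
  finally show ?thesis .
qed

lemma gap_change:
  assumes "0 \<le> \<kappa>" "x \<in> space P" "r < n" "u \<in> space J"
  shows "\<bar>gap \<kappa> (x(r := u)) - gap \<kappa> x\<bar> \<le> 2 * D * (2 + \<kappa>) / n"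
proof -
  have "\<bar>\<kappa> * flip_total (Y (x(r := u))) (Z (x(r := u))) - \<kappa> * flip_total (Y x) (Z x)\<bar> \<le> \<kappa> * (2 * D / n)"
    unfolding right_diff_distrib[symmetric] abs_mult abs_of_nonneg[OF assms(1)]
    by (rule mult_left_mono[OF flip_total_change[OF assms(2-4)] assms(1)])
  moreover have "\<bar>cov_norm (\<lambda>i. i) (Y (x(r := u))) (Z (x(r := u))) - cov_norm (\<lambda>i. i) (Y x) (Z x)\<bar> \<le> 2 * D / n"
    using assms(2-4) by (intro cov_norm_change) auto
  moreover have "2 * D / n + 2 * D / n + \<kappa> * (2 * D / n) = 2 * D * (2 + \<kappa>) / n"
    by (simp add: add_divide_distrib algebra_simps)
  ultimately show ?thesis
    unfolding gap_def using swapped_mean_change[OF assms(2-4)] by linarith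
qed

lemma gap_nonpos_prob_le:
  fixes t :: real
  assumes "0 \<le> \<kappa>" "0 < t" "t \<le> (\<integral>x. gap \<kappa> x \<partial>P)"
  shows "measure P {x \<in> space P. gap \<kappa> x \<le> 0} \<le> exp (- (real n * t\<^sup>2) / (2 * D\<^sup>2 * (2 + \<kappa>)\<^sup>2))"
proof -
  define v where "v = n * (2 * D * (2 + \<kappa>) / n)\<^sup>2"
  have v: "0 < v"
    using n_pos D_pos assms by (simp add: v_def)
  have "measure P {x \<in> space P. gap \<kappa> x \<le> 0} \<le> measure P {x \<in> space P. (\<integral>x. - gap \<kappa> x \<partial>P) + t \<le> - gap \<kappa> x}"
    using assms borel_measurable_integrable[OF gap_integrable] by (intro P.finite_measure_mono) auto
  also have "\<dots> \<le> exp (- 2 * t\<^sup>2 / v)"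
  proof (rule mcdiarmid_inequality[where c = "\<lambda>_. 2 * D * (2 + \<kappa>) / n"])
    show "\<bar>- gap \<kappa> (x(i := u)) - - gap \<kappa> x\<bar> \<le> 2 * D * (2 + \<kappa>) / n"
      if "x \<in> space P" "i \<in> {..<n}" "u \<in> space J" for x i u
      using gap_change[OF assms(1) that(1) _ that(3), of i] that(2) by (simp add: abs_minus_commute)
  qed (use v assms borel_measurable_integrable[OF gap_integrable] in \<open>auto simp: v_def\<close>)
  also have "- 2 * t\<^sup>2 / v = - (real n * t\<^sup>2) / (2 * D\<^sup>2 * (2 + \<kappa>)\<^sup>2)"
  proof -
    have v': "v = 4 * (D\<^sup>2 * (2 + \<kappa>)\<^sup>2) / n"
      using n_pos by (simp add: v_def power_divide power_mult_distrib) (simp add: power2_eq_square)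
    show ?thesis
      unfolding v' by simp
  qed
  finally show ?thesis .
qed

text \<open>With \<open>t\<close> the distance of the original norm from the mean of the swapped ones, a positive gap
  bounds the sum of the squared bounded differences by \<open>t\<^sup>2 / \<kappa>\<^sup>2\<close>, so
  that \<open>t\<close> cancels in McDiarmid's exponent.\<close>

lemma swapped_exceeds_prob_le:
  assumes x: "x \<in> space P" and "0 < \<kappa>" "0 < gap \<kappa> x"
  shows "measure_pmf.prob coins {c. cov_norm (\<lambda>i. i) (Y x) (Z x) \<le> cov_norm (swap_bins n m c) (Y x) (Z x)}
    \<le> exp (- 2 * \<kappa>\<^sup>2)"
proof -
  define t where "t = cov_norm (\<lambda>i. i) (Y x) (Z x) - swapped_mean x"
  have ft: "0 \<le> flip_total (Y x) (Z x)"
    by (simp add: flip_total_def)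
  have t: "\<kappa> * flip_total (Y x) (Z x) < t"
    using assms by (simp add: gap_def t_def)
  then have t0: "0 < t"
    using assms(2) ft by (smt (verit) mult_nonneg_nonneg)
  have "(\<kappa> * flip_total (Y x) (Z x))\<^sup>2 \<le> t\<^sup>2"
    using t ft assms(2) by (intro power_mono) auto
  then have "(\<Sum>b<h. (flip_norm b (Y x) (Z x))\<^sup>2) \<le> t\<^sup>2 / \<kappa>\<^sup>2"
    using assms(2) by (simp add: flip_total_sq[symmetric] power_mult_distrib field_simps)
  then have "measure_pmf.prob coins {c. swapped_mean x + t \<le> cov_norm (swap_bins n m c) (Y x) (Z x)}
      \<le> exp (- 2 * t\<^sup>2 / (t\<^sup>2 / \<kappa>\<^sup>2))"
    unfolding swapped_mean_def coins_eq using t0 assms(2) Y_in[OF x] Z_in[OF x]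
    by (intro mcdiarmid_inequality_coins[where w = "\<lambda>b. flip_norm b (Y x) (Z x)"] cov_norm_flip) auto
  then show ?thesis
    using t0 by (simp add: t_def)
qed

end

section \<open>The rank test\<close>

lemma reject_prob_nonneg: "0 \<le> reject_prob \<alpha> B R"
  by (simp add: reject_prob_def)

lemma reject_prob_le_1: "reject_prob \<alpha> B R \<le> 1"
  by (simp add: reject_prob_def)

text \<open>With fewer than \<open>k\<close> replicates reaching the original statistic, its rank is at least
  \<open>B + 2 - k\<close>, however ties are broken.\<close>

lemma reject_prob_few_exceedances:
  assumes "card {b\<in>{1..B}. T 0 \<le> T b} < k" and "real k \<le> \<alpha> * (real B + 1)"
  shows "reject_prob \<alpha> B (rank B T t) = 1"
proof -
  let ?E = "{b\<in>{1..B}. T 0 \<le> T b}"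
  have "card ({1..B} - ?E) \<le> card {b\<in>{1..B}. T b < T 0 \<or> (T b = T 0 \<and> t b < t 0)}"
    by (intro card_mono) auto
  moreover have "card ({1..B} - ?E) = B - card ?E"
    by (subst card_Diff_subset) auto
  ultimately have "B + 2 \<le> rank B T t + k"
    using assms(1) by (simp add: rank_def)
  then have "real (B + 2) \<le> real (rank B T t + k)"
    by (rule of_nat_mono)
  then have "1 \<le> real (rank B T t) - (1 - \<alpha>) * (real B + 1)"
    using assms(2) by (simp add: algebra_simps)
  then show ?thesis
    by (simp add: reject_prob_def)
qed

text \<open>Union bound over the subsets of size \<open>k\<close>.\<close>

lemma Pi_pmf_card_ge_prob_le:
  assumes "finite I" and "measure_pmf.prob W A \<le> a"
  shows "measure_pmf.prob (Pi_pmf I d (\<lambda>_. W)) {p. k \<le> card {b\<in>I. p b \<in> A}} \<le> real (card I choose k) * a ^ k"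
proof -
  let ?P = "Pi_pmf I d (\<lambda>_. W)" and ?S = "{S. S \<subseteq> I \<and> card S = k}"
  have fin: "finite ?S"
    using assms(1) by simp
  have "{p. k \<le> card {b\<in>I. p b \<in> A}} \<subseteq> (\<Union>S\<in>?S. {p. \<forall>b\<in>S. p b \<in> A})"
  proof
    fix p assume "p \<in> {p. k \<le> card {b\<in>I. p b \<in> A}}"
    then obtain S where "S \<subseteq> {b\<in>I. p b \<in> A}" "card S = k"
      using obtain_subset_with_card_n by blast
    then show "p \<in> (\<Union>S\<in>?S. {p. \<forall>b\<in>S. p b \<in> A})"
      by auto
  qed
  then have "measure_pmf.prob ?P {p. k \<le> card {b\<in>I. p b \<in> A}} \<le> measure_pmf.prob ?P (\<Union>S\<in>?S. {p. \<forall>b\<in>S. p b \<in> A})"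
    by (intro measure_pmf.finite_measure_mono) auto
  also have "\<dots> \<le> (\<Sum>S\<in>?S. measure_pmf.prob ?P {p. \<forall>b\<in>S. p b \<in> A})"
    by (intro measure_pmf.finite_measure_subadditive_finite fin) auto
  also have "\<dots> \<le> (\<Sum>S\<in>?S. a ^ k)"
  proof (intro sum_mono)
    fix S assume S: "S \<in> ?S"
    have "{p. \<forall>b\<in>S. p b \<in> A} = Pi I (\<lambda>b. if b \<in> S then A else UNIV)"
      using S by (auto simp: Pi_def)
    then have "measure_pmf.prob ?P {p. \<forall>b\<in>S. p b \<in> A}
        = (\<Prod>b\<in>I. measure_pmf.prob W (if b \<in> S then A else UNIV))"
      using measure_Pi_pmf_Pi[OF assms(1)] by simp
    also have "\<dots> = (\<Prod>b\<in>S. measure_pmf.prob W A)"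
      using S assms(1) by (intro prod.mono_neutral_cong_right) auto
    also have "\<dots> = measure_pmf.prob W A ^ k"
      using S by simp
    also have "\<dots> \<le> a ^ k"
      using assms(2) by (intro power_mono) auto
    finally show "measure_pmf.prob ?P {p. \<forall>b\<in>S. p b \<in> A} \<le> a ^ k" .
  qed
  also have "\<dots> = real (card I choose k) * a ^ k"
    using n_subsets[OF assms(1)] by simp
  finally show ?thesis .
qed

text \<open>This follows from \<open>(n choose k) * k! \<le> n\<^sup>k\<close> and \<open>k\<^sup>k / k! \<le> exp
  k\<close>, which is one term of the exponential series.\<close>

lemma binomial_le_exp_power:
  assumes "0 < k"
  shows "real (n choose k) \<le> (exp 1 * real n / real k) ^ k"
proof -
  have "(real k ^ k) / fact k \<le> exp (real k)"
  proof -
    have "(\<Sum>i\<in>{k}. inverse (fact i) * real k ^ i) \<le> (\<Sum>i. inverse (fact i) * real k ^ i)"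
      by (intro sum_le_suminf summable_exp) auto
    then show ?thesis
      by (simp add: exp_def divide_inverse mult.commute)
  qed
  then have "real k ^ k \<le> exp 1 ^ k * fact k"
    by (simp add: exp_of_nat_mult[symmetric] divide_le_eq mult.commute)
  moreover have "real ((n choose k) * fact k) \<le> real (n ^ k)"
    by (intro of_nat_mono binomial_fact_pow)
  ultimately have "real (n choose k) * fact k * real k ^ k \<le> real n ^ k * (exp 1 ^ k * fact k)"
    by (intro mult_mono) (auto simp: of_nat_fact)
  then have "real (n choose k) * real k ^ k \<le> real n ^ k * exp 1 ^ k"
    by (simp add: mult_ac)
  then show ?thesis
    using assms by (simp add: power_divide power_mult_distrib pos_le_divide_eq mult_ac)
qed

text \<open>The factor \<open>\<alpha> / (2 e)\<close> in \<open>\<alpha>\<^sup>\<star>\<close> compensates \<open>(B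
  choose k) \<le> (e B / k)\<^sup>k\<close>, because \<open>\<alpha> B \<le> 2 k\<close> for the integer
  part \<open>k \<ge> 1\<close> of \<open>\<alpha> (B + 1)\<close>.\<close>

lemma alpha_star_binomial:
  assumes "0 < \<alpha>" "0 < \<beta>" and k: "k = nat \<lfloor>\<alpha> * (real B + 1)\<rfloor>" "0 < k"
  shows "real (B choose k) * alpha_star \<alpha> \<beta> B ^ k \<le> \<beta> / 3"
proof -
  have fl: "real_of_int \<lfloor>\<alpha> * (real B + 1)\<rfloor> = real k"
    using k by simp
  have "\<alpha> * (real B + 1) < real k + 1"
    using fl by linarith
  moreover have "\<alpha> * (real B + 1) = \<alpha> * real B + \<alpha>"
    by (simp add: algebra_simps)
  moreover have "1 \<le> real k"
    using k(2) by simp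
  ultimately have "\<alpha> * real B \<le> 2 * real k"
    using assms(1) by linarith
  have "((\<beta> / 3) powr (1 / real k)) ^ k = \<beta> / 3"
    using assms(2) k(2) by (simp add: powr_realpow[symmetric] powr_powr)
  then have a: "alpha_star \<alpha> \<beta> B ^ k = (\<alpha> / (2 * exp 1)) ^ k * (\<beta> / 3)"
    unfolding alpha_star_def fl power_mult_distrib by (simp only:)
  have "real (B choose k) * alpha_star \<alpha> \<beta> B ^ k \<le> (exp 1 * real B / real k) ^ k * ((\<alpha> / (2 * exp 1)) ^ k * (\<beta> / 3))"
    unfolding a using assms by (intro mult_right_mono binomial_le_exp_power) auto
  also have "\<dots> = (\<alpha> * real B / (2 * real k)) ^ k * (\<beta> / 3)"
  proof -
    have "exp 1 * real B / real k * (\<alpha> / (2 * exp 1)) = \<alpha> * real B / (2 * real k)"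
      by (simp add: mult.commute)
    then show ?thesis
      by (simp only: mult.assoc[symmetric] power_mult_distrib[symmetric])
  qed
  also have "\<dots> \<le> 1 * (\<beta> / 3)"
    using assms \<open>\<alpha> * real B \<le> 2 * real k\<close>
    by (intro mult_right_mono power_le_one) (auto simp: divide_le_eq)
  finally show ?thesis
    by simp
qed

lemma finite_set_wild_bootstrap: "finite (set_pmf (wild_bootstrap q))"
  unfolding wild_bootstrap_def by (simp add: finite_set_swap_coins)

definition test_randomness :: "nat \<Rightarrow> nat \<Rightarrow> ((nat \<Rightarrow> nat \<Rightarrow> nat) \<times> (nat \<Rightarrow> nat)) pmf" where
  "test_randomness s B
    = pair_pmf (Pi_pmf {1..B} id (\<lambda>_. wild_bootstrap s)) (pmf_of_set {t. t permutes {0..B}})"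

lemma set_tie_breaking: "set_pmf (pmf_of_set {t. t permutes {0..B}}) = {t. t permutes {0..B}}" for B :: nat
  by (rule set_pmf_of_set) (auto simp: finite_permutations intro!: exI[of _ id] permutes_id)

lemma finite_set_test_randomness: "finite (set_pmf (test_randomness s B))"
  unfolding test_randomness_def set_pair_pmf set_tie_breaking
  by (intro finite_cartesian_product finite_subset[OF set_Pi_pmf_subset'] finite_PiE_dflt)
    (auto simp: finite_set_wild_bootstrap finite_permutations)

context paired_sample
begin

lemma V_stat_measurable:
  assumes "\<And>i. i < n \<Longrightarrow> \<sigma> i < n"
  shows "(\<lambda>x. V_stat gY gZ n (Y x) (\<lambda>i. Z x (\<sigma> i))) \<in> borel_measurable P"
  unfolding V_stat_def h_in_def using assms
  by (auto intro!: borel_measurable_divide borel_measurable_sum borel_measurable_times borel_measurable_diff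
      borel_measurable_add gY_P gZ_P)

definition reject :: "real \<Rightarrow> nat \<Rightarrow> (nat \<Rightarrow> 'y \<times> 'z) \<Rightarrow> (nat \<Rightarrow> nat \<Rightarrow> nat) \<Rightarrow> (nat \<Rightarrow> nat) \<Rightarrow> real" where
  "reject \<alpha> B x p t = reject_prob \<alpha> B (rank B (test_stat gY gZ n (2 * h) x p) t)"

definition conditional_power :: "real \<Rightarrow> nat \<Rightarrow> (nat \<Rightarrow> 'y \<times> 'z) \<Rightarrow> real" where
  "conditional_power \<alpha> B x = measure_pmf.expectation (test_randomness (2 * h) B) (\<lambda>(p, t). reject \<alpha> B x p t)"

lemma cheap_test_power_eq: "cheap_test_power J gY gZ n (2 * h) B \<alpha> = (\<integral>x. conditional_power \<alpha> B x \<partial>P)"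
  by (simp add: cheap_test_power_def conditional_power_def test_randomness_def reject_def sample_def)

text \<open>Permutations in the support of the bootstrap map data indices to data indices, and only the values of the
  sample at such indices are measurable.\<close>

lemma test_stat_measurable:
  assumes "(p, t) \<in> set_pmf (test_randomness (2 * h) B)" "b \<le> B"
  shows "(\<lambda>x. test_stat gY gZ n (2 * h) x p b) \<in> borel_measurable P"
proof (cases "b = 0")
  case True
  then show ?thesis
    using V_stat_measurable[of "\<lambda>i. i"] by (simp add: test_stat_def)
next
  case False
  have "p b \<in> set_pmf (wild_bootstrap (2 * h))"
    using assms False by (auto simp: test_randomness_def set_Pi_pmf PiE_dflt_def)
  then obtain c where "p b = wild_perm (2 * h) c"
    by (auto simp: wild_bootstrap_def)
  then show ?thesis
    using False V_stat_measurable[of "swap_bins n m c"] swap_bins_less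
    by (simp add: test_stat_def V_stat_permute_bins)
qed

lemma reject_measurable:
  assumes "(p, t) \<in> set_pmf (test_randomness (2 * h) B)"
  shows "(\<lambda>x. reject \<alpha> B x p t) \<in> borel_measurable P"
proof -
  let ?T = "test_stat gY gZ n (2 * h)"
  have rank: "real (rank B T t) = 1 + (\<Sum>b\<in>{1..B}. if T b < T 0 \<or> (T b = T 0 \<and> t b < t 0) then 1 else 0)" for T
    by (simp add: rank_def sum.inter_filter[symmetric])
  have "(\<lambda>x. \<Sum>b\<in>{1..B}. if ?T x p b < ?T x p 0 \<or> (?T x p b = ?T x p 0 \<and> t b < t 0) then 1 else 0 :: real)
      \<in> borel_measurable P"
  proof (rule borel_measurable_sum)
    fix b assume "b \<in> {1..B}"
    then have [measurable]: "(\<lambda>x. ?T x p b) \<in> borel_measurable P" "(\<lambda>x. ?T x p 0) \<in> borel_measurable P"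
      by (auto intro: test_stat_measurable[OF assms])
    have [measurable]: "Measurable.pred P (\<lambda>x. ?T x p b = ?T x p 0)"
      unfolding pred_def by (intro borel_measurable_eq) fact+
    show "(\<lambda>x. if ?T x p b < ?T x p 0 \<or> (?T x p b = ?T x p 0 \<and> t b < t 0) then 1 else 0 :: real) \<in> borel_measurable P"
      by measurable
  qed
  then show ?thesis
    unfolding reject_def reject_prob_def rank by measurable
qed

lemma conditional_power_sum:
  "conditional_power \<alpha> B x = (\<Sum>q\<in>set_pmf (test_randomness (2 * h) B).
    pmf (test_randomness (2 * h) B) q * reject \<alpha> B x (fst q) (snd q))"
  unfolding conditional_power_def split_beta'
  by (subst integral_measure_pmf[OF finite_set_test_randomness]) auto

lemma conditional_power_measurable: "conditional_power \<alpha> B \<in> borel_measurable P"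
  unfolding conditional_power_sum[abs_def]
  by (intro borel_measurable_sum borel_measurable_times borel_measurable_const reject_measurable) simp

lemma reject_integrable: "integrable (measure_pmf (test_randomness (2 * h) B)) (\<lambda>q. reject \<alpha> B x (fst q) (snd q))"
  by (intro integrable_measure_pmf_finite finite_set_test_randomness)

lemma conditional_power_bounds: "0 \<le> conditional_power \<alpha> B x" "conditional_power \<alpha> B x \<le> 1"
proof -
  show "0 \<le> conditional_power \<alpha> B x"
    unfolding conditional_power_def split_beta' reject_def
    by (intro integral_nonneg_AE AE_I2 reject_prob_nonneg)
  have "conditional_power \<alpha> B x \<le> measure_pmf.expectation (test_randomness (2 * h) B) (\<lambda>_. 1)"
    unfolding conditional_power_def split_beta'
    by (intro integral_mono reject_integrable) (auto simp: reject_def reject_prob_le_1)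
  then show "conditional_power \<alpha> B x \<le> 1"
    by simp
qed

text \<open>Given the data, the replicates are independent, and each reaches the original statistic with probability
  at most \<open>exp (-2 * \<kappa>\<^sup>2)\<close>.\<close>

lemma conditional_power_ge:
  assumes x: "x \<in> space P" and gap: "0 < gap \<kappa> x" "0 < \<kappa>" and a: "exp (- 2 * \<kappa>\<^sup>2) \<le> alpha_star \<alpha> \<beta> B"
    and "0 < \<alpha>" "0 < \<beta>" "1 \<le> \<alpha> * (real B + 1)"
  shows "1 - \<beta> / 3 \<le> conditional_power \<alpha> B x"
proof -
  define k where "k = nat \<lfloor>\<alpha> * (real B + 1)\<rfloor>"
  have k: "0 < k" "real k \<le> \<alpha> * (real B + 1)"
    using assms(7) by (auto simp: k_def)
  define W where "W = wild_bootstrap (2 * h)"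
  define A where "A = {\<pi>. V_stat gY gZ n (Y x) (Z x) \<le> V_stat gY gZ n (Y x) (permute_bins n (2 * h) \<pi> (Z x))}"
  have "measure_pmf.prob W A
      = measure_pmf.prob coins {c. V_stat gY gZ n (Y x) (Z x) \<le> V_stat gY gZ n (Y x) (\<lambda>i. Z x (swap_bins n m c i))}"
    by (simp add: W_def A_def wild_bootstrap_def coins_def V_stat_permute_bins vimage_def)
  also have "{c. V_stat gY gZ n (Y x) (Z x) \<le> V_stat gY gZ n (Y x) (\<lambda>i. Z x (swap_bins n m c i))}
      = {c. cov_norm (\<lambda>i. i) (Y x) (Z x) \<le> cov_norm (swap_bins n m c) (Y x) (Z x)}"
  proof -
    have V: "V_stat gY gZ n (Y x) (\<lambda>i. Z x (\<sigma> i)) = (2 * cov_norm \<sigma> (Y x) (Z x))\<^sup>2" "0 \<le> cov_norm \<sigma> (Y x) (Z x)"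
      if "\<And>i. i < n \<Longrightarrow> \<sigma> i < n" "\<And>i. i < n \<Longrightarrow> \<sigma> (\<sigma> i) = i" for \<sigma>
      using V_stat_eq_cov_norm[of "Y x" "Z x" \<sigma>] cov_norm_nonneg[of "Y x" "Z x" \<sigma>] Y_in[OF x] Z_in[OF x] that by auto
    show ?thesis
      using V[of "\<lambda>i. i"] V[of "swap_bins n m _"] swap_bins_less swap_bins_involution
      by (simp add: abs_le_square_iff[symmetric])
  qed
  also have "measure_pmf.prob coins \<dots> \<le> alpha_star \<alpha> \<beta> B"
    using swapped_exceeds_prob_le[OF x gap(2,1)] a by simp
  finally have WA: "measure_pmf.prob W A \<le> alpha_star \<alpha> \<beta> B" .
  define G where "G = {p :: nat \<Rightarrow> nat \<Rightarrow> nat. card {b\<in>{1..B}. p b \<in> A} < k}"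
  have "measure_pmf.prob (Pi_pmf {1..B} id (\<lambda>_. W)) (- G) \<le> \<beta> / 3"
  proof -
    have "- G = {p. k \<le> card {b\<in>{1..B}. p b \<in> A}}"
      by (auto simp: G_def)
    then show ?thesis
      using Pi_pmf_card_ge_prob_le[OF _ WA, of "{1..B}" id k] alpha_star_binomial[OF assms(5,6) k_def k(1)] by simp
  qed
  then have "1 - \<beta> / 3 \<le> measure_pmf.prob (Pi_pmf {1..B} id (\<lambda>_. W)) G"
    using measure_pmf.prob_compl[of G "Pi_pmf {1..B} id (\<lambda>_. W)"] by (simp add: Compl_eq_Diff_UNIV)
  also have "\<dots> = measure_pmf.expectation (test_randomness (2 * h) B) (\<lambda>q. indicator G (fst q))"
    by (simp add: test_randomness_def W_def)
  also have "\<dots> \<le> measure_pmf.expectation (test_randomness (2 * h) B) (\<lambda>q. reject \<alpha> B x (fst q) (snd q))"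
  proof (intro integral_mono reject_integrable)
    show "integrable (measure_pmf (test_randomness (2 * h) B)) (\<lambda>q. indicator G (fst q) :: real)"
      by (intro integrable_measure_pmf_finite finite_set_test_randomness)
    fix q :: "(nat \<Rightarrow> nat \<Rightarrow> nat) \<times> (nat \<Rightarrow> nat)"
    show "indicator G (fst q) \<le> reject \<alpha> B x (fst q) (snd q)"
    proof (cases "fst q \<in> G")
      case True
      have "{b\<in>{1..B}. test_stat gY gZ n (2 * h) x (fst q) 0 \<le> test_stat gY gZ n (2 * h) x (fst q) b}
          = {b\<in>{1..B}. fst q b \<in> A}"
        by (auto simp: test_stat_def A_def)
      then have "reject \<alpha> B x (fst q) (snd q) = 1"
        unfolding reject_def using True k(2)
        by (intro reject_prob_few_exceedances[of _ _ k]) (auto simp: G_def)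
      then show ?thesis
        by (simp add: indicator_def)
    qed (simp add: reject_def reject_prob_nonneg)
  qed
  finally show ?thesis
    by (simp add: conditional_power_def split_beta')
qed

text \<open>A positive gap has probability at least \<open>1 - 2 \<beta> / 3\<close>, and given such data the test
  rejects with probability at least \<open>1 - \<beta> / 3\<close>.\<close>

lemma power_ge:
  assumes "0 < \<kappa>" "0 < t" and t: "t \<le> \<theta> * (1 / 2 - \<kappa> / sqrt h) - (2 * D / n + (2 + sqrt 2 * \<kappa>) * D / sqrt n)"
    and exceed: "exp (- (real n * t\<^sup>2) / (2 * D\<^sup>2 * (2 + \<kappa>)\<^sup>2)) \<le> 2 * \<beta> / 3"
    and "exp (- 2 * \<kappa>\<^sup>2) \<le> alpha_star \<alpha> \<beta> B"
    and "0 < \<alpha>" "0 < \<beta>" "\<beta> < 1" "1 \<le> \<alpha> * (real B + 1)"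
  shows "1 - \<beta> \<le> cheap_test_power J gY gZ n (2 * h) B \<alpha>"
proof -
  let ?G = "{x \<in> space P. 0 < gap \<kappa> x}"
  have G: "?G \<in> sets P"
    using borel_measurable_integrable[OF gap_integrable] by measurable
  have "t \<le> (\<integral>x. gap \<kappa> x \<partial>P)"
    using gap_mean_ge[of \<kappa>] assms(1) t by linarith
  then have "measure P {x \<in> space P. gap \<kappa> x \<le> 0} \<le> 2 * \<beta> / 3"
    using gap_nonpos_prob_le[of \<kappa> t] assms(1,2) exceed by linarith
  moreover have "{x \<in> space P. gap \<kappa> x \<le> 0} = space P - ?G"
    by auto
  ultimately have "1 - 2 * \<beta> / 3 \<le> measure P ?G"
    using P.prob_compl[OF G] by simp
  then have "(1 - 2 * \<beta> / 3) * (1 - \<beta> / 3) \<le> measure P ?G * (1 - \<beta> / 3)"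
    using assms(8) by (intro mult_right_mono) auto
  also have "\<dots> = (\<integral>x. indicator ?G x * (1 - \<beta> / 3) \<partial>P)"
    using G by (simp add: Int_absorb2 sets.sets_into_space)
  also have "\<dots> \<le> (\<integral>x. conditional_power \<alpha> B x \<partial>P)"
  proof (rule integral_mono)
    show "integrable P (\<lambda>x. indicator ?G x * (1 - \<beta> / 3))"
      using G by (intro P.integrable_bounded[where C = "\<bar>1 - \<beta> / 3\<bar>"]) (auto simp: indicator_def)
    show "integrable P (conditional_power \<alpha> B)"
      using conditional_power_bounds
      by (intro P.integrable_bounded[where C = 1] conditional_power_measurable) (simp add: abs_le_iff order_trans[of _ 0])
    fix x assume "x \<in> space P"
    then show "indicator ?G x * (1 - \<beta> / 3) \<le> conditional_power \<alpha> B x"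
      using conditional_power_ge[of x \<kappa> \<alpha> \<beta> B] conditional_power_bounds assms by (auto simp: indicator_def)
  qed
  finally have "(1 - 2 * \<beta> / 3) * (1 - \<beta> / 3) \<le> cheap_test_power J gY gZ n (2 * h) B \<alpha>"
    by (simp add: cheap_test_power_eq)
  moreover have "1 - \<beta> \<le> (1 - 2 * \<beta> / 3) * (1 - \<beta> / 3)"
    by (simp add: field_simps)
  ultimately show ?thesis
    by linarith
qed

end

section \<open>The maximum mean discrepancy in terms of centered kernels\<close>

text \<open>Expanding the product of the centered kernels, each cross term integrates by Fubini's theorem and
  symmetry either to the mean of the product of the two marginal integrals or to the product of their
  means.\<close>

lemma (in prob_space) integral_centered_product:
  fixes f g :: "'a \<Rightarrow> 'a \<Rightarrow> real"
  assumes f [measurable]: "(\<lambda>(u, v). f u v) \<in> borel_measurable (M \<Otimes>\<^sub>M M)"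
    and g [measurable]: "(\<lambda>(u, v). g u v) \<in> borel_measurable (M \<Otimes>\<^sub>M M)"
    and fC: "\<And>u v. u \<in> space M \<Longrightarrow> v \<in> space M \<Longrightarrow> \<bar>f u v\<bar> \<le> C"
    and gD: "\<And>u v. u \<in> space M \<Longrightarrow> v \<in> space M \<Longrightarrow> \<bar>g u v\<bar> \<le> D"
    and symf: "\<And>u v. u \<in> space M \<Longrightarrow> v \<in> space M \<Longrightarrow> f u v = f v u"
    and symg: "\<And>u v. u \<in> space M \<Longrightarrow> v \<in> space M \<Longrightarrow> g u v = g v u"
  shows "(\<integral>u. (\<integral>v. centered_kernel M f u v * centered_kernel M g u v \<partial>M) \<partial>M)
    = (\<integral>u. (\<integral>v. f u v * g u v \<partial>M) \<partial>M) - 2 * (\<integral>u. (\<integral>v. f u v \<partial>M) * (\<integral>v. g u v \<partial>M) \<partial>M)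
      + (\<integral>u. (\<integral>v. f u v \<partial>M) \<partial>M) * (\<integral>u. (\<integral>v. g u v \<partial>M) \<partial>M)"
proof -
  have inner_meas: "(\<lambda>u. \<integral>v. F u v \<partial>M) \<in> borel_measurable M"
    if "(\<lambda>(u, v). F u v) \<in> borel_measurable (M \<Otimes>\<^sub>M M)" for F :: "'a \<Rightarrow> 'a \<Rightarrow> real"
    using that by (rule borel_measurable_lebesgue_integral)
  interpret pair_sigma_finite M M
    by unfold_locales
  interpret MM: prob_space "M \<Otimes>\<^sub>M M"
    by (intro prob_space_pair prob_space_axioms)
  obtain w where w: "w \<in> space M"
    using not_empty by blast
  have C: "0 \<le> C" and D: "0 \<le> D"
    using fC[OF w w] gD[OF w w] by auto
  define a where "a u = (\<integral>v. f u v \<partial>M)" for u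
  define b where "b u = (\<integral>v. g u v \<partial>M)" for u
  define a0 where "a0 = (\<integral>u. a u \<partial>M)"
  define b0 where "b0 = (\<integral>u. b u \<partial>M)"
  define s where "s = (\<integral>u. a u * b u \<partial>M)"
  have [measurable]: "a \<in> borel_measurable M" "b \<in> borel_measurable M"
    unfolding a_def b_def using inner_meas[OF f] inner_meas[OF g] by auto
  have a: "\<bar>a u\<bar> \<le> C" and b: "\<bar>b u\<bar> \<le> D" if "u \<in> space M" for u
    unfolding a_def b_def using that by (auto intro!: abs_expectation_le fC gD)
  have fm [measurable]: "f u \<in> borel_measurable M" and gm [measurable]: "g u \<in> borel_measurable M" if "u \<in> space M" for u
    using that measurable_compose[OF measurable_Pair1' f] measurable_compose[OF measurable_Pair1' g] by simp_all
  have fb: "\<bar>f u v * b w\<bar> \<le> C * D" "\<bar>a w * g u v\<bar> \<le> C * D" "\<bar>f u v * g u v\<bar> \<le> C * D"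
    "\<bar>a u * b v\<bar> \<le> C * D"
    if "u \<in> space M" "v \<in> space M" "w \<in> space M" for u v w
    unfolding abs_mult using that C D by (auto intro!: mult_mono fC gD a b)
  have i_a: "integrable M a" and i_b: "integrable M b"
    using a b by (auto intro!: integrable_bounded)
  have i_ab: "integrable M (\<lambda>u. a u * b u)"
    using fb(4) by (intro integrable_bounded[where C = "C * D"]) auto
  have i_f: "integrable M (f u)" and i_g: "integrable M (g u)" if "u \<in> space M" for u
    using that fC gD by (auto intro!: integrable_bounded fm gm)
  have i_fg: "integrable M (\<lambda>v. f u v * g u v)" and i_fb: "integrable M (\<lambda>v. f u v * b v)"
    and i_ag: "integrable M (\<lambda>v. a v * g u v)" if "u \<in> space M" for u
    using that fb by (auto intro!: integrable_bounded[where C = "C * D"] borel_measurable_times)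
  define p where "p u = (\<integral>v. f u v * b v \<partial>M)" for u
  define q where "q u = (\<integral>v. a v * g u v \<partial>M)" for u
  define r where "r u = (\<integral>v. f u v * g u v \<partial>M)" for u
  have swap: "(\<integral>u. (\<integral>v. F u v * e v \<partial>M) \<partial>M) = (\<integral>v. (\<integral>u. F v u \<partial>M) * e v \<partial>M)"
    if [measurable]: "(\<lambda>(u, v). F u v) \<in> borel_measurable (M \<Otimes>\<^sub>M M)" "e \<in> borel_measurable M"
      and bound: "\<And>u v. u \<in> space M \<Longrightarrow> v \<in> space M \<Longrightarrow> \<bar>F u v * e v\<bar> \<le> C * D"
      and sym: "\<And>u v. u \<in> space M \<Longrightarrow> v \<in> space M \<Longrightarrow> F u v = F v u"
    for F :: "'a \<Rightarrow> 'a \<Rightarrow> real" and e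
  proof -
    have "(\<integral>u. (\<integral>v. F u v * e v \<partial>M) \<partial>M) = (\<integral>v. (\<integral>u. F u v * e v \<partial>M) \<partial>M)"
      using bound by (intro Fubini_integral[symmetric] MM.integrable_bounded[where C = "C * D"])
        (auto simp: space_pair_measure)
    also have "\<dots> = (\<integral>v. (\<integral>u. F v u * e v \<partial>M) \<partial>M)"
      using sym by (intro Bochner_Integration.integral_cong refl) simp
    finally show ?thesis
      by simp
  qed
  have p_swap: "(\<integral>u. p u \<partial>M) = s"
    unfolding p_def s_def a_def by (rule swap[OF f _ fb(1) symf]) auto
  have q_swap: "(\<integral>u. q u \<partial>M) = s"
    using swap[OF g _ _ symg, of a] fb(2) by (simp add: q_def s_def b_def mult.commute)
  have [measurable]: "p \<in> borel_measurable M" "q \<in> borel_measurable M" "r \<in> borel_measurable M"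
    unfolding p_def q_def r_def by (auto intro!: inner_meas)
  have i_pqr: "integrable M p" "integrable M q" "integrable M r"
    unfolding atomize_conj
    using fb by (intro conjI integrable_bounded[where C = "C * D"])
      (auto simp: p_def q_def r_def intro!: abs_expectation_le)
  have inner: "(\<integral>v. centered_kernel M f u v * centered_kernel M g u v \<partial>M)
      = r u - p u - q u + s - (a0 - a u) * (b0 - b u)" if u: "u \<in> space M" for u
  proof -
    define A where "A = a0 - a u"
    define B where "B = b0 - b u"
    have "(\<integral>v. centered_kernel M f u v * centered_kernel M g u v \<partial>M)
        = (\<integral>v. f u v * g u v - f u v * b v - a v * g u v + a v * b v + B * f u v - B * a v + A * g u v - A * b v + A * B \<partial>M)"
      by (intro Bochner_Integration.integral_cong refl)
        (simp add: centered_kernel_def a_def[symmetric] b_def[symmetric] a0_def[symmetric] b0_def[symmetric]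
          A_def B_def algebra_simps)
    also have "\<dots> = r u - p u - q u + s + B * a u - B * a0 + A * b u - A * b0 + A * B"
      using i_fg[OF u] i_fb[OF u] i_ag[OF u] i_ab i_f[OF u] i_g[OF u] i_a i_b
      by (simp add: r_def p_def q_def s_def a0_def b0_def prob_space a_def[of u] b_def[of u])
    finally show ?thesis
      by (simp add: A_def B_def algebra_simps)
  qed
  have "(\<integral>u. (\<integral>v. centered_kernel M f u v * centered_kernel M g u v \<partial>M) \<partial>M)
      = (\<integral>u. r u - p u - q u + s - (a0 * b0 - a0 * b u - b0 * a u + a u * b u) \<partial>M)"
    by (intro Bochner_Integration.integral_cong refl) (simp add: inner algebra_simps)
  also have "\<dots> = (\<integral>u. r u \<partial>M) - s - s + s - (a0 * b0 - a0 * b0 - b0 * a0 + s)"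
    using i_pqr i_a i_b i_ab p_swap q_swap by (simp add: prob_space a0_def b0_def s_def)
  finally show ?thesis
    by (simp add: r_def a_def b_def a0_def b0_def s_def algebra_simps)
qed

lemma integral_pair_measure_product:
  fixes f :: "'a \<Rightarrow> real" and g :: "'b \<Rightarrow> real"
  assumes "prob_space M" "prob_space N" and [measurable]: "f \<in> borel_measurable M" "g \<in> borel_measurable N"
    and f: "\<And>u. u \<in> space M \<Longrightarrow> \<bar>f u\<bar> \<le> C" and g: "\<And>v. v \<in> space N \<Longrightarrow> \<bar>g v\<bar> \<le> D"
  shows "(\<integral>w. f (fst w) * g (snd w) \<partial>(M \<Otimes>\<^sub>M N)) = (\<integral>u. f u \<partial>M) * (\<integral>v. g v \<partial>N)"
proof -
  interpret M: prob_space M by fact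
  interpret N: prob_space N by fact
  interpret pair_sigma_finite M N
    by unfold_locales
  interpret MN: prob_space "M \<Otimes>\<^sub>M N"
    by (intro prob_space_pair assms)
  have "integrable (M \<Otimes>\<^sub>M N) (\<lambda>w. f (fst w) * g (snd w))"
  proof (rule MN.integrable_bounded)
    fix w assume "w \<in> space (M \<Otimes>\<^sub>M N)"
    then have "\<bar>f (fst w)\<bar> \<le> \<bar>C\<bar>" "\<bar>g (snd w)\<bar> \<le> \<bar>D\<bar>"
      using f[of "fst w"] g[of "snd w"] by (auto simp: space_pair_measure)
    then show "\<bar>f (fst w) * g (snd w)\<bar> \<le> \<bar>C\<bar> * \<bar>D\<bar>"
      unfolding abs_mult by (intro mult_mono) auto
  qed measurable
  from integral_fst'[OF this] show ?thesis
    by simp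
qed

text \<open>For the product of the marginals, the inner integral of the product kernel factorizes. Hence both mixed
  terms of the squared MMD are the mean of the product of the marginal integrals, and the last term is
  the product of their means.\<close>

lemma MMD_product_eq:
  fixes J :: "('y \<times> 'z) measure" and gY :: "'y \<Rightarrow> 'y \<Rightarrow> real" and gZ :: "'z \<Rightarrow> 'z \<Rightarrow> real"
  defines "PY \<equiv> \<lambda>MY. distr J MY fst" and "PZ \<equiv> \<lambda>MZ. distr J MZ snd"
  assumes J: "prob_space J" and sets_J: "sets J = sets (MY \<Otimes>\<^sub>M MZ)"
    and gY: "(\<lambda>(u, v). gY u v) \<in> borel_measurable (MY \<Otimes>\<^sub>M MY)"
    and gZ: "(\<lambda>(u, v). gZ u v) \<in> borel_measurable (MZ \<Otimes>\<^sub>M MZ)"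
    and bY: "\<And>u v. u \<in> space MY \<Longrightarrow> v \<in> space MY \<Longrightarrow> \<bar>gY u v\<bar> \<le> C"
    and bZ: "\<And>u v. u \<in> space MZ \<Longrightarrow> v \<in> space MZ \<Longrightarrow> \<bar>gZ u v\<bar> \<le> D"
    and symY: "\<And>u v. u \<in> space MY \<Longrightarrow> v \<in> space MY \<Longrightarrow> gY u v = gY v u"
    and symZ: "\<And>u v. u \<in> space MZ \<Longrightarrow> v \<in> space MZ \<Longrightarrow> gZ u v = gZ v u"
  shows "MMD (product_kernel gY gZ) J (PY MY \<Otimes>\<^sub>M PZ MZ)
    = sqrt (\<integral>u. (\<integral>v. product_kernel (centered_kernel (PY MY) gY) (centered_kernel (PZ MZ) gZ) u v \<partial>J) \<partial>J)"
proof -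
  interpret prob_space J by fact
  have fst_m [measurable]: "fst \<in> J \<rightarrow>\<^sub>M MY" and snd_m [measurable]: "snd \<in> J \<rightarrow>\<^sub>M MZ"
    by (simp_all add: measurable_cong_sets[OF sets_J refl])
  have space_J: "space J = space MY \<times> space MZ"
    using sets_eq_imp_space_eq[OF sets_J] by (simp add: space_pair_measure)
  let ?PY = "PY MY" and ?PZ = "PZ MZ"
  let ?Q = "?PY \<Otimes>\<^sub>M ?PZ"
  have PY: "prob_space ?PY" and PZ: "prob_space ?PZ"
    unfolding PY_def PZ_def by (auto intro!: prob_space_distr)
  interpret Q: prob_space ?Q
    by (intro prob_space_pair PY PZ)
  interpret JQ: pair_sigma_finite J ?Q
    by unfold_locales
  interpret JQ': prob_space "J \<Otimes>\<^sub>M ?Q"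
    by (intro prob_space_pair prob_space_axioms Q.prob_space_axioms)
  have sets_PY: "sets ?PY = sets MY" and sets_PZ: "sets ?PZ = sets MZ"
    by (simp_all add: PY_def PZ_def)
  have sets_Q: "sets ?Q = sets J"
    unfolding sets_J by (intro sets_pair_measure_cong sets_PY sets_PZ)
  have space_Q: "space ?Q = space J"
    by (rule sets_eq_imp_space_eq[OF sets_Q])
  have space_PY: "space ?PY = space MY" and space_PZ: "space ?PZ = space MZ"
    by (simp_all add: PY_def PZ_def)
  define K where "K = product_kernel gY gZ"
  have K: "K u v = gY (fst u) (fst v) * gZ (snd u) (snd v)" for u v
    by (simp add: K_def product_kernel_def split_beta')
  define f where "f u v = gY (fst u) (fst v)" for u v :: "'y \<times> 'z"
  define g where "g u v = gZ (snd u) (snd v)" for u v :: "'y \<times> 'z"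
  have fm: "(\<lambda>(u, v). f u v) \<in> borel_measurable (J \<Otimes>\<^sub>M J)"
    unfolding f_def by (rule measurable_kernel_compose[OF gY fst_m])
  have gm: "(\<lambda>(u, v). g u v) \<in> borel_measurable (J \<Otimes>\<^sub>M J)"
    unfolding g_def by (rule measurable_kernel_compose[OF gZ snd_m])
  have fC: "\<bar>f u v\<bar> \<le> C" and gD: "\<bar>g u v\<bar> \<le> D" and symf: "f u v = f v u" and symg: "g u v = g v u"
    if "u \<in> space J" "v \<in> space J" for u v
    using that bY bZ symY symZ by (auto simp: f_def g_def space_J)
  have gY1: "gY y \<in> borel_measurable MY" if "y \<in> space MY" for y
    using measurable_compose[OF measurable_Pair1'[OF that] gY] by simp
  have gZ1: "gZ z \<in> borel_measurable MZ" if "z \<in> space MZ" for z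
    using measurable_compose[OF measurable_Pair1'[OF that] gZ] by simp
  define a where "a y = (\<integral>u. gY y u \<partial>?PY)" for y
  define b where "b z = (\<integral>u. gZ z u \<partial>?PZ)" for z
  interpret PY: prob_space ?PY by (rule PY)
  interpret PZ: prob_space ?PZ by (rule PZ)
  have am: "a \<in> borel_measurable MY" and bm: "b \<in> borel_measurable MZ"
    unfolding a_def b_def
    using PY.borel_measurable_lebesgue_integral[of gY MY] PZ.borel_measurable_lebesgue_integral[of gZ MZ] gY gZ
    by (simp_all add: measurable_cong_sets[OF sets_pair_measure_cong[OF refl sets_PY] refl]
        measurable_cong_sets[OF sets_pair_measure_cong[OF refl sets_PZ] refl])
  have aC: "\<bar>a y\<bar> \<le> C" if "y \<in> space MY" for y
    unfolding a_def using that bY by (intro PY.abs_expectation_le) (simp add: space_PY)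
  have bD: "\<bar>b z\<bar> \<le> D" if "z \<in> space MZ" for z
    unfolding b_def using that bZ by (intro PZ.abs_expectation_le) (simp add: space_PZ)
  have a_J: "(\<integral>v. f u v \<partial>J) = a (fst u)" and b_J: "(\<integral>v. g u v \<partial>J) = b (snd u)" if "u \<in> space J" for u
    using that unfolding f_def g_def a_def b_def PY_def PZ_def
    by (auto simp: space_J integral_distr gY1 gZ1)
  have a0: "(\<integral>u. a u \<partial>?PY) = (\<integral>u. a (fst u) \<partial>J)" and b0: "(\<integral>u. b u \<partial>?PZ) = (\<integral>u. b (snd u) \<partial>J)"
    unfolding PY_def PZ_def by (simp_all add: integral_distr am bm)
  have KQ: "(\<integral>v. K u v \<partial>?Q) = a (fst u) * b (snd u)" if u: "u \<in> space J" for u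
    unfolding K a_def b_def using u bY bZ gY1 gZ1
    by (intro integral_pair_measure_product[where C = C and D = D] PY PZ)
      (auto simp: space_J space_PY space_PZ measurable_cong_sets[OF sets_PY refl] measurable_cong_sets[OF sets_PZ refl])
  have T2: "(\<integral>u. (\<integral>v. K u v \<partial>?Q) \<partial>J) = (\<integral>u. a (fst u) * b (snd u) \<partial>J)"
    by (intro Bochner_Integration.integral_cong refl KQ)
  have T4: "(\<integral>u. (\<integral>v. K u v \<partial>?Q) \<partial>?Q) = (\<integral>u. a (fst u) \<partial>J) * (\<integral>u. b (snd u) \<partial>J)"
  proof -
    have "(\<integral>u. (\<integral>v. K u v \<partial>?Q) \<partial>?Q) = (\<integral>u. a (fst u) * b (snd u) \<partial>?Q)"
      by (intro Bochner_Integration.integral_cong refl KQ) (simp add: space_Q)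
    also have "\<dots> = (\<integral>u. a u \<partial>?PY) * (\<integral>u. b u \<partial>?PZ)"
      using aC bD am bm by (intro integral_pair_measure_product[where C = C and D = D] PY PZ)
        (auto simp: space_PY space_PZ measurable_cong_sets[OF sets_PY refl] measurable_cong_sets[OF sets_PZ refl])
    finally show ?thesis
      by (simp add: a0 b0)
  qed
  have T3: "(\<integral>u. (\<integral>v. K u v \<partial>J) \<partial>?Q) = (\<integral>u. a (fst u) * b (snd u) \<partial>J)"
  proof -
    have "(\<integral>v. (\<integral>u. K v u \<partial>J) \<partial>?Q) = (\<integral>u. (\<integral>v. K v u \<partial>?Q) \<partial>J)"
    proof (rule JQ.Fubini_integral)
      have "(\<lambda>w. (\<lambda>(u, v). f u v) w * (\<lambda>(u, v). g u v) w) \<in> borel_measurable (J \<Otimes>\<^sub>M J)"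
        by (intro borel_measurable_times fm gm)
      then have "(\<lambda>w. K (fst w) (snd w)) \<in> borel_measurable (J \<Otimes>\<^sub>M J)"
        by (simp add: K f_def g_def split_beta')
      from measurable_compose[OF measurable_pair_swap' this]
      have "(\<lambda>w. K (snd w) (fst w)) \<in> borel_measurable (J \<Otimes>\<^sub>M J)"
        by (simp add: split_beta')
      then have m: "(\<lambda>(u, v). K v u) \<in> borel_measurable (J \<Otimes>\<^sub>M ?Q)"
        by (simp add: split_beta' measurable_cong_sets[OF sets_pair_measure_cong[OF refl sets_Q] refl])
      show "integrable (J \<Otimes>\<^sub>M ?Q) (\<lambda>(u, v). K v u)"
      proof (rule JQ'.integrable_bounded[OF m])
        fix w assume "w \<in> space (J \<Otimes>\<^sub>M ?Q)"
        then have "\<bar>gY (fst (snd w)) (fst (fst w))\<bar> \<le> \<bar>C\<bar>" "\<bar>gZ (snd (snd w)) (snd (fst w))\<bar> \<le> \<bar>D\<bar>"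
          using bY[of "fst (snd w)" "fst (fst w)"] bZ[of "snd (snd w)" "snd (fst w)"]
          by (auto simp: space_pair_measure space_J space_PY space_PZ)
        then show "\<bar>case w of (u, v) \<Rightarrow> K v u\<bar> \<le> \<bar>C\<bar> * \<bar>D\<bar>"
          unfolding split_beta' K abs_mult by (intro mult_mono) auto
      qed
    qed
    also have "\<dots> = (\<integral>u. (\<integral>v. K u v \<partial>?Q) \<partial>J)"
      using symY symZ by (intro Bochner_Integration.integral_cong refl)
        (auto simp: K space_Q space_J)
    finally show ?thesis
      by (simp add: T2)
  qed
  have "MMD K J ?Q = sqrt ((\<integral>u. (\<integral>v. f u v * g u v \<partial>J) \<partial>J) - 2 * (\<integral>u. a (fst u) * b (snd u) \<partial>J)
      + (\<integral>u. a (fst u) \<partial>J) * (\<integral>u. b (snd u) \<partial>J))"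
    unfolding MMD_def T2 T3 T4 by (simp add: K[abs_def] f_def g_def)
  also have "(\<integral>u. (\<integral>v. f u v * g u v \<partial>J) \<partial>J) - 2 * (\<integral>u. a (fst u) * b (snd u) \<partial>J)
      + (\<integral>u. a (fst u) \<partial>J) * (\<integral>u. b (snd u) \<partial>J)
    = (\<integral>u. (\<integral>v. centered_kernel J f u v * centered_kernel J g u v \<partial>J) \<partial>J)"
  proof -
    have "(\<integral>u. (\<integral>v. centered_kernel J f u v * centered_kernel J g u v \<partial>J) \<partial>J)
        = (\<integral>u. (\<integral>v. f u v * g u v \<partial>J) \<partial>J) - 2 * (\<integral>u. (\<integral>v. f u v \<partial>J) * (\<integral>v. g u v \<partial>J) \<partial>J)
          + (\<integral>u. (\<integral>v. f u v \<partial>J) \<partial>J) * (\<integral>u. (\<integral>v. g u v \<partial>J) \<partial>J)"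
      by (rule integral_centered_product[OF fm gm fC gD symf symg])
    then show ?thesis
      by (simp add: a_J b_J cong: Bochner_Integration.integral_cong)
  qed
  also have "\<dots> = (\<integral>u. (\<integral>v. product_kernel (centered_kernel ?PY gY) (centered_kernel ?PZ gZ) u v \<partial>J) \<partial>J)"
  proof (intro Bochner_Integration.integral_cong refl)
    fix u v assume u: "u \<in> space J" and v: "v \<in> space J"
    have "(\<integral>u. (\<integral>v. f u v \<partial>J) \<partial>J) = (\<integral>u. a u \<partial>?PY)" "(\<integral>u. (\<integral>v. g u v \<partial>J) \<partial>J) = (\<integral>u. b u \<partial>?PZ)"
      unfolding a0 b0 by (auto intro!: Bochner_Integration.integral_cong a_J b_J)
    then show "centered_kernel J f u v * centered_kernel J g u v
        = product_kernel (centered_kernel ?PY gY) (centered_kernel ?PZ gZ) u v"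
      using u v by (simp add: centered_kernel_def a_J b_J product_kernel_def split_beta' a_def[symmetric] b_def[symmetric])
        (simp add: f_def g_def)
  qed
  finally show ?thesis
    by (simp add: K_def)
qed

section \<open>The power of the cheap independence test\<close>

lemma pos_def_kernel_diameter:
  assumes "pos_def_kernel A g" "\<And>u. u \<in> A \<Longrightarrow> g u u \<le> C" "u \<in> A" "v \<in> A"
  shows "g u u + g v v - 2 * g u v \<le> 4 * C"
  using pos_def_kernel_abs_le[OF assms(1,3,4)] assms(2)[OF assms(3)] assms(2)[OF assms(4)] by linarith

text \<open>The supremum of \<open>g y y * h z z\<close> factorizes into the supremum of the first factor and the
  remaining quotient, which bounds the second factor. Both are finite because \<open>K > 0\<close>
  provides a point where neither diagonal vanishes.\<close>

lemma product_kernel_diagonal_bounds: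
  assumes pd: "pos_def_kernel A g" "pos_def_kernel B h" and "A \<noteq> {}" "B \<noteq> {}"
    and bdd: "bdd_above ((\<lambda>x. \<bar>product_kernel g h x x\<bar>) ` (A \<times> B))"
    and K: "K = (SUP x\<in>A \<times> B. \<bar>product_kernel g h x x\<bar>)" "0 < K"
  obtains KY KZ where "0 < KY" "0 < KZ" "KY * KZ = K"
    "\<And>y. y \<in> A \<Longrightarrow> g y y \<le> KY" "\<And>z. z \<in> B \<Longrightarrow> h z z \<le> KZ"
proof -
  have nn: "0 \<le> g y y" "0 \<le> h z z" if "y \<in> A" "z \<in> B" for y z
    using that pos_def_kernel_diag[OF pd(1)] pos_def_kernel_diag[OF pd(2)] by auto
  have le: "g y y * h z z \<le> K" if "y \<in> A" "z \<in> B" for y z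
    unfolding K using cSUP_upper[OF _ bdd, of "(y, z)"] that nn[OF that] by (simp add: product_kernel_def)
  obtain y0 z0 where yz: "y0 \<in> A" "z0 \<in> B" "0 < g y0 y0" "0 < h z0 z0"
  proof -
    obtain x where "x \<in> A \<times> B" "0 < \<bar>product_kernel g h x x\<bar>"
      using less_cSUP_iff[OF _ bdd, of 0] K assms(3,4) by auto
    then show ?thesis
      using that[of "fst x" "snd x"] nn[of "fst x" "snd x"] by (auto simp: product_kernel_def split_beta' less_le)
  qed
  define KY where "KY = (SUP y\<in>A. g y y)"
  have bddY: "bdd_above ((\<lambda>y. g y y) ` A)"
  proof (rule bdd_aboveI2)
    show "g y y \<le> K / h z0 z0" if "y \<in> A" for y
      using le[OF that yz(2)] yz(4) by (simp add: pos_le_divide_eq)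
  qed
  have gY: "g y y \<le> KY" if "y \<in> A" for y
    unfolding KY_def by (rule cSUP_upper[OF that bddY])
  have KY: "0 < KY"
    using gY[OF yz(1)] yz(3) by linarith
  have hZ: "h z z \<le> K / KY" if z: "z \<in> B" for z
  proof (cases "h z z = 0")
    case False
    then have pos: "0 < h z z"
      using nn[OF yz(1) z] by simp
    have "KY \<le> K / h z z"
      unfolding KY_def using le[OF _ z] pos assms(3) by (intro cSUP_least) (auto simp: pos_le_divide_eq)
    then show ?thesis
      using KY pos by (simp add: field_simps)
  qed (use KY K(2) in simp)
  show ?thesis
    by (rule that[OF KY _ _ gY hZ]) (use KY K(2) in auto)
qed

text \<open>For a centered kernel, averaging the squared distance of \<open>x\<close> to \<open>u\<close> over
  \<open>u\<close> gives \<open>g x x\<close> plus the nonnegative mean of \<open>g u u\<close>.\<close>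

lemma (in prob_space) centered_diag_le_diameter:
  fixes g :: "'a \<Rightarrow> 'a \<Rightarrow> real"
  assumes g: "(\<lambda>(u, v). g u v) \<in> borel_measurable (M \<Otimes>\<^sub>M M)" and pd: "pos_def_kernel (space M) g"
    and centered: "\<And>x. x \<in> space M \<Longrightarrow> (\<integral>u. g x u \<partial>M) = 0"
    and diam: "\<And>u v. u \<in> space M \<Longrightarrow> v \<in> space M \<Longrightarrow> g u u + g v v - 2 * g u v \<le> C"
    and x: "x \<in> space M"
  shows "g x x \<le> C"
proof -
  have gx: "g x \<in> borel_measurable M" and gd: "(\<lambda>u. g u u) \<in> borel_measurable M"
    using measurable_compose[OF measurable_Pair1'[OF x] g]
      measurable_compose[OF measurable_Pair[OF measurable_ident measurable_ident] g] by simp_all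
  have bound: "g u u \<le> 2 * (C + g x x)" if u: "u \<in> space M" for u
    using diam[OF u x] pos_def_kernel_two[OF pd u x, of 1 "- 2"] pos_def_kernel_diag[OF pd u]
      pos_def_kernel_diag[OF pd x] by simp
  have diag_int: "integrable M (\<lambda>u. g u u)"
    using bound pos_def_kernel_diag[OF pd] gd by (intro integrable_bounded[where C = "2 * (C + g x x)"]) auto
  have x_int: "integrable M (g x)"
  proof (rule integrable_bounded[OF gx])
    show "\<bar>g x u\<bar> \<le> (g x x + 2 * (C + g x x)) / 2" if u: "u \<in> space M" for u
      using pos_def_kernel_abs_le[OF pd x u] bound[OF u] by simp
  qed
  have "(\<integral>u. g x x + g u u - 2 * g x u \<partial>M) \<le> (\<integral>u. C \<partial>M)"
    using diag_int x_int diam[OF x]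
    by (intro integral_mono Bochner_Integration.integrable_diff Bochner_Integration.integrable_add
        Bochner_Integration.integrable_mult_right) auto
  then have "g x x + (\<integral>u. g u u \<partial>M) \<le> C"
    using diag_int x_int centered[OF x] by (simp add: prob_space)
  moreover have "0 \<le> (\<integral>u. g u u \<partial>M)"
    using pos_def_kernel_diag[OF pd] by (intro integral_nonneg_AE AE_I2)
  ultimately show ?thesis
    by linarith
qed

lemma centered_marginal_kernel:
  fixes g :: "'b \<Rightarrow> 'b \<Rightarrow> real"
  assumes J: "prob_space J" and f: "f \<in> J \<rightarrow>\<^sub>M N"
    and g: "(\<lambda>(u, v). g u v) \<in> borel_measurable (N \<Otimes>\<^sub>M N)" and pd: "pos_def_kernel (space N) g"
    and diag: "\<And>u. u \<in> space N \<Longrightarrow> g u u \<le> C" and "0 < C"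
  defines "c \<equiv> centered_kernel (distr J N f) g"
  shows "(\<lambda>(u, v). c u v) \<in> borel_measurable (N \<Otimes>\<^sub>M N)"
    and "pos_def_kernel (space N) c"
    and "\<And>u. u \<in> space N \<Longrightarrow> (\<integral>x. c u (f x) \<partial>J) = 0"
    and "\<And>u v. u \<in> space N \<Longrightarrow> v \<in> space N \<Longrightarrow> c u u + c v v - 2 * c u v \<le> (2 * sqrt C)\<^sup>2"
    and "\<And>u. u \<in> space N \<Longrightarrow> c u u \<le> (2 * sqrt C)\<^sup>2"
proof -
  let ?M = "distr J N f"
  interpret M: prob_space ?M
    using prob_space.prob_space_distr[OF J f] .
  have sets_M: "sets (?M \<Otimes>\<^sub>M ?M) = sets (N \<Otimes>\<^sub>M N)"
    by (intro sets_pair_measure_cong) simp_all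
  have g_M: "(\<lambda>(u, v). g u v) \<in> borel_measurable (?M \<Otimes>\<^sub>M ?M)"
    using g by (simp add: measurable_cong_sets[OF sets_M refl])
  have bound: "\<bar>g u v\<bar> \<le> C" if "u \<in> space ?M" "v \<in> space ?M" for u v
    using pos_def_kernel_abs_le[OF pd, of u v] diag[of u] diag[of v] that by simp
  have pd_M: "pos_def_kernel (space ?M) g"
    using pd by simp
  note c_M = M.centered_kernel[OF g_M bound pd_M, folded c_def]
  show c_meas: "(\<lambda>(u, v). c u v) \<in> borel_measurable (N \<Otimes>\<^sub>M N)"
    using c_M(1) by (simp add: measurable_cong_sets[OF sets_M refl])
  show "pos_def_kernel (space N) c"
    using c_M(2) by simp
  show diam: "c u u + c v v - 2 * c u v \<le> (2 * sqrt C)\<^sup>2" if "u \<in> space N" "v \<in> space N" for u v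
    using pos_def_kernel_diameter[OF pd diag that] \<open>0 < C\<close> by (simp add: c_def centered_kernel_def)
  show "c u u \<le> (2 * sqrt C)\<^sup>2" if "u \<in> space N" for u
  proof (rule M.centered_diag_le_diameter[OF c_M(1,2,3)])
    show "c v v + c w w - 2 * c v w \<le> (2 * sqrt C)\<^sup>2" if "v \<in> space ?M" "w \<in> space ?M" for v w
      using that by (intro diam) simp_all
  qed (use that in simp_all)
  show "(\<integral>x. c u (f x) \<partial>J) = 0" if u: "u \<in> space N" for u
  proof -
    have "c u \<in> borel_measurable N"
      using measurable_compose[OF measurable_Pair1'[OF u] c_meas] by simp
    then show ?thesis
      using c_M(3)[of u] u f by (simp add: integral_distr)
  qed
qed

text \<open>With \<open>r = sqrt (ln (6 / a) / s)\<close>, the denominator of the threshold is \<open>(1 / 2 - r) *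
  (3 / 2 + r)\<close>, which is at most \<open>2 * (1 / 2 - r)\<close> because the hypothesis on
  \<open>s\<close> amounts to \<open>r < 1 / 2\<close>. After dividing it out, the constants of the
  threshold exceed the needed ones in each of the monomials \<open>1\<close>, \<open>w\<close>,
  \<open>v\<close> and \<open>v w\<close>, where \<open>w = sqrt (ln (1 / a))\<close> and \<open>v = sqrt
  l\<close>.\<close>

lemma separation_threshold:
  fixes \<theta> K a l \<kappa> :: real and n h :: nat
  assumes "8 \<le> n" "0 < h" "0 < K" "0 < a" "a \<le> 1" "0 \<le> l"
    and cond: "1 / 4 + ln (6 / a) / real (2 * h) + sqrt (ln (6 / a) / real (2 * h)) < 1"
    and \<theta>: "(sqrt K * (30 + 22 * sqrt l) *
        (7 / 2 + (1 + 12 * ln (3 / a)) / (6 * sqrt (real (2 * h))) + 2 * sqrt (ln (3 / a)))) /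
      (sqrt n * (3 / 4 - ln (6 / a) / real (2 * h) - sqrt (ln (6 / a) / real (2 * h)))) \<le> \<theta>"
    and \<kappa>: "\<kappa> = sqrt (ln (1 / a) / 2)"
  shows "(4 * sqrt K / sqrt n) * (2 + \<kappa>) * sqrt 2 * sqrt l
    \<le> \<theta> * (1 / 2 - \<kappa> / sqrt h) - (2 * (4 * sqrt K) / n + (2 + sqrt 2 * \<kappa>) * (4 * sqrt K) / sqrt n)"
proof -
  define s where "s = real (2 * h)"
  define r where "r = sqrt (ln (6 / a) / s)"
  define w where "w = sqrt (ln (1 / a))"
  define v where "v = sqrt l"
  define c where "c = sqrt K / sqrt n"
  define d where "d = 3 / 4 - ln (6 / a) / s - r"
  have s: "0 < s"
    using assms by (simp add: s_def)
  have n: "0 < sqrt (real n)" "2 \<le> sqrt (real n)"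
    using assms(1) by (auto intro!: real_le_rsqrt)
  have ln_mono: "ln (1 / a) \<le> ln (3 / a)" "ln (1 / a) \<le> ln (6 / a)" "0 \<le> ln (1 / a)"
    using assms by (auto simp: divide_right_mono)
  have r2: "ln (6 / a) / s = r\<^sup>2"
    using ln_mono s by (simp add: r_def)
  have r: "0 \<le> r" "r < 1 / 2"
  proof -
    show "0 \<le> r"
      using ln_mono s by (simp add: r_def)
    have "(r + 1 / 2)\<^sup>2 < 1\<^sup>2"
      using cond unfolding s_def[symmetric] r_def[symmetric] r2 by (simp add: power2_eq_square algebra_simps)
    then have "r + 1 / 2 < 1"
      by (rule power_less_imp_less_base) simp
    then show "r < 1 / 2"
      by simp
  qed
  have d_eq: "d = (1 / 2 - r) * (3 / 2 + r)"
    by (simp add: d_def r2 power2_eq_square field_simps)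
  have d: "0 < d" "d / 2 \<le> 1 / 2 - r"
  proof -
    show "0 < d"
      unfolding d_eq using r by (intro mult_pos_pos) auto
    have "d \<le> (1 / 2 - r) * 2"
      unfolding d_eq using r by (intro mult_left_mono) auto
    then show "d / 2 \<le> 1 / 2 - r"
      by (simp add: field_simps)
  qed
  have v0: "0 \<le> v" and w0: "0 \<le> w" and c0: "0 < c"
    using assms(3,6) n ln_mono(3) by (auto simp: v_def w_def c_def)
  have scaled: "c * ((30 + 22 * v) * (7 / 2 + 2 * w)) \<le> \<theta> * d"
  proof -
    have "0 \<le> (1 + 12 * ln (3 / a)) / (6 * sqrt s)" and "w \<le> sqrt (ln (3 / a))"
      using ln_mono s by (auto simp: w_def)
    then have "(30 + 22 * v) * (7 / 2 + 2 * w)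
        \<le> (30 + 22 * v) * (7 / 2 + (1 + 12 * ln (3 / a)) / (6 * sqrt s) + 2 * sqrt (ln (3 / a)))"
      using v0 by (intro mult_left_mono) auto
    then have "c * ((30 + 22 * v) * (7 / 2 + 2 * w))
        \<le> c * ((30 + 22 * v) * (7 / 2 + (1 + 12 * ln (3 / a)) / (6 * sqrt s) + 2 * sqrt (ln (3 / a))))"
      by (rule mult_left_mono) (use c0 in simp)
    also have "\<dots> \<le> \<theta> * d"
    proof -
      have "sqrt K * (30 + 22 * v) * (7 / 2 + (1 + 12 * ln (3 / a)) / (6 * sqrt s) + 2 * sqrt (ln (3 / a))) / (sqrt n * d) \<le> \<theta>"
        using \<theta> unfolding s_def[symmetric] r_def[symmetric] d_def[symmetric] v_def[symmetric] .
      then show ?thesis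
        using n d by (simp add: c_def pos_divide_le_eq mult_ac)
    qed
    finally show ?thesis .
  qed
  have \<theta>0: "0 \<le> \<theta>"
  proof -
    have "0 \<le> c * ((30 + 22 * v) * (7 / 2 + 2 * w))"
      using c0 v0 w0 by (intro mult_nonneg_nonneg) auto
    then have "0 \<le> \<theta> * d"
      using scaled by (rule order_trans)
    then show ?thesis
      using d(1) by (simp add: zero_le_mult_iff)
  qed
  have \<kappa>w: "sqrt 2 * \<kappa> = w"
    by (simp add: \<kappa> w_def real_sqrt_divide)
  have \<kappa>h: "\<kappa> / sqrt h \<le> r"
  proof -
    have "\<kappa> / sqrt h = sqrt (ln (1 / a) / s)"
      by (simp add: \<kappa> s_def real_sqrt_divide real_sqrt_mult)
    also have "\<dots> \<le> r"
      unfolding r_def using ln_mono s by (intro real_sqrt_le_mono divide_right_mono) auto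
    finally show ?thesis .
  qed
  have "\<theta> * (d / 2) \<le> \<theta> * (1 / 2 - \<kappa> / sqrt h)"
    by (rule mult_left_mono[OF order_trans[OF d(2)] \<theta>0]) (use \<kappa>h in linarith)
  then have main: "c * ((15 + 11 * v) * (7 / 2 + 2 * w)) \<le> \<theta> * (1 / 2 - \<kappa> / sqrt h)"
    using scaled by (simp add: algebra_simps)
  have e1: "2 * (4 * sqrt K) / n \<le> 4 * c"
  proof -
    have "2 * (4 * sqrt K) / n = 8 * c / sqrt n"
      using n by (simp add: c_def divide_simps)
    also have "\<dots> \<le> 8 * c / 2"
      using n c0 by (intro divide_left_mono) auto
    finally show ?thesis
      by simp
  qed
  have e2: "(2 + sqrt 2 * \<kappa>) * (4 * sqrt K) / sqrt n = c * (8 + 4 * w)"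
    unfolding \<kappa>w by (simp add: c_def algebra_simps add_divide_distrib)
  have e3: "(4 * sqrt K / sqrt n) * (2 + \<kappa>) * sqrt 2 * sqrt l \<le> c * ((12 + 4 * w) * v)"
  proof -
    have "(4 * sqrt K / sqrt n) * (2 + \<kappa>) * sqrt 2 * sqrt l = c * ((8 * sqrt 2 + 4 * (sqrt 2 * \<kappa>)) * v)"
      by (simp add: c_def v_def algebra_simps add_divide_distrib)
    also have "\<dots> \<le> c * ((12 + 4 * w) * v)"
    proof -
      have "sqrt 2 \<le> 3 / 2"
        by (rule real_le_lsqrt) (auto simp: power2_eq_square)
      then show ?thesis
        unfolding \<kappa>w using c0 v0 by (intro mult_left_mono mult_right_mono) auto
    qed
    finally show ?thesis .
  qed
  have "c * ((12 + 4 * w) * v) + (4 * c + c * (8 + 4 * w)) \<le> c * ((15 + 11 * v) * (7 / 2 + 2 * w))"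
  proof -
    have "(15 + 11 * v) * (7 / 2 + 2 * w) = 105 / 2 + 30 * w + 77 / 2 * v + 22 * (v * w)"
      by (simp add: field_simps)
    moreover have "(12 + 4 * w) * v + (4 + (8 + 4 * w)) = 12 + 4 * w + 12 * v + 4 * (v * w)"
      by (simp add: algebra_simps)
    ultimately have "(12 + 4 * w) * v + (4 + (8 + 4 * w)) \<le> (15 + 11 * v) * (7 / 2 + 2 * w)"
      using v0 w0 mult_nonneg_nonneg[OF v0 w0] by linarith
    from mult_left_mono[OF this, of c] show ?thesis
      using c0 by (simp add: algebra_simps)
  qed
  then show ?thesis
    using main e1 e2 e3 by linarith
qed

theorem theorem4:
  fixes MY :: "'y measure" and MZ :: "'z measure"
    and J :: "('y \<times> 'z) measure"
    and gY :: "'y \<Rightarrow> 'y \<Rightarrow> real" and gZ :: "'z \<Rightarrow> 'z \<Rightarrow> real"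
    and \<alpha> \<beta> K a :: real and n s B :: nat
  assumes "prob_space J" and "sets J = sets (MY \<Otimes>\<^sub>M MZ)"
    and "0 < \<alpha>" "\<alpha> < 1" and "0 < \<beta>" "\<beta> < 1"
    and "8 \<le> n" and "even s" and "s dvd n"
    and "1 / \<alpha> - 1 \<le> real B"
    and "(\<lambda>(y, y'). gY y y') \<in> borel_measurable (MY \<Otimes>\<^sub>M MY)"
    and "(\<lambda>(z, z'). gZ z z') \<in> borel_measurable (MZ \<Otimes>\<^sub>M MZ)"
    and "pos_def_kernel (space MY) gY" and "pos_def_kernel (space MZ) gZ"
    and "psi1 J n gY gZ < \<infinity>" and "psi1_tilde J n gY gZ < \<infinity>" and "psi2 J n gY gZ < \<infinity>"
    and "bdd_above ((\<lambda>x. \<bar>product_kernel gY gZ x x\<bar>) ` space J)"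
    and "K = (SUP x\<in>space J. \<bar>product_kernel gY gZ x x\<bar>)" and "0 < K"
    and "a = alpha_star \<alpha> \<beta> B"
    and "1 / 4 + ln (6 / a) / real s + sqrt (ln (6 / a) / real s) < 1"
    and "MMD (product_kernel gY gZ) J (distr J MY fst \<Otimes>\<^sub>M distr J MZ snd) \<ge>
           (sqrt K * (30 + 22 * sqrt (ln (12 / \<beta>))) *
             (7 / 2 + (1 + 12 * ln (3 / a)) / (6 * sqrt (real s)) + 2 * sqrt (ln (3 / a)))) /
           (sqrt (real n) * (3 / 4 - ln (6 / a) / real s - sqrt (ln (6 / a) / real s)))"
  shows "cheap_test_power J gY gZ n s B \<alpha> \<ge> 1 - \<beta>"
proof -
  define h where "h = s div 2"
  define m where "m = n div s"
  have s: "s = 2 * h"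
    using \<open>even s\<close> by (simp add: h_def)
  have n_eq: "n = 2 * h * m"
    using \<open>s dvd n\<close> by (simp add: m_def s[symmetric])
  have hm: "0 < h" "0 < m"
    using \<open>8 \<le> n\<close> n_eq by (auto intro: gr0I)
  interpret J: prob_space J by fact
  have space_J: "space J = space MY \<times> space MZ"
    using sets_eq_imp_space_eq[OF \<open>sets J = sets (MY \<Otimes>\<^sub>M MZ)\<close>] by (simp add: space_pair_measure)
  have fst_m [measurable]: "fst \<in> J \<rightarrow>\<^sub>M MY" and snd_m [measurable]: "snd \<in> J \<rightarrow>\<^sub>M MZ"
    by (simp_all add: measurable_cong_sets[OF \<open>sets J = sets (MY \<Otimes>\<^sub>M MZ)\<close> refl])
  note pdY = \<open>pos_def_kernel (space MY) gY\<close> and pdZ = \<open>pos_def_kernel (space MZ) gZ\<close>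
  have ne: "space MY \<noteq> {}" "space MZ \<noteq> {}"
    using J.not_empty by (auto simp: space_J)
  obtain KY KZ where KY: "0 < KY" "\<And>y. y \<in> space MY \<Longrightarrow> gY y y \<le> KY"
    and KZ: "0 < KZ" "\<And>z. z \<in> space MZ \<Longrightarrow> gZ z z \<le> KZ" and KK: "KY * KZ = K"
    using product_kernel_diagonal_bounds[OF pdY pdZ ne assms(18,19)[unfolded space_J] assms(20)] by blast
  have bY: "\<bar>gY u v\<bar> \<le> KY" if "u \<in> space MY" "v \<in> space MY" for u v
    using pos_def_kernel_abs_le[OF pdY that] KY(2)[OF that(1)] KY(2)[OF that(2)] by linarith
  have bZ: "\<bar>gZ u v\<bar> \<le> KZ" if "u \<in> space MZ" "v \<in> space MZ" for u v
    using pos_def_kernel_abs_le[OF pdZ that] KZ(2)[OF that(1)] KZ(2)[OF that(2)] by linarith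
  define cY where "cY = centered_kernel (distr J MY fst) gY"
  define cZ where "cZ = centered_kernel (distr J MZ snd) gZ"
  note cY = centered_marginal_kernel[OF assms(1) fst_m assms(11) pdY KY(2,1), folded cY_def]
  note cZ = centered_marginal_kernel[OF assms(1) snd_m assms(12) pdZ KZ(2,1), folded cZ_def]
  \<comment> \<open>Features of norm at most \<open>sqrt KY\<close> are at most \<open>2 * sqrt KY\<close> apart.\<close>
  interpret S: paired_sample n m h MY MZ cY cZ "2 * sqrt KY" "2 * sqrt KZ" J
    by unfold_locales (use n_eq hm KY(1) KZ(1) assms(2) cY cZ in auto)
  have D: "S.D = 4 * sqrt K"
    by (simp add: S.D_def KK[symmetric] real_sqrt_mult)
  have \<theta>: "MMD (product_kernel gY gZ) J (distr J MY fst \<Otimes>\<^sub>M distr J MZ snd) = S.\<theta>"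
  proof -
    have "MMD (product_kernel gY gZ) J (distr J MY fst \<Otimes>\<^sub>M distr J MZ snd)
        = sqrt (\<integral>u. (\<integral>v. product_kernel cY cZ u v \<partial>J) \<partial>J)"
      unfolding cY_def cZ_def using assms(1,2,11,12)
      by (intro MMD_product_eq[where C = KY and D = KZ] bY bZ pos_def_kernel_sym[OF pdY] pos_def_kernel_sym[OF pdZ])
    then show ?thesis
      by (simp add: S.\<theta>_def S.\<theta>sq_def)
  qed
  have B: "1 \<le> \<alpha> * (real B + 1)"
    using assms(3,10) by (simp add: field_simps)
  have a: "0 < a" "a \<le> 1"
  proof -
    show "0 < a"
      using assms(3,5) by (simp add: assms(21) alpha_star_def)
    have "(\<beta> / 3) powr (1 / real_of_int \<lfloor>\<alpha> * (real B + 1)\<rfloor>) \<le> 1"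
      using assms(5,6) B by (intro powr_le1) auto
    moreover have "\<alpha> / (2 * exp 1) \<le> 1"
      using assms(3,4) exp_ge_add_one_self[of 1] by (simp add: pos_divide_le_eq)
    ultimately show "a \<le> 1"
      unfolding assms(21) alpha_star_def using assms(3) by (intro mult_le_one) auto
  qed
  have a1: "a < 1"
  proof -
    have "a \<le> \<alpha> / (2 * exp 1) * 1"
      unfolding assms(21) alpha_star_def using assms(3,5,6) B by (intro mult_left_mono powr_le1) auto
    also have "\<dots> < 1"
      using assms(3,4) exp_ge_add_one_self[of 1] by (simp add: pos_divide_less_eq)
    finally show ?thesis .
  qed
  define \<kappa> where "\<kappa> = sqrt (ln (1 / a) / 2)"
  define l where "l = ln (12 / \<beta>)"
  \<comment> \<open>The deviation for which McDiarmid's bound for the data equals \<open>exp (- l) = \<beta> / 12\<close>.\<close>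
  define t where "t = (S.D / sqrt n) * (2 + \<kappa>) * sqrt 2 * sqrt l"
  have l: "0 < l"
    using assms(5,6) by (simp add: l_def)
  have \<kappa>: "0 < \<kappa>"
    using a(1) a1 by (simp add: \<kappa>_def)
  have t: "0 < t"
    using S.D_pos \<open>8 \<le> n\<close> \<kappa> l by (simp add: t_def)
  have "1 - \<beta> \<le> cheap_test_power J cY cZ n (2 * h) B \<alpha>"
  proof (rule S.power_ge[OF \<kappa> t])
    show "t \<le> S.\<theta> * (1 / 2 - \<kappa> / sqrt h) - (2 * S.D / n + (2 + sqrt 2 * \<kappa>) * S.D / sqrt n)"
      unfolding t_def D using assms(22,23) l hm a \<open>8 \<le> n\<close> \<open>0 < K\<close>
      by (intro separation_threshold[where a = a]) (simp_all add: \<theta> l_def \<kappa>_def s)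
    have "real n * t\<^sup>2 / (2 * S.D\<^sup>2 * (2 + \<kappa>)\<^sup>2) = l"
      using S.D_pos \<open>8 \<le> n\<close> \<kappa> l by (simp add: t_def power_mult_distrib power_divide)
    then have "exp (- (real n * t\<^sup>2) / (2 * S.D\<^sup>2 * (2 + \<kappa>)\<^sup>2)) = \<beta> / 12"
      using assms(5) by (simp add: l_def exp_minus)
    then show "exp (- (real n * t\<^sup>2) / (2 * S.D\<^sup>2 * (2 + \<kappa>)\<^sup>2)) \<le> 2 * \<beta> / 3"
      using assms(5) by simp
    have "exp (- 2 * \<kappa>\<^sup>2) = a"
      using a a1 by (simp add: \<kappa>_def ln_div)
    then show "exp (- 2 * \<kappa>\<^sup>2) \<le> alpha_star \<alpha> \<beta> B"
      by (simp add: assms(21))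
  qed (use assms B in auto)
  moreover have "test_stat cY cZ n s = test_stat gY gZ n s"
    by (simp add: fun_eq_iff test_stat_def cY_def cZ_def V_stat_centered_kernel)
  then have "cheap_test_power J cY cZ n (2 * h) B \<alpha> = cheap_test_power J gY gZ n s B \<alpha>"
    by (simp add: cheap_test_power_def s)
  ultimately show ?thesis
    by simp
qed

end
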